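(* Let $(E_7)^{\lambda\gamma}=\{\alpha\in E_7\mid(\lambda\gamma)\alpha(\lambda\gamma)^{-1}=\alpha\}$ and $(E_7)^{\iota\gamma_C}=\{\alpha\in E_7\mid(\iota\gamma_C)\alpha(\iota\gamma_C)^{-1}=\alpha\}$. Then $$(E_7)^{\lambda\gamma}\cap (E_7)^{\iota\gamma_C}\;\cong\;(SO(8)/\mathbf{Z}_2)\times\mathcal{Z}_2,\qquad \mathbf{Z}_2=\{E,-E\},\quad \mathcal{Z}_2=\{1,-1\}.$$
   Context: Let $\mathbf{H}$ be the quaternions with basis $1,e_1,e_2,e_3=e_1e_2$, $\mathbf{C}=\mathbf{R}\oplus\mathbf{R}e_1$, $\mathbf{H}=\mathbf{C}\oplus\mathbf{C}e_2$, and $\mathfrak{C}=\mathbf{H}\oplus\mathbf{H}e_4$ the division Cayley algebra with product $(m+ae_4)(n+be_4)=(mn-\overline{b}a)+(a\overline{n}+bm)e_4$. Let $\mathfrak{J}=\{X\in M(3,\mathfrak{C})\mid X^*=X\}$, $\mathfrak{J}^C=\mathfrak{J}\oplus i\mathfrak{J}$ its complexification ($C=\mathbf{R}\oplus\mathbf{R}i$), $\tau$ the complex conjugation, $X\circ Y=\frac12(XY+YX)$, $(X,Y)=\mathrm{tr}(X\circ Y)$, $X\times Y=\frac12\big(2X\circ Y-\mathrm{tr}(X)Y-\mathrm{tr}(Y)X+(\mathrm{tr}(X)\mathrm{tr}(Y)-(X,Y))E\big)$, $\langle X,Y\rangle=(\tau X,Y)$. Let ${\mathfrak{e}_6}^C=\{\phi\in\mathrm{Hom}_C(\mathfrak{J}^C,\mathfrak{J}^C)\mid(\phi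 X,X\times X)=0\}$, and ${}^t\phi$ the transpose with respect to $(X,Y)$. For $X,W\in\mathfrak{J}^C$ define $X\vee W\in{\mathfrak{e}_6}^C$ by $(X\vee W)U=\frac12(W,U)X+\frac16(X,W)U-2W\times(X\times U)$. Let $\mathfrak{P}^C=\mathfrak{J}^C\oplus\mathfrak{J}^C\oplus C\oplus C$ with $\langle P,Q\rangle=\langle X,Z\rangle+\langle Y,W\rangle+(\tau\xi)\zeta+(\tau\eta)\omega$ for $P=(X,Y,\xi,\eta)$, $Q=(Z,W,\zeta,\omega)$. For $\phi\in{\mathfrak{e}_6}^C$, $A,B\in\mathfrak{J}^C$, $\nu\in C$ define $\varPhi(\phi,A,B,\nu):\mathfrak{P}^C\to\mathfrak{P}^C$ by $(X,Y,\xi,\eta)\mapsto(\phi X-\frac13\nu X+2B\times Y+\eta A,\ 2A\times X-{}^t\phi Y+\frac13\nu Y+\xi B,\ (A,Y)+\nu\xi,\ (B,X)-\nu\eta)$. Define $P\times Q=\varPhi(\phi,A,B,\nu)$ with $\phi=-\frac12(X\vee W+Z\vee Y)$, $A=-\frac14(2Y\times W-\xi Z-\zeta X)$, $B=\frac14(2X\times Z-\eta W-\omega Y)$, $\nu=\frac18((X,W)+(Z,Y)-3(\xi\omega+\zeta\eta))$. Then $E_7=\{\alpha\in\mathrm{Iso}_C(\mathfrak{P}^C)\mid\alpha(P\times Q)\alpha^{-1}=\alpha P\times\alpha Q,\ \langle\alpha P,\alpha Q\rangle=\langle P,Q\rangle\}$. Elements of $E_7$: $\gamma(X,Y,\xi,\eta)=(\gamma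 X,\gamma Y,\xi,\eta)$ and $\gamma_C(X,Y,\xi,\eta)=(\gamma_CX,\gamma_CY,\xi,\eta)$, where on $\mathfrak{J}^C$ they act entrywise ($C$-linearly) by $\gamma(x+ye_4)=x-ye_4$ ($x,y\in\mathbf{H}$) and $\gamma_C(x+ye_4)=\gamma_Cx+(\gamma_Cy)e_4$ with $\gamma_C(a+be_2)=\overline a+\overline be_2$ ($a,b\in\mathbf{C}$); $\lambda(X,Y,\xi,\eta)=(Y,-X,\eta,-\xi)$; $\iota(X,Y,\xi,\eta)=(-iX,iY,-i\xi,i\eta)$. $-1$ denotes the central element $-\mathrm{id}$ of $E_7$, and $\mathcal{Z}_2=\{1,-1\}$. *)

theory Defs
  imports "HOL-Analysis.Analysis" "HOL-Algebra.Coset"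
begin

section \<open>Quaternions and Cayley algebra over a coefficient ring\<close>

text \<open>
  Both algebras are defined over an arbitrary commutative coefficient ring, so that
  \<open>real cayley\<close> is the division Cayley algebra and \<open>complex cayley\<close> its complexification.
  The four quaternion coordinates refer to the basis \<open>1, e\<^sub>1, e\<^sub>2, e\<^sub>3 = e\<^sub>1 e\<^sub>2\<close>; in particular
  the scalar \<open>i\<close> in a coefficient of \<open>complex cayley\<close> is unrelated to \<open>e\<^sub>1\<close>. A pair \<open>(m, a)\<close> of
  quaternions stands for \<open>m + a e\<^sub>4\<close>.
\<close>

type_synonym 'a quat = "'a \<times> 'a \<times> 'a \<times> 'a"
type_synonym 'a cayley = "'a quat \<times> 'a quat"

fun qmult :: "'a::comm_ring_1 quat \<Rightarrow> 'a quat \<Rightarrow> 'a quat" where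
  "qmult (a0, a1, a2, a3) (b0, b1, b2, b3) =
    (a0 * b0 - a1 * b1 - a2 * b2 - a3 * b3,
     a0 * b1 + a1 * b0 + a2 * b3 - a3 * b2,
     a0 * b2 - a1 * b3 + a2 * b0 + a3 * b1,
     a0 * b3 + a1 * b2 - a2 * b1 + a3 * b0)"

fun qconj :: "'a::comm_ring_1 quat \<Rightarrow> 'a quat" where
  "qconj (a0, a1, a2, a3) = (a0, - a1, - a2, - a3)"

fun quat_map :: "('a \<Rightarrow> 'b) \<Rightarrow> 'a quat \<Rightarrow> 'b quat" where
  "quat_map f (a0, a1, a2, a3) = (f a0, f a1, f a2, f a3)"

fun cmult :: "'a::comm_ring_1 cayley \<Rightarrow> 'a cayley \<Rightarrow> 'a cayley" where
  "cmult (m, a) (n, b) = (qmult m n - qmult (qconj b) a, qmult a (qconj n) + qmult b m)"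

fun cconj :: "'a::comm_ring_1 cayley \<Rightarrow> 'a cayley" where
  "cconj (m, a) = (qconj m, - a)"

fun cayley_map :: "('a \<Rightarrow> 'b) \<Rightarrow> 'a cayley \<Rightarrow> 'b cayley" where
  "cayley_map f (m, a) = (quat_map f m, quat_map f a)"

definition cone :: "'a::comm_ring_1 cayley" where
  "cone = ((1, 0, 0, 0), 0)"

fun creal :: "'a cayley \<Rightarrow> 'a" where
  "creal ((a0, a1, a2, a3), b) = a0"

fun cgamma :: "'a::comm_ring_1 cayley \<Rightarrow> 'a cayley" where
  "cgamma (m, a) = (m, - a)"

text \<open>
  For \<open>a = a0 + a1 e\<^sub>1\<close> and \<open>b = a2 + a3 e\<^sub>1\<close> one has \<open>a + b e\<^sub>2 = a0 + a1 e\<^sub>1 + a2 e\<^sub>2 + a3 e\<^sub>3\<close>,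
  so conjugating \<open>a\<close> and \<open>b\<close> flips the signs of \<open>a1\<close> and \<open>a3\<close>.
\<close>

fun qgammaC :: "'a::comm_ring_1 quat \<Rightarrow> 'a quat" where
  "qgammaC (a0, a1, a2, a3) = (a0, - a1, a2, - a3)"

fun cgammaC :: "'a::comm_ring_1 cayley \<Rightarrow> 'a cayley" where
  "cgammaC (m, a) = (qgammaC m, qgammaC a)"


lemma qconj_add: "qconj (x + y) = qconj x + qconj y"
  and qconj_minus: "qconj (- x) = - qconj x"
  and qconj_diff: "qconj (x - y) = qconj x - qconj y"
  and qconj_qconj: "qconj (qconj x) = x"
  and qconj_qmult: "qconj (qmult x y) = qmult (qconj y) (qconj x)"
  and qmult_minus: "qmult x (- y) = - qmult x y" "qmult (- x) y = - qmult x y"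
  by (cases x; cases y; simp add: algebra_simps)+

lemma cconj_0: "cconj 0 = 0"
  by (simp add: zero_prod_def)

lemma cconj_add: "cconj (x + y) = cconj x + cconj y"
  by (cases x rule: prod.exhaust; cases y rule: prod.exhaust; simp add: qconj_add)

lemma cconj_minus: "cconj (- x) = - cconj x"
  by (cases x rule: prod.exhaust; simp add: qconj_minus)

lemma cconj_diff: "cconj (x - y) = cconj x - cconj y"
  by (cases x rule: prod.exhaust; cases y rule: prod.exhaust; simp add: qconj_diff)

lemma cconj_cmult: "cconj (cmult x y) = cmult (cconj y) (cconj x)"
  by (cases x rule: prod.exhaust; cases y rule: prod.exhaust;
      simp add: qconj_diff qconj_qmult qconj_qconj qmult_minus qconj_minus)

lemma cconj_cayley_map:
  assumes "\<And>t. f (- t) = - f t"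
  shows "cconj (cayley_map f x) = cayley_map f (cconj x)"
  by (cases x) (auto simp: assms)

lemma cconj_sum: "cconj (sum f A) = (\<Sum>k\<in>A. cconj (f k))"
  by (induction A rule: infinite_finite_induct) (simp_all add: cconj_add cconj_0)


section \<open>The Jordan algebra and its complexification\<close>

definition cmat_mult :: "'a::comm_ring_1 cayley^3^3 \<Rightarrow> 'a cayley^3^3 \<Rightarrow> 'a cayley^3^3" where
  "cmat_mult X Y = (\<chi> i j. \<Sum>k\<in>UNIV. cmult (X $ i $ k) (Y $ k $ j))"

definition cmat_adj :: "'a::comm_ring_1 cayley^3^3 \<Rightarrow> 'a cayley^3^3" where
  "cmat_adj X = (\<chi> i j. cconj (X $ j $ i))"

definition jordan :: "(real cayley^3^3) set" where
  "jordan = {X. cmat_adj X = X}"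

definition jordan_complexification :: "(complex cayley^3^3) set" where
  "jordan_complexification =
    {map_matrix (cayley_map complex_of_real) X
       + map_matrix (cayley_map (\<lambda>t. \<i> * complex_of_real t)) Y |X Y. X \<in> jordan \<and> Y \<in> jordan}"

lemma jordan_complexification_eq: "jordan_complexification = {X. cmat_adj X = X}"
proof (intro equalityI subsetI)
  fix Z assume "Z \<in> jordan_complexification"
  then obtain X Y where Z: "Z = map_matrix (cayley_map complex_of_real) X
       + map_matrix (cayley_map (\<lambda>t. \<i> * complex_of_real t)) Y"
    and "\<forall>i j. cconj (X $ j $ i) = X $ i $ j" "\<forall>i j. cconj (Y $ j $ i) = Y $ i $ j"
    by (auto simp: jordan_complexification_def jordan_def cmat_adj_def vec_eq_iff)
  then have "cconj (Z $ j $ i) = Z $ i $ j" for i j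
    by (simp add: Z cconj_add cconj_cayley_map)
  then show "Z \<in> {X. cmat_adj X = X}" by (simp add: cmat_adj_def vec_eq_iff)
next
  fix Z :: "complex cayley^3^3" assume "Z \<in> {X. cmat_adj X = X}"
  then have Z: "\<forall>i j. cconj (Z $ j $ i) = Z $ i $ j" by (simp add: cmat_adj_def vec_eq_iff)
  define X where "X = map_matrix (cayley_map Re) Z"
  define Y where "Y = map_matrix (cayley_map Im) Z"
  have "X \<in> jordan" "Y \<in> jordan"
    using Z by (simp_all add: jordan_def cmat_adj_def vec_eq_iff X_def Y_def cconj_cayley_map)
  moreover have "cayley_map complex_of_real (cayley_map Re z)
      + cayley_map (\<lambda>t. \<i> * complex_of_real t) (cayley_map Im z) = z" for z
    by (cases z; cases "fst z") (auto simp: complex_eq_iff)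
  then have "Z = map_matrix (cayley_map complex_of_real) X
       + map_matrix (cayley_map (\<lambda>t. \<i> * complex_of_real t)) Y"
    by (simp add: X_def Y_def vec_eq_iff)
  ultimately show "Z \<in> jordan_complexification"
    unfolding jordan_complexification_def by blast
qed

typedef jordanC = jordan_complexification
  unfolding jordan_complexification_eq
  by (rule exI[of _ 0]) (auto simp: cmat_adj_def vec_eq_iff zero_prod_def)

setup_lifting type_definition_jordanC

lemma mem_jordan_complexification:
  "X \<in> jordan_complexification \<longleftrightarrow> (\<forall>i j. cconj (X $ j $ i) = X $ i $ j)"
  by (simp add: jordan_complexification_eq cmat_adj_def vec_eq_iff)

instantiation jordanC :: ab_group_add
begin

lift_definition zero_jordanC :: jordanC is 0
  by (simp add: mem_jordan_complexification cconj_0)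

lift_definition plus_jordanC :: "jordanC \<Rightarrow> jordanC \<Rightarrow> jordanC" is "(+)"
  by (simp add: mem_jordan_complexification cconj_add)

lift_definition minus_jordanC :: "jordanC \<Rightarrow> jordanC \<Rightarrow> jordanC" is "(-)"
  by (simp add: mem_jordan_complexification cconj_diff)

lift_definition uminus_jordanC :: "jordanC \<Rightarrow> jordanC" is uminus
  by (simp add: mem_jordan_complexification cconj_minus)

instance
  by standard (transfer; simp add: algebra_simps)+

end

instantiation jordanC :: topological_space
begin

definition open_jordanC :: "jordanC set \<Rightarrow> bool" where
  "open_jordanC U \<longleftrightarrow> (\<exists>V. open V \<and> U = Rep_jordanC -` V)"

instance
proof
  show "open (UNIV :: jordanC set)"
    unfolding open_jordanC_def by (rule exI[of _ UNIV]) simp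
next
  fix S T :: "jordanC set"
  assume "open S" "open T"
  then obtain V W where "open V" "S = Rep_jordanC -` V" "open W" "T = Rep_jordanC -` W"
    unfolding open_jordanC_def by blast
  then show "open (S \<inter> T)"
    unfolding open_jordanC_def by (intro exI[of _ "V \<inter> W"]) auto
next
  fix K :: "jordanC set set"
  assume "\<forall>S\<in>K. open S"
  then obtain V where "\<forall>S\<in>K. open (V S) \<and> S = Rep_jordanC -` V S"
    unfolding open_jordanC_def by metis
  then show "open (\<Union>K)"
    unfolding open_jordanC_def by (intro exI[of _ "\<Union>(V ` K)"]) auto
qed

end

lift_definition jscale :: "complex \<Rightarrow> jordanC \<Rightarrow> jordanC" is
  "\<lambda>c. map_matrix (cayley_map ((*) c))"
  by (simp add: mem_jordan_complexification cconj_cayley_map)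

text \<open>Complex conjugation acts on the coefficients, not on the Cayley units.\<close>

lift_definition jtau :: "jordanC \<Rightarrow> jordanC" is "map_matrix (cayley_map cnj)"
  by (simp add: mem_jordan_complexification cconj_cayley_map)

lift_definition jE :: jordanC is "\<chi> i j. if i = j then cone else 0"
  by (auto simp: mem_jordan_complexification cone_def zero_prod_def)

text \<open>
  The diagonal entries of a Hermitian matrix are scalars; \<open>creal\<close> reads off the scalar.
\<close>

lift_definition jtr :: "jordanC \<Rightarrow> complex" is "\<lambda>X. \<Sum>i\<in>UNIV. creal (X $ i $ i)" .

lift_definition jcirc :: "jordanC \<Rightarrow> jordanC \<Rightarrow> jordanC" is
  "\<lambda>X Y. map_matrix (cayley_map ((*) (1 / 2))) (cmat_mult X Y + cmat_mult Y X)"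
  by (simp add: mem_jordan_complexification cmat_mult_def cconj_cayley_map cconj_add
      cconj_sum cconj_cmult add.commute)

definition jform :: "jordanC \<Rightarrow> jordanC \<Rightarrow> complex" where
  "jform X Y = jtr (jcirc X Y)"

definition jherm :: "jordanC \<Rightarrow> jordanC \<Rightarrow> complex" where
  "jherm X Y = jform (jtau X) Y"

definition jcross :: "jordanC \<Rightarrow> jordanC \<Rightarrow> jordanC" where
  "jcross X Y = jscale (1 / 2)
    (jscale 2 (jcirc X Y) - jscale (jtr X) Y - jscale (jtr Y) X
      + jscale (jtr X * jtr Y - jform X Y) jE)"

definition jvee :: "jordanC \<Rightarrow> jordanC \<Rightarrow> jordanC \<Rightarrow> jordanC" where
  "jvee X W U = jscale (1 / 2 * jform W U) X + jscale (1 / 6 * jform X W) U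
    - jscale 2 (jcross W (jcross X U))"

text \<open>Unique for every linear \<open>\<phi>\<close>, because the bilinear form \<open>jform\<close> is nondegenerate.\<close>

definition jtranspose :: "(jordanC \<Rightarrow> jordanC) \<Rightarrow> (jordanC \<Rightarrow> jordanC)" where
  "jtranspose \<phi> = (THE \<psi>. \<forall>X Y. jform (\<phi> X) Y = jform X (\<psi> Y))"

lift_definition jgamma :: "jordanC \<Rightarrow> jordanC" is "map_matrix cgamma"
proof -
  have "cconj (cgamma x) = cgamma (cconj x)" for x :: "complex cayley"
    by (cases x) simp
  then show "\<And>X. X \<in> jordan_complexification \<Longrightarrow> map_matrix cgamma X \<in> jordan_complexification"
    by (simp add: mem_jordan_complexification)
qed

lift_definition jgammaC :: "jordanC \<Rightarrow> jordanC" is "map_matrix cgammaC"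
proof -
  have "cconj (cgammaC x) = cgammaC (cconj x)" for x :: "complex cayley"
    by (cases x) auto
  then show "\<And>X. X \<in> jordan_complexification \<Longrightarrow> map_matrix cgammaC X \<in> jordan_complexification"
    by (simp add: mem_jordan_complexification)
qed


section \<open>The Freudenthal vector space and the compact group of type E7\<close>

type_synonym freudC = "jordanC \<times> jordanC \<times> complex \<times> complex"

fun pscale :: "complex \<Rightarrow> freudC \<Rightarrow> freudC" where
  "pscale c (X, Y, \<xi>, \<eta>) = (jscale c X, jscale c Y, c * \<xi>, c * \<eta>)"

fun pherm :: "freudC \<Rightarrow> freudC \<Rightarrow> complex" where
  "pherm (X, Y, \<xi>, \<eta>) (Z, W, \<zeta>, \<omega>) = jherm X Z + jherm Y W + cnj \<xi> * \<zeta> + cnj \<eta> * \<omega>"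

fun Phi :: "(jordanC \<Rightarrow> jordanC) \<Rightarrow> jordanC \<Rightarrow> jordanC \<Rightarrow> complex \<Rightarrow> freudC \<Rightarrow> freudC" where
  "Phi \<phi> A B \<nu> (X, Y, \<xi>, \<eta>) =
    (\<phi> X - jscale (1 / 3 * \<nu>) X + jscale 2 (jcross B Y) + jscale \<eta> A,
     jscale 2 (jcross A X) - jtranspose \<phi> Y + jscale (1 / 3 * \<nu>) Y + jscale \<xi> B,
     jform A Y + \<nu> * \<xi>,
     jform B X - \<nu> * \<eta>)"

fun pcross :: "freudC \<Rightarrow> freudC \<Rightarrow> freudC \<Rightarrow> freudC" where
  "pcross (X, Y, \<xi>, \<eta>) (Z, W, \<zeta>, \<omega>) =
    Phi (\<lambda>U. jscale (- 1 / 2) (jvee X W U + jvee Z Y U))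
        (jscale (- 1 / 4) (jscale 2 (jcross Y W) - jscale \<xi> Z - jscale \<zeta> X))
        (jscale (1 / 4) (jscale 2 (jcross X Z) - jscale \<eta> W - jscale \<omega> Y))
        (1 / 8 * (jform X W + jform Z Y - 3 * (\<xi> * \<omega> + \<zeta> * \<eta>)))"

lemma vector_space_pscale: "vector_space pscale"
proof -
  have a: "cayley_map ((*) c) (x + y) = cayley_map ((*) c) x + cayley_map ((*) c) y"
    and b: "cayley_map ((*) (c + d)) x = cayley_map ((*) c) x + cayley_map ((*) d) x"
    and e: "cayley_map ((*) c) (cayley_map ((*) d) x) = cayley_map ((*) (c * d)) x"
    and f: "cayley_map ((*) 1) x = x" for c d and x y :: "complex cayley"
    by (cases x; cases y; auto simp: distrib_left distrib_right mult.assoc)+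
  have 1: "jscale c (X + Y) = jscale c X + jscale c Y" for c X Y
    by transfer (simp add: vec_eq_iff a)
  have 2: "jscale (c + d) X = jscale c X + jscale d X" for c d X
    by transfer (simp add: vec_eq_iff b)
  have 3: "jscale c (jscale d X) = jscale (c * d) X" for c d X
    by transfer (simp add: vec_eq_iff e)
  have 4: "jscale 1 X = X" for X
    by transfer (simp add: vec_eq_iff f)
  show ?thesis
  proof
    fix c d :: complex and P Q :: freudC
    obtain X Y x y where P: "P = (X, Y, x, y)" by (cases P)
    obtain Z W z w where Q: "Q = (Z, W, z, w)" by (cases Q)
    show "pscale c (P + Q) = pscale c P + pscale c Q"
      by (simp add: P Q 1 distrib_left)
    show "pscale (c + d) P = pscale c P + pscale d P"
      by (simp add: P 2 distrib_right)
    show "pscale c (pscale d P) = pscale (c * d) P"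
      by (simp add: P 3 mult.assoc)
    show "pscale 1 P = P"
      by (simp add: P 4)
  qed
qed

definition IsoC :: "(freudC \<Rightarrow> freudC) set" where
  "IsoC = {\<alpha>. Vector_Spaces.linear pscale pscale \<alpha> \<and> bij \<alpha>}"

definition E7 :: "(freudC \<Rightarrow> freudC) set" where
  "E7 = {\<alpha> \<in> IsoC.
    (\<forall>P Q. \<alpha> \<circ> pcross P Q \<circ> inv_into UNIV \<alpha> = pcross (\<alpha> P) (\<alpha> Q)) \<and>
    (\<forall>P Q. pherm (\<alpha> P) (\<alpha> Q) = pherm P Q)}"

definition E7_fixed :: "(freudC \<Rightarrow> freudC) \<Rightarrow> (freudC \<Rightarrow> freudC) set" where
  "E7_fixed \<sigma> = {\<alpha> \<in> E7. \<sigma> \<circ> \<alpha> \<circ> inv_into UNIV \<sigma> = \<alpha>}"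

fun gamma7 :: "freudC \<Rightarrow> freudC" where
  "gamma7 (X, Y, \<xi>, \<eta>) = (jgamma X, jgamma Y, \<xi>, \<eta>)"

fun gammaC7 :: "freudC \<Rightarrow> freudC" where
  "gammaC7 (X, Y, \<xi>, \<eta>) = (jgammaC X, jgammaC Y, \<xi>, \<eta>)"

fun lambda7 :: "freudC \<Rightarrow> freudC" where
  "lambda7 (X, Y, \<xi>, \<eta>) = (Y, - X, \<eta>, - \<xi>)"

fun iota7 :: "freudC \<Rightarrow> freudC" where
  "iota7 (X, Y, \<xi>, \<eta>) = (jscale (- \<i>) X, jscale \<i> Y, - \<i> * \<xi>, \<i> * \<eta>)"


section \<open>The groups and their topologies\<close>

text \<open>
  Sets of linear maps on \<open>freudC\<close> carry the topology of pointwise convergence, which is the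
  standard topology on the type of functions and, \<open>freudC\<close> being finite-dimensional,
  coincides on linear maps with the usual one.
\<close>

definition comp_group :: "('a \<Rightarrow> 'a) set \<Rightarrow> ('a \<Rightarrow> 'a) monoid" where
  "comp_group S = \<lparr>carrier = S, monoid.mult = (\<circ>), one = id\<rparr>"

definition SO8 :: "(real^8^8) monoid" where
  "SO8 = \<lparr>carrier = {A. rotation_matrix A}, monoid.mult = matrix_matrix_mult, one = mat 1\<rparr>"

definition center2 :: "(freudC \<Rightarrow> freudC) set" where
  "center2 = {id, uminus}"

definition coset_topology :: "('a, 'b) monoid_scheme \<Rightarrow> 'a topology \<Rightarrow> 'a set \<Rightarrow> 'a set topology" where
  "coset_topology G T N = topology (\<lambda>U. U \<subseteq> carrier (G Mod N) \<and>
     openin T {x \<in> topspace T. N #>\<^bsub>G\<^esub> x \<in> U})"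

lemma openin_coset_topology:
  "openin (coset_topology G T N) U \<longleftrightarrow>
    U \<subseteq> carrier (G Mod N) \<and> openin T {x \<in> topspace T. N #>\<^bsub>G\<^esub> x \<in> U}"
proof -
  have "istopology (\<lambda>U. U \<subseteq> carrier (G Mod N) \<and> openin T {x \<in> topspace T. N #>\<^bsub>G\<^esub> x \<in> U})"
    unfolding istopology_def
  proof (intro conjI allI impI)
    fix S S' assume "S \<subseteq> carrier (G Mod N) \<and> openin T {x \<in> topspace T. N #>\<^bsub>G\<^esub> x \<in> S}"
      and "S' \<subseteq> carrier (G Mod N) \<and> openin T {x \<in> topspace T. N #>\<^bsub>G\<^esub> x \<in> S'}"
    moreover have "{x \<in> topspace T. N #>\<^bsub>G\<^esub> x \<in> S \<inter> S'} =
        {x \<in> topspace T. N #>\<^bsub>G\<^esub> x \<in> S} \<inter> {x \<in> topspace T. N #>\<^bsub>G\<^esub> x \<in> S'}" by auto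
    ultimately show "S \<inter> S' \<subseteq> carrier (G Mod N)"
      "openin T {x \<in> topspace T. N #>\<^bsub>G\<^esub> x \<in> S \<inter> S'}" by auto
  next
    fix K assume K: "\<forall>S\<in>K. S \<subseteq> carrier (G Mod N) \<and> openin T {x \<in> topspace T. N #>\<^bsub>G\<^esub> x \<in> S}"
    then show "\<Union>K \<subseteq> carrier (G Mod N)" by auto
    have "{x \<in> topspace T. N #>\<^bsub>G\<^esub> x \<in> \<Union>K} =
        \<Union>((\<lambda>S. {x \<in> topspace T. N #>\<^bsub>G\<^esub> x \<in> S}) ` K)" by auto
    then show "openin T {x \<in> topspace T. N #>\<^bsub>G\<^esub> x \<in> \<Union>K}" using K by auto
  qed
  then show ?thesis by (simp add: coset_topology_def)
qed

text \<open>
  Isomorphism of topological groups. For compact Lie groups this agrees with isomorphism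
  of Lie groups, since continuous homomorphisms between Lie groups are smooth.
\<close>

definition top_group_iso ::
  "('a, 'c) monoid_scheme \<Rightarrow> 'a topology \<Rightarrow> ('b, 'd) monoid_scheme \<Rightarrow> 'b topology \<Rightarrow> bool" where
  "top_group_iso G S H T \<longleftrightarrow> (\<exists>f \<in> iso G H. homeomorphic_map S T f)"

end

theory Submission
  imports Defs
begin

text \<open>
  The maps \<open>J\<^sub>1 = \<lambda>\<gamma>\<close> and \<open>J\<^sub>2 = \<iota>\<gamma>\<^sub>C\<close> anticommute and square to \<open>-1\<close>. The \<open>\<i>\<close>-eigenspace of
  \<open>J\<^sub>2\<close> has dimension 28 and is identified with the complex skew matrices of size 8; \<open>J\<^sub>1\<close> maps it
  to the other eigenspace, so every \<open>P\<close> corresponds to a pair \<open>(x, y)\<close> of skew matrices. In these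
  coordinates the cubic map \<open>P \<mapsto> (P \<times> P) P\<close> is, up to a scalar, \<open>(F x y, - F y x)\<close> with
  \<open>F x y = (Pf' y - x y x) / 2 + tr (x y) x / 8\<close>, where \<open>Pf'\<close> is the gradient of the Pfaffian.
  Hence \<open>A \<in> SO(8)\<close> acts by \<open>x \<mapsto> A x A\<^sup>T\<close>.

  Conversely, an element of the fixed group commutes with \<open>J\<^sub>1\<close>, \<open>J\<^sub>2\<close> and a real structure, so it comes
  from an isometry of the real skew matrices that preserves \<open>x y x\<close> and \<open>Pf'\<close>. The images
  \<open>F\<^sub>i\<^sub>j\<close> of the standard basis give commuting projections \<open>- F\<^sub>i\<^sub>j\<^sup>2\<close> of rank two, and the projections
  with a common index \<open>i\<close> share a unit vector \<open>f\<^sub>i\<close>; these vectors form an orthogonal matrix \<open>A\<close> such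
  that the isometry is \<open>x \<mapsto> \<plusminus> A x A\<^sup>T\<close>, and preservation of \<open>Pf'\<close> forces \<open>det A = 1\<close>. The resulting
  bijection is a homeomorphism because its source is compact.
\<close>

section \<open>Triple products of skew matrices\<close>

definition matrix_unit :: "'n::finite \<Rightarrow> 'n \<Rightarrow> 'a::comm_ring_1^'n^'n" where
  "matrix_unit i j = (\<chi> k l. if k = i \<and> l = j then 1 else 0)"

definition skew_unit :: "'n::finite \<Rightarrow> 'n \<Rightarrow> 'a::comm_ring_1^'n^'n" where
  "skew_unit i j = matrix_unit i j - matrix_unit j i"

definition skew :: "'a::ab_group_add^'n^'n \<Rightarrow> bool" where
  "skew x \<longleftrightarrow> transpose x = - x"

lemma matrix_unit_mult:
  "matrix_unit i j ** matrix_unit k l = (if j = k then matrix_unit i l else (0 ::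
      'a::comm_ring_1^'n::finite^'n))"
proof -
  have "(if p = i \<and> q = j then 1 else 0) * (if q = k \<and> r = l then 1 else (0::'a))
      = (if q = j then (if p = i \<and> j = k \<and> r = l then 1 else 0) else 0)" for p q r
    by auto
  then show ?thesis
    by (auto simp: vec_eq_iff matrix_matrix_mult_def matrix_unit_def)
qed

lemma transpose_matrix_unit: "transpose (matrix_unit i j) = matrix_unit j i"
  by (auto simp: vec_eq_iff transpose_def matrix_unit_def)

lemma transpose_diff: "transpose (A - B) = transpose A - transpose (B :: 'a::ab_group_add^'n^'m)"
  and transpose_add: "transpose (A + B) = transpose A + transpose (B :: 'a::ab_group_add^'n^'m)"
  and transpose_uminus: "transpose (- A) = - transpose (A :: 'a::ab_group_add^'n^'m)"
  by (simp_all add: vec_eq_iff transpose_def)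

lemma skew_skew_unit: "skew (skew_unit i j)"
  by (simp add: skew_def skew_unit_def transpose_diff transpose_matrix_unit)

lemma matrix_mul_uminus: "(- A) ** B = - (A ** (B :: 'a::ring_1^'n^'m))" "A ** (- B) = - (A ** B)"
  by (simp_all add: vec_eq_iff matrix_matrix_mult_def sum_negf)

lemma matrix_mul_diff: "(A - B) ** C = A ** C - B ** (C :: 'a::ring_1^'n^'m)"
  "C' ** (A - B) = C' ** A - C' ** B"
  by (simp_all add: vec_eq_iff matrix_matrix_mult_def sum_subtractf algebra_simps)

lemma matrix_mul_add: "(A + B) ** C = A ** C + B ** (C :: 'a::ring_1^'n^'m)"
  by (simp_all add: vec_eq_iff matrix_matrix_mult_def sum.distrib algebra_simps)

lemma matrix_mul_zero: "0 ** B = (0 :: 'a::ring_1^'n^'m)" "A ** 0 = (0 :: 'a::ring_1^'n^'m)"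
  by (simp_all add: vec_eq_iff matrix_matrix_mult_def)

lemmas mat_simps = matrix_add_ldistrib matrix_mul_add matrix_mul_uminus matrix_mul_diff
  matrix_mul_zero matrix_mul_assoc

lemma skew_unit_swap: "skew_unit j i = - skew_unit i j"
  by (simp add: skew_unit_def)

lemma skew_unit_cube: "i \<noteq> j \<Longrightarrow> skew_unit i j ** skew_unit i j ** skew_unit i j = - skew_unit i j"
  by (simp add: skew_unit_def mat_simps matrix_unit_mult)

lemma skew_unit_triple_disjoint:
  "i \<noteq> j \<Longrightarrow> k \<noteq> l \<Longrightarrow> i \<noteq> k \<Longrightarrow> i \<noteq> l \<Longrightarrow> j \<noteq> k \<Longrightarrow> j \<noteq> l \<Longrightarrow>
    skew_unit i j ** skew_unit i j ** skew_unit k l + skew_unit k l ** skew_unit i j ** skew_unit i j = 0"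
  by (simp add: skew_unit_def mat_simps matrix_unit_mult)

lemma skew_unit_triple_adjacent:
  "i \<noteq> j \<Longrightarrow> i \<noteq> k \<Longrightarrow> j \<noteq> k \<Longrightarrow>
    skew_unit i j ** skew_unit i j ** skew_unit i k + skew_unit i k ** skew_unit i j ** skew_unit i
        j = - skew_unit i k"
  by (simp add: skew_unit_def mat_simps matrix_unit_mult)

lemma skew_unit_triple_path:
  "i \<noteq> j \<Longrightarrow> i \<noteq> k \<Longrightarrow> i \<noteq> l \<Longrightarrow> j \<noteq> k \<Longrightarrow> j \<noteq> l \<Longrightarrow> k \<noteq> l \<Longrightarrow>
    skew_unit i j ** skew_unit j k ** skew_unit k l + skew_unit k l ** skew_unit j k ** skew_unit i
        j = skew_unit i l"
  by (simp add: skew_unit_def mat_simps matrix_unit_mult)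

lemma sum_matrix_unit_nth:
  "(\<Sum>i\<in>UNIV. \<Sum>j\<in>UNIV. c i j * matrix_unit i j $ k $ l) = (c k l :: 'a::comm_ring_1)"
proof -
  have "(\<Sum>j\<in>UNIV. c i j * matrix_unit i j $ k $ l) = (if k = i then c k l else 0)" for i
  proof -
    have "c i j * matrix_unit i j $ k $ l = (if l = j then (if k = i then c k l else 0) else 0)" for j
      by (simp add: matrix_unit_def)
    then show ?thesis by simp
  qed
  then show ?thesis by simp
qed

lemma skew_nth:
  assumes "skew x"
  shows "x$j$i = - x$i$j"
proof -
  have "transpose x $ i $ j = (- x) $ i $ j"
    using assms by (simp only: skew_def)
  then show ?thesis by (simp add: transpose_def)
qed

lemma skew_expand:
  fixes x :: "real^'n^'n"
  assumes "skew x"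
  shows "x = (\<Sum>i\<in>UNIV. \<Sum>j\<in>UNIV. (x$i$j / 2) *\<^sub>R skew_unit i j)"
proof -
  have "(\<Sum>i\<in>UNIV. \<Sum>j\<in>UNIV. (x$i$j / 2) *\<^sub>R skew_unit i j) $ k $ l
      = (\<Sum>i\<in>UNIV. \<Sum>j\<in>UNIV. x$i$j / 2 * matrix_unit i j $ k $ l)
        - (\<Sum>i\<in>UNIV. \<Sum>j\<in>UNIV. x$i$j / 2 * matrix_unit j i $ k $ l)" for k l
    by (simp add: skew_unit_def right_diff_distrib sum_subtractf)
  moreover have "(\<Sum>i\<in>UNIV. \<Sum>j\<in>UNIV. x$i$j / 2 * matrix_unit j i $ k $ l) = x$l$k / 2" for k l
    by (subst sum.swap) (rule sum_matrix_unit_nth)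
  ultimately have "(\<Sum>i\<in>UNIV. \<Sum>j\<in>UNIV. (x$i$j / 2) *\<^sub>R skew_unit i j) $ k $ l = x$k$l" for k l
    using skew_nth[OF assms, of k l] by (simp only: sum_matrix_unit_nth)
  then show ?thesis by (simp add: vec_eq_iff)
qed

definition sym_idem :: "real^'n^'n \<Rightarrow> bool" where
  "sym_idem P \<longleftrightarrow> transpose P = P \<and> P ** P = P"

lemma inner_matrix: "A \<bullet> B = trace (transpose A ** (B :: real^'n^'n))"
  by (simp add: inner_vec_def trace_def matrix_matrix_mult_def transpose_def) (rule sum.swap)

lemma trace_sym_idem: "sym_idem P \<Longrightarrow> trace P = P \<bullet> P"
  by (simp add: sym_idem_def inner_matrix)

lemma sym_idem_trace_0: "sym_idem P \<Longrightarrow> trace P = 0 \<Longrightarrow> P = 0"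
  by (simp add: trace_sym_idem)

lemma sym_idem_mult: "sym_idem P \<Longrightarrow> sym_idem Q \<Longrightarrow> P ** Q = Q ** P \<Longrightarrow> sym_idem (P ** Q)"
  by (metis (no_types, lifting) matrix_mul_assoc matrix_transpose_mul sym_idem_def)

definition outer :: "real^'n \<Rightarrow> real^'n \<Rightarrow> real^'n^'n" where
  "outer u v = (\<chi> i j. u$i * v$j)"

lemma outer_mult: "A ** outer u v = outer (A *v u) v" "outer u v ** A = outer u (transpose A *v v)"
  "outer u v ** outer w z = (v \<bullet> w) *\<^sub>R outer u z"
  by (simp_all add: vec_eq_iff outer_def matrix_matrix_mult_def matrix_vector_mult_def inner_vec_def
      transpose_def sum_distrib_left sum_distrib_right mult_ac)

lemma outer_mult_vec: "outer u v *v w = (v \<bullet> w) *\<^sub>R u"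
  by (simp add: vec_eq_iff outer_def matrix_vector_mult_def inner_vec_def sum_distrib_left
      sum_distrib_right mult_ac)

lemma outer_scaleR: "outer (c *\<^sub>R u) v = c *\<^sub>R outer u v"
  by (simp add: vec_eq_iff outer_def)

lemma transpose_outer: "transpose (outer u v) = outer v u"
  by (simp add: vec_eq_iff outer_def transpose_def mult.commute)

lemma trace_outer: "trace (outer u v) = u \<bullet> v"
  by (simp add: trace_def outer_def inner_vec_def)

lemma sym_idem_trace_1:
  assumes P: "sym_idem P" and t: "trace P = 1"
  obtains u where "norm u = 1" "P *v u = u" "P = outer u u"
proof -
  have "P \<noteq> 0" using t by (auto simp: trace_def)
  then obtain w where w: "P *v w \<noteq> 0"
    by (metis matrix_eq matrix_vector_mult_0)
  define u where "u = (P *v w) /\<^sub>R norm (P *v w)"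
  have PP: "P ** P = P" and PT: "transpose P = P" using P by (auto simp: sym_idem_def)
  have u: "norm u = 1" using w by (simp add: u_def)
  have Pu: "P *v u = u"
    by (simp add: u_def matrix_vector_mult_scaleR matrix_vector_mul_assoc PP)
  have uu: "u \<bullet> u = 1" using u by (simp add: dot_square_norm)
  have "sym_idem (P - outer u u)"
    unfolding sym_idem_def matrix_mul_diff
    by (simp add: transpose_diff transpose_outer PT PP outer_mult outer_mult_vec Pu uu)
  moreover have "trace (P - outer u u) = 0"
    by (simp add: trace_sub t trace_outer uu)
  ultimately have "P - outer u u = 0" by (rule sym_idem_trace_0)
  then show thesis using that u Pu by simp
qed

lemma sym_idem_rank1_commute:
  assumes R: "sym_idem R" "trace R = 1" and P: "sym_idem P" and RP: "R ** P = P ** R"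
  shows "trace (R ** P) = 0 \<and> R ** P = 0 \<or> trace (R ** P) = 1 \<and> R ** P = R"
proof -
  obtain u where u: "norm u = 1" "R *v u = u" "R = outer u u"
    using sym_idem_trace_1[OF R] by blast
  have "R ** P = R ** P ** R"
    by (metis R(1) RP matrix_mul_assoc sym_idem_def)
  also have "\<dots> = (u \<bullet> (P *v u)) *\<^sub>R R"
    unfolding u(3) by (simp add: outer_mult outer_mult_vec outer_scaleR dot_lmul_matrix)
  finally have eq: "R ** P = (u \<bullet> (P *v u)) *\<^sub>R R" (is "_ = ?l *\<^sub>R R") .
  have "sym_idem (R ** P)" by (rule sym_idem_mult[OF R(1) P RP])
  then have "(?l *\<^sub>R R) ** (?l *\<^sub>R R) = ?l *\<^sub>R R" by (simp add: sym_idem_def eq)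
  moreover have "(?l *\<^sub>R R) ** (?l *\<^sub>R R) = (?l * ?l) *\<^sub>R R"
    using R(1) by (simp add: scalar_matrix_assoc [symmetric] matrix_scalar_ac sym_idem_def)
  ultimately have "(?l * ?l - ?l) *\<^sub>R R = 0" by (simp add: scaleR_diff_left)
  moreover have "R \<noteq> 0" using R(2) by (auto simp: trace_def)
  ultimately have "?l = 0 \<or> ?l = 1" by auto
  moreover have "trace (?l *\<^sub>R R) = ?l" using R(2) by (simp add: trace_def sum_distrib_left [symmetric])
  ultimately show ?thesis unfolding eq by auto
qed

locale skew_triple_isometry =
  fixes a :: "real^'n::finite^'n \<Rightarrow> real^'n^'n"
  assumes card: "CARD('n) \<ge> 5"
    and lin: "linear a"
    and skew_a: "skew x \<Longrightarrow> skew (a x)"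
    and triple: "skew x \<Longrightarrow> skew y \<Longrightarrow> a (x ** y ** x) = a x ** a y ** a x"
    and isometry: "skew x \<Longrightarrow> skew y \<Longrightarrow> a x \<bullet> a y = x \<bullet> y"
begin

lemma fresh: obtains m :: 'n where "m \<noteq> i" "m \<noteq> j" "m \<noteq> k" "m \<noteq> l"
proof -
  have "card {i, j, k, l} \<le> 4"
    using card_length[of "[i, j, k, l]"] by simp
  then have "{i, j, k, l} \<noteq> UNIV" using card by auto
  then show thesis using that by auto
qed

lemma triple_polar:
  assumes "skew x" "skew y" "skew z"
  shows "a (x ** y ** z + z ** y ** x) = a x ** a y ** a z + a z ** a y ** a x"
proof -
  have "skew (x + z)"
    using assms by (simp add: skew_def transpose_add)
  then have "a ((x + z) ** y ** (x + z)) = a (x + z) ** a y ** a (x + z)"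
    using assms(2) triple by blast
  then show ?thesis
    using triple[OF assms(1,2)] triple[OF assms(3,2)]
    by (simp add: linear_add[OF lin] mat_simps algebra_simps)
qed

definition F :: "'n \<Rightarrow> 'n \<Rightarrow> real^'n^'n" where "F i j = a (skew_unit i j)"
definition p :: "'n \<Rightarrow> 'n \<Rightarrow> real^'n^'n" where "p i j = - (F i j ** F i j)"

lemma F_swap: "F j i = - F i j"
  by (simp add: F_def skew_unit_swap[of j i] linear_neg[OF lin])

lemma transpose_F: "transpose (F i j) = - F i j"
  using skew_a[OF skew_skew_unit[of i j]] by (simp add: F_def skew_def)

lemma F_cube: "i \<noteq> j \<Longrightarrow> F i j ** F i j ** F i j = - F i j"
  using triple[OF skew_skew_unit[of i j] skew_skew_unit[of i j]]
  by (simp add: F_def skew_unit_cube linear_neg[OF lin])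

lemma F_p: "i \<noteq> j \<Longrightarrow> F i j ** p i j = F i j" "i \<noteq> j \<Longrightarrow> p i j ** F i j = F i j"
  using F_cube[of i j] by (simp_all add: p_def mat_simps)

lemma sym_idem_p: "i \<noteq> j \<Longrightarrow> sym_idem (p i j)"
  using F_p(1)[of i j]
  by (simp add: sym_idem_def p_def transpose_uminus matrix_transpose_mul transpose_F mat_simps)

lemma trace_p: "i \<noteq> j \<Longrightarrow> trace (p i j) = 2"
proof -
  assume ij: "i \<noteq> j"
  have "trace (p i j) = F i j \<bullet> F i j"
    by (simp add: inner_matrix transpose_F p_def mat_simps)
  also have "\<dots> = skew_unit i j \<bullet> (skew_unit i j :: real^'n^'n)"
    by (simp add: F_def isometry skew_skew_unit)
  also have "\<dots> = trace (matrix_unit j j + matrix_unit i i :: real^'n^'n)"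
    using ij by (simp add: inner_matrix skew_unit_def transpose_diff transpose_matrix_unit mat_simps
        matrix_unit_mult)
  also have "\<dots> = 2" by (simp add: trace_add) (simp add: trace_def matrix_unit_def)
  finally show ?thesis .
qed

lemma p_disjoint:
  assumes "i \<noteq> j" "k \<noteq> l" "i \<noteq> k" "i \<noteq> l" "j \<noteq> k" "j \<noteq> l"
  shows "p i j ** p k l = 0"
proof -
  have "F i j ** F i j ** F k l + F k l ** F i j ** F i j = 0"
    using triple_polar[OF skew_skew_unit[of i j] skew_skew_unit[of i j] skew_skew_unit[of k l]]
    by (simp add: skew_unit_triple_disjoint[OF assms] F_def linear_0[OF lin])
  then have 1: "p i j ** F k l = - (F k l ** p i j)"
    by (simp add: p_def mat_simps add_eq_0_iff)
  have pp: "p i j ** p i j = p i j" using sym_idem_p[OF assms(1)] by (simp add: sym_idem_def)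
  have "p i j ** F k l = p i j ** (p i j ** F k l)" by (simp add: matrix_mul_assoc pp)
  also have "\<dots> = - ((p i j ** F k l) ** p i j)" by (simp add: 1 mat_simps)
  also have "\<dots> = F k l ** (p i j ** p i j)" by (simp add: 1 mat_simps)
  also have "\<dots> = - (p i j ** F k l)" by (simp add: pp 1)
  finally have "2 *\<^sub>R (p i j ** F k l) = 0" by (metis add.right_inverse scaleR_2)
  then have "p i j ** F k l = 0" by simp
  then show ?thesis by (simp add: p_def[of k l] mat_simps)
qed

lemma
  assumes "i \<noteq> j" "i \<noteq> k" "j \<noteq> k"
  shows p_commute: "p i j ** p i k = p i k ** p i j"
    and trace_p_p: "trace (p i j ** p i k) = 1"
proof -
  define P G where "P = p i j" and "G = F i k"
  have "F i j ** F i j ** F i k + F i k ** F i j ** F i j = - F i k"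
    using triple_polar[OF skew_skew_unit[of i j] skew_skew_unit[of i j] skew_skew_unit[of i k]]
    by (simp add: skew_unit_triple_adjacent[OF assms] F_def linear_neg[OF lin])
  moreover have "P ** G + G ** P = - (F i j ** F i j ** F i k + F i k ** F i j ** F i j)"
    by (simp add: P_def G_def p_def mat_simps)
  ultimately have 1: "P ** G + G ** P = G" by (simp add: G_def)
  have PP: "P ** P = P" using sym_idem_p[OF assms(1)] by (simp add: sym_idem_def P_def)
  have "P ** (P ** G + G ** P) = P ** G" by (simp add: 1)
  then have PGP: "P ** G ** P = 0" by (simp add: mat_simps PP)
  have "P ** (G ** G) = P ** (G ** (P ** G + G ** P))" by (simp add: 1)
  also have "\<dots> = P ** G ** P ** G + P ** G ** G ** P" by (simp add: mat_simps)
  finally have 2: "P ** (G ** G) = P ** G ** G ** P" by (simp add: PGP mat_simps)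
  have "(G ** G) ** P = ((P ** G + G ** P) ** G) ** P" by (simp add: 1)
  also have "\<dots> = P ** G ** G ** P + G ** (P ** G ** P)" by (simp add: mat_simps)
  finally have 3: "(G ** G) ** P = P ** G ** G ** P" by (simp add: PGP mat_simps)
  show "p i j ** p i k = p i k ** p i j"
    using 2 3 by (simp add: P_def [symmetric] p_def[of i k] G_def [symmetric] mat_simps)
  have "trace (G ** G) = trace (G ** (P ** G + G ** P))" by (simp add: 1)
  also have "\<dots> = trace ((G ** P) ** G) + trace ((G ** G) ** P)"
    by (simp add: mat_simps trace_add)
  also have "trace ((G ** P) ** G) = trace (G ** (G ** P))" by (rule trace_mul_sym)
  also have "trace (G ** (G ** P)) = trace (P ** (G ** G))"
    by (metis matrix_mul_assoc trace_mul_sym)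
  also have "trace ((G ** G) ** P) = trace (P ** (G ** G))" by (rule trace_mul_sym)
  finally have "trace (G ** G) = 2 * trace (P ** (G ** G))" by simp
  moreover have "trace (p i k) = - trace (G ** G)" "trace (p i j ** p i k) = - trace (P ** (G ** G))"
    by (simp_all add: p_def[of i k] G_def [symmetric] P_def [symmetric] mat_simps)
      (simp_all add: trace_def sum_negf)
  ultimately show "trace (p i j ** p i k) = 1" using trace_p[OF assms(2)] by simp
qed

lemma sym_idem_p_p: "i \<noteq> j \<Longrightarrow> i \<noteq> k \<Longrightarrow> j \<noteq> k \<Longrightarrow> sym_idem (p i j ** p i k)"
  by (rule sym_idem_mult) (auto intro: sym_idem_p p_commute)

definition t :: "'n \<Rightarrow> 'n \<Rightarrow> 'n \<Rightarrow> 'n \<Rightarrow> real" where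
  "t i j k l = trace (p i j ** p i k ** p i l)"

lemma t_01:
  assumes "i \<noteq> j" "i \<noteq> k" "i \<noteq> l" "j \<noteq> k" "j \<noteq> l" "k \<noteq> l"
  shows "t i j k l = 0 \<and> p i j ** p i k ** p i l = 0 \<or> t i j k l = 1 \<and> p i j ** p i k ** p i l = p i
      j ** p i k"
  unfolding t_def
proof (rule sym_idem_rank1_commute)
  show "p i j ** p i k ** p i l = p i l ** (p i j ** p i k)"
    by (metis assms matrix_mul_assoc p_commute)
qed (use assms in \<open>auto intro: sym_idem_p sym_idem_p_p trace_p_p\<close>)

lemma t_sum:
  assumes d: "i \<noteq> j" "i \<noteq> k" "i \<noteq> l" "i \<noteq> m" "j \<noteq> k" "j \<noteq> l" "j \<noteq> m" "k \<noteq> l" "k \<noteq> m" "l \<noteq> m"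
    and 0: "t i j k l = 0"
  shows "t i j k m + t i j l m = 1"
proof -
  let ?P = "p i j" and ?R = "p i j ** p i k" and ?S = "p i j ** p i l"
  have c: "p i k ** p i j = ?R" "p i l ** p i j = ?S" "p i l ** p i k = p i k ** p i l"
    using p_commute d by metis+
  have id: "?P ** ?P = ?P" "?R ** ?R = ?R" "?S ** ?S = ?S"
    using sym_idem_p sym_idem_p_p d by (auto simp: sym_idem_def)
  have tr: "transpose ?P = ?P" "transpose ?R = ?R" "transpose ?S = ?S"
    using sym_idem_p sym_idem_p_p d by (auto simp: sym_idem_def)
  have 1: "p i j ** p i k ** p i l = 0" using 0 t_01[of i j k l] d by auto
  have RS: "?R ** ?S = 0" "?S ** ?R = 0"
    by (metis 1 c id(1) matrix_mul_assoc matrix_mul_zero)+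
  have PR: "?P ** ?R = ?R" "?R ** ?P = ?R" "?P ** ?S = ?S" "?S ** ?P = ?S"
    by (metis c id(1) matrix_mul_assoc)+
  have "sym_idem (?P - ?R - ?S)"
    unfolding sym_idem_def transpose_diff tr
    by (simp add: matrix_mul_diff id RS PR)
  moreover have "trace (?P - ?R - ?S) = 0"
    using d by (simp add: trace_sub trace_p trace_p_p)
  ultimately have "?P - ?R - ?S = 0" by (rule sym_idem_trace_0)
  then have "?P = ?R + ?S" by (simp add: algebra_simps)
  then have "trace (?P ** p i m) = trace (?R ** p i m) + trace (?S ** p i m)"
    by (metis matrix_mul_add trace_add)
  then show ?thesis using d by (simp add: trace_p_p t_def)
qed

lemma t_perm:
  assumes "i \<noteq> j" "i \<noteq> k" "i \<noteq> l" "j \<noteq> k" "j \<noteq> l" "k \<noteq> l"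
  shows "t i k j l = t i j k l" "t i j l k = t i j k l"
  unfolding t_def using assms by (metis p_commute matrix_mul_assoc)+

text \<open>If \<open>t i j k l\<close> vanished, three values in \<open>{0, 1}\<close> would have pairwise sums equal to \<open>1\<close>.\<close>

lemma t_eq_1:
  assumes d: "i \<noteq> j" "i \<noteq> k" "i \<noteq> l" "j \<noteq> k" "j \<noteq> l" "k \<noteq> l"
  shows "t i j k l = 1"
proof (rule ccontr)
  assume "t i j k l \<noteq> 1"
  then have 0: "t i j k l = 0" using t_01 d by blast
  obtain m where m: "m \<noteq> i" "m \<noteq> j" "m \<noteq> k" "m \<noteq> l" by (rule fresh)
  have "t i k j l = 0" "t i l j k = 0"
    using 0 t_perm d by metis+
  then have "t i j k m + t i j l m = 1" "t i k j m + t i k l m = 1" "t i l j m + t i l k m = 1"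
    using t_sum[of i j k l m] t_sum[of i k j l m] t_sum[of i l j k m] 0 d m by simp_all
  moreover have "t i k j m = t i j k m" "t i l j m = t i j l m" "t i l k m = t i k l m"
    using t_perm(1) d m by metis+
  moreover have "t i j k m \<in> {0, 1}" "t i j l m \<in> {0, 1}" "t i k l m \<in> {0, 1}"
    using t_01[of i j k m] t_01[of i j l m] t_01[of i k l m] d m by auto
  ultimately show False by auto
qed

lemma p_p_absorb:
  assumes d: "i \<noteq> j" "i \<noteq> k" "j \<noteq> k" "i \<noteq> l"
  shows "p i l ** (p i j ** p i k) = p i j ** p i k"
proof -
  have c: "p i k ** p i j = p i j ** p i k" using p_commute d by metis
  have id: "p i j ** p i j = p i j" "p i k ** p i k = p i k"
    using sym_idem_p d by (auto simp: sym_idem_def)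
  consider "l = j" | "l = k" | "l \<noteq> j" "l \<noteq> k" by blast
  then show ?thesis
  proof cases
    case 1 then show ?thesis by (simp add: matrix_mul_assoc id)
  next
    case 2 then show ?thesis by (metis c id(2) matrix_mul_assoc)
  next
    case 3
    then have "p i j ** p i k ** p i l = p i j ** p i k"
      using t_01[of i j k l] t_eq_1[of i j k l] d by auto
    then show ?thesis using 3 d by (metis p_commute matrix_mul_assoc)
  qed
qed

lemma ex_common_vector: "\<exists>u. norm u = 1 \<and> (\<forall>l. l \<noteq> i \<longrightarrow> p i l *v u = u)"
proof -
  obtain j where j: "j \<noteq> i" using fresh[of i i i i] by blast
  obtain k where k: "k \<noteq> i" "k \<noteq> j" using fresh[of i j i i] by blast
  have ijk: "i \<noteq> j" "i \<noteq> k" "j \<noteq> k" using j k by auto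
  obtain u where u: "norm u = 1" "(p i j ** p i k) *v u = u"
    by (rule sym_idem_trace_1[OF sym_idem_p_p[OF ijk] trace_p_p[OF ijk]])
  have "p i l *v u = u" if "l \<noteq> i" for l
    using p_p_absorb[OF ijk, of l] that u(2) by (metis matrix_vector_mul_assoc)
  then show ?thesis using u(1) by blast
qed

end

lemma linear_skew_expand:
  assumes "linear (g :: real^'n^'n \<Rightarrow> 'b::real_vector)" "skew x"
  shows "g x = (\<Sum>i\<in>UNIV. \<Sum>j\<in>UNIV. (x$i$j / 2) *\<^sub>R g (skew_unit i j))"
proof -
  have "g x = g (\<Sum>i\<in>UNIV. \<Sum>j\<in>UNIV. (x$i$j / 2) *\<^sub>R skew_unit i j)"
    using skew_expand[OF assms(2)] by (rule arg_cong)
  then show ?thesis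
    by (simp only: linear_sum[OF assms(1)] linear_scale[OF assms(1)])
qed

context skew_triple_isometry begin
definition f :: "'n \<Rightarrow> real^'n" where
  "f i = (SOME u. norm u = 1 \<and> (\<forall>l. l \<noteq> i \<longrightarrow> p i l *v u = u))"

lemma norm_f: "norm (f i) = 1" and p_f: "l \<noteq> i \<Longrightarrow> p i l *v f i = f i"
  using someI_ex[OF ex_common_vector[of i]] unfolding f_def by blast+

lemma f_orthogonal: "i \<noteq> j \<Longrightarrow> f i \<bullet> f j = 0"
proof -
  assume ij: "i \<noteq> j"
  obtain k where k: "k \<noteq> i" "k \<noteq> j" by (rule fresh)
  obtain m where m: "m \<noteq> i" "m \<noteq> j" "m \<noteq> k" by (rule fresh)
  have "f i \<bullet> f j = (p i k *v f i) \<bullet> (p j m *v f j)" using k m by (simp add: p_f)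
  also have "\<dots> = f i \<bullet> ((transpose (p i k) ** p j m) *v f j)"
    by (metis dot_lmul_matrix matrix_vector_mul_assoc transpose_matrix_vector transpose_transpose)
  also have "transpose (p i k) ** p j m = 0"
    using sym_idem_p[of i k] p_disjoint[of i k j m] ij k m by (simp add: sym_idem_def)
  finally show ?thesis by simp
qed

lemma F_f: "i \<noteq> j \<Longrightarrow> k \<noteq> i \<Longrightarrow> k \<noteq> j \<Longrightarrow> F i j *v f k = 0"
proof -
  assume d: "i \<noteq> j" "k \<noteq> i" "k \<noteq> j"
  obtain m where m: "m \<noteq> i" "m \<noteq> j" "m \<noteq> k" by (rule fresh)
  have "F i j *v f k = (F i j ** p i j) *v (p k m *v f k)" using d m by (simp add: p_f F_p)
  also have "\<dots> = (F i j ** (p i j ** p k m)) *v f k"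
    by (simp add: matrix_vector_mul_assoc matrix_mul_assoc)
  also have "\<dots> = 0" using p_disjoint[of i j k m] d m by (simp add: mat_simps)
  finally show ?thesis .
qed

definition Q :: "real^'n^'n" where "Q = (\<chi> i. f i)"

lemma conj_Q_nth: "(Q ** M ** transpose Q) $ k $ l = f k \<bullet> (M *v f l)"
  by (simp add: Q_def matrix_matrix_mult_def transpose_def inner_vec_def matrix_vector_mult_def
      sum_distrib_left sum_distrib_right mult.assoc) (rule sum.swap)

lemma Q_orthogonal: "Q ** transpose Q = mat 1" "transpose Q ** Q = mat 1"
proof -
  have "f k \<bullet> f l = mat 1 $ k $ l" for k l
    using norm_f[of k] f_orthogonal[of k l] by (auto simp: mat_def dot_square_norm)
  then show "Q ** transpose Q = mat 1"
    using conj_Q_nth[of "mat 1"] by (simp add: vec_eq_iff)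
  then show "transpose Q ** Q = mat 1" by (simp add: matrix_left_right_inverse)
qed

definition s :: "'n \<Rightarrow> 'n \<Rightarrow> real" where "s i j = f i \<bullet> (F i j *v f j)"

lemma F_dot: "u \<bullet> (F i j *v v) = - (v \<bullet> (F i j *v u))"
proof -
  have "u \<bullet> (F i j *v v) = (transpose (F i j) *v u) \<bullet> v"
    by (simp add: dot_lmul_matrix)
  also have "\<dots> = - (v \<bullet> (F i j *v u))"
    unfolding transpose_F by (simp add: matrix_vector_mult_def inner_vec_def sum_negf mult.commute)
  finally show ?thesis .
qed

lemma conj_Q_F: "i \<noteq> j \<Longrightarrow> Q ** F i j ** transpose Q = s i j *\<^sub>R skew_unit i j"
proof -
  assume ij: "i \<noteq> j"
  have 0: "f k \<bullet> (F i j *v f k) = 0" for k using F_dot[of "f k" i j "f k"] by simp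
  have "f k \<bullet> (F i j *v f l) = s i j * skew_unit i j $ k $ l" for k l
  proof (cases "k \<in> {i, j} \<and> l \<in> {i, j}")
    case True
    then show ?thesis using ij 0 F_dot[of "f j" i j "f i"] by (auto simp: s_def skew_unit_def
        matrix_unit_def)
  next
    case False
    then have "f k \<bullet> (F i j *v f l) = 0"
      using F_f[of i j l] F_f[of i j k] F_dot[of "f k" i j "f l"] ij by auto
    moreover have "\<not> (k = i \<and> l = j)" "\<not> (k = j \<and> l = i)" using False by auto
    then have "skew_unit i j $ k $ l = (0::real)" by (simp add: skew_unit_def matrix_unit_def del:
        de_Morgan_conj)
    ultimately show ?thesis by simp
  qed
  then show ?thesis by (simp add: vec_eq_iff conj_Q_nth)
qed

lemma conj_Q_mult: "Q ** (M ** N) ** transpose Q = (Q ** M ** transpose Q) ** (Q ** N ** transpose Q)"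
  by (metis Q_orthogonal(2) matrix_mul_assoc matrix_mul_rid)

lemma scaleR_triple: "(x *\<^sub>R A) ** (y *\<^sub>R B) ** (z *\<^sub>R C) = (x * y * z) *\<^sub>R (A ** B ** (C :: real^'n^'n))"
  by (simp add: scalar_matrix_assoc [symmetric] matrix_scalar_ac mult_ac)

lemma skew_unit_scaleR_inject: "i \<noteq> j \<Longrightarrow> x *\<^sub>R skew_unit i j = y *\<^sub>R (skew_unit i j :: real^'n^'n) \<Longrightarrow> x = y"
  by (drule arg_cong[where f="\<lambda>M. M $ i $ j"]) (simp add: skew_unit_def matrix_unit_def)

lemma s_swap: "i \<noteq> j \<Longrightarrow> s j i = s i j"
proof -
  assume ij: "i \<noteq> j"
  have "- (s j i *\<^sub>R skew_unit i j) = Q ** F j i ** transpose Q"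
    using conj_Q_F[of j i] ij by (simp add: skew_unit_swap[of j i])
  also have "\<dots> = - (s i j *\<^sub>R skew_unit i j)"
    using conj_Q_F[OF ij] by (simp add: F_swap[of j i] mat_simps)
  finally have "s j i *\<^sub>R skew_unit i j = s i j *\<^sub>R (skew_unit i j :: real^'n^'n)" by simp
  then show ?thesis using skew_unit_scaleR_inject[OF ij] by blast
qed

lemma s_path:
  assumes "i \<noteq> j" "i \<noteq> k" "i \<noteq> l" "j \<noteq> k" "j \<noteq> l" "k \<noteq> l"
  shows "s i j * s j k * s k l = s i l"
proof -
  have "F i j ** F j k ** F k l + F k l ** F j k ** F i j = F i l"
    using triple_polar[OF skew_skew_unit[of i j] skew_skew_unit[of j k] skew_skew_unit[of k l]]
    by (simp add: F_def skew_unit_triple_path assms)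
  then have "Q ** (F i j ** F j k ** F k l + F k l ** F j k ** F i j) ** transpose Q
      = s i l *\<^sub>R skew_unit i l"
    using conj_Q_F assms by simp
  then have "(s i j * s j k * s k l) *\<^sub>R (skew_unit i j ** skew_unit j k ** skew_unit k l +
      skew_unit k l ** skew_unit j k ** skew_unit i j)
      = s i l *\<^sub>R (skew_unit i l :: real^'n^'n)"
    by (simp add: matrix_add_ldistrib matrix_mul_add conj_Q_mult conj_Q_F assms scaleR_triple
        scaleR_add_right mult_ac)
  then have "(s i j * s j k * s k l) *\<^sub>R skew_unit i l = s i l *\<^sub>R (skew_unit i l :: real^'n^'n)"
    by (simp add: skew_unit_triple_path assms)
  then show ?thesis using skew_unit_scaleR_inject assms by blast
qed

lemma s_square: "i \<noteq> j \<Longrightarrow> s i j * s i j = 1"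
proof -
  assume ij: "i \<noteq> j"
  have "Q ** (F i j ** F i j ** F i j) ** transpose Q = - (s i j *\<^sub>R skew_unit i j)"
    using F_cube conj_Q_F ij by (simp add: mat_simps)
  then have "(s i j * s i j * s i j) *\<^sub>R (skew_unit i j ** skew_unit i j ** skew_unit i j)
      = - (s i j *\<^sub>R (skew_unit i j :: real^'n^'n))"
    by (simp add: conj_Q_mult conj_Q_F ij scaleR_triple)
  then have "(s i j * s i j * s i j) *\<^sub>R skew_unit i j = s i j *\<^sub>R (skew_unit i j :: real^'n^'n)"
    by (simp add: skew_unit_cube ij)
  then have "s i j * s i j * s i j = s i j" using skew_unit_scaleR_inject ij by blast
  moreover have "s i j \<noteq> 0"
  proof
    assume "s i j = 0"
    then have "Q ** F i j ** transpose Q = 0" using conj_Q_F ij by simp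
    then have "transpose Q ** (Q ** F i j ** transpose Q) ** Q = 0" by (simp add: mat_simps)
    then have "F i j = 0"
      by (metis Q_orthogonal(2) matrix_mul_assoc matrix_mul_lid matrix_mul_rid)
    then show False using p_f[of j i] norm_f[of i] ij by (auto simp: p_def mat_simps)
  qed
  ultimately show ?thesis by simp
qed

lemma s_splits:
  "\<exists>e c. e * e = 1 \<and> (\<forall>i. c i * c i = (1::real)) \<and> (\<forall>i j. i \<noteq> j \<longrightarrow> s i j = e * c i * c j)"
proof -
  obtain o1 i0 :: 'n where i0: "i0 \<noteq> o1" by (metis fresh)
  obtain j0 where j0: "j0 \<noteq> o1" "j0 \<noteq> i0" using fresh[of o1 i0 i0 i0] by blast
  define \<tau> where "\<tau> i j = s o1 i * s i j * s o1 j" for i j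
  have step: "\<tau> i j = \<tau> j k" if "i \<noteq> j" "j \<noteq> k" "i \<noteq> k" "i \<noteq> o1" "j \<noteq> o1" "k \<noteq> o1" for i j k
  proof -
    have "\<tau> i j * \<tau> j k = (s o1 i * s i j * s j k) * s o1 k * (s o1 j * s o1 j)"
      by (simp add: \<tau>_def)
    also have "\<dots> = 1" using s_path[of o1 i j k] s_square[of o1] that by auto
    finally have "\<tau> i j * \<tau> j k = 1" .
    moreover have "\<tau> j k * \<tau> j k = (s o1 j * s o1 j) * (s j k * s j k) * (s o1 k * s o1 k)"
      by (simp add: \<tau>_def)
    then have "\<tau> j k * \<tau> j k = 1" using s_square that by auto
    ultimately show ?thesis by (metis mult.assoc mult.left_neutral mult.right_neutral)
  qed
  have sym: "\<tau> j i = \<tau> i j" if "i \<noteq> j" for i j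
    using s_swap[OF that] by (simp add: \<tau>_def)
  have const: "\<tau> i j = \<tau> i0 j0" if "i \<noteq> j" "i \<noteq> o1" "j \<noteq> o1" for i j
  proof -
    obtain k where k: "k \<noteq> o1" "k \<noteq> i" "k \<noteq> j" "k \<noteq> i0" using fresh[of o1 i j i0] by blast
    have 1: "\<tau> i j = \<tau> j k" using step[of i j k] k that by simp
    have 2: "\<tau> j k = \<tau> k i0" if "j \<noteq> i0" using step[of j k i0] k that i0 \<open>j \<noteq> o1\<close> by blast
    have 3: "\<tau> j k = \<tau> k i0" if "j = i0" using sym[of j k] that k by simp
    have 4: "\<tau> k i0 = \<tau> i0 j0" if "k \<noteq> j0" using step[of k i0 j0] k i0 j0 that by blast
    have 5: "\<tau> k i0 = \<tau> i0 j0" if "k = j0" using sym[of k i0] that k by simp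
    show ?thesis using 1 2 3 4 5 by (cases "j = i0"; cases "k = j0") simp_all
  qed
  define e where "e = \<tau> i0 j0"
  define c where "c i = (if i = o1 then e else s o1 i)" for i
  have "e * e = (s o1 i0 * s o1 i0) * (s i0 j0 * s i0 j0) * (s o1 j0 * s o1 j0)"
    by (simp add: e_def \<tau>_def)
  then have ee: "e * e = 1" using s_square[of o1 i0] s_square[of i0 j0] s_square[of o1 j0] i0 j0 by auto
  moreover have "c i * c i = 1" for i using ee s_square[of o1 i] by (auto simp: c_def)
  moreover have "s i j = e * c i * c j" if "i \<noteq> j" for i j
  proof -
    consider "i = o1" | "j = o1" | "i \<noteq> o1" "j \<noteq> o1" by blast
    then show ?thesis
    proof cases
      case 1 then show ?thesis using that by (simp add: c_def ee)
    next
      case 2 then show ?thesis using that ee s_swap[of o1 i] by (simp add: c_def mult_ac)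
    next
      case 3
      then have "s o1 i * s i j * s o1 j = e" using const[of i j] that by (simp add: e_def \<tau>_def)
      then have "e * c i * c j = (s o1 i * s i j * s o1 j) * s o1 i * s o1 j"
        using 3 by (simp add: c_def)
      also have "\<dots> = (s o1 i * s o1 i) * (s o1 j * s o1 j) * s i j"
        by (simp add: mult_ac)
      finally show ?thesis using 3 s_square[of o1] by auto
    qed
  qed
  ultimately show ?thesis by blast
qed

theorem conjugation_by_orthogonal:
  "\<exists>A e. orthogonal_matrix A \<and> (e = 1 \<or> e = - 1)
    \<and> (\<forall>x. skew x \<longrightarrow> a x = e *\<^sub>R (A ** x ** transpose A))"
proof -
  obtain e c where e: "e * e = 1" and c: "\<And>i. c i * c i = (1::real)"
    and sc: "\<And>i j. i \<noteq> j \<Longrightarrow> s i j = e * c i * c j"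
    using s_splits by blast
  define D :: "real^'n^'n" where "D = (\<chi> i j. if i = j then c i else 0)"
  define A where "A = transpose Q ** D"
  have l: "(D ** M) $ i $ j = c i * M $ i $ j" for M i j
    by (simp add: D_def matrix_matrix_mult_def if_distrib[of "\<lambda>x. x * _"] cong: if_cong)
  have r: "(M ** D) $ i $ j = M $ i $ j * c j" for M i j
    by (simp add: D_def matrix_matrix_mult_def if_distrib[of "\<lambda>x. _ * x"] cong: if_cong)
  have nth_D: "(D ** M ** D) $ i $ j = c i * c j * M $ i $ j" for M i j
    by (simp add: l r)
  have D: "transpose D = D" by (auto simp: D_def vec_eq_iff transpose_def)
  have "D ** D = mat 1"
    by (simp add: vec_eq_iff l) (simp add: D_def mat_def c)
  moreover have "transpose A ** A = D ** (Q ** transpose Q) ** D"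
    by (simp add: A_def matrix_transpose_mul D matrix_mul_assoc)
  ultimately have "orthogonal_matrix A"
    by (simp add: orthogonal_matrix Q_orthogonal)
  moreover have "e = 1 \<or> e = -1" using e by (simp add: square_eq_1_iff)
  moreover have "a x = e *\<^sub>R (A ** x ** transpose A)" if x: "skew x" for x
  proof -
    define L where "L x = e *\<^sub>R (A ** x ** transpose A)" for x
    have linL: "linear L"
      by (rule linearI) (simp_all add: L_def mat_simps scaleR_add_right
          scalar_matrix_assoc [symmetric] matrix_scalar_ac)
    have "F i j = L (skew_unit i j)" if ij: "i \<noteq> j" for i j
    proof -
      have "D ** skew_unit i j ** D = (c i * c j) *\<^sub>R skew_unit i j"
        by (auto simp: vec_eq_iff nth_D skew_unit_def matrix_unit_def)
      then have "Q ** F i j ** transpose Q = e *\<^sub>R (D ** skew_unit i j ** D)"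
        by (simp add: conj_Q_F ij sc)
      then have "transpose Q ** (Q ** F i j ** transpose Q) ** Q
          = e *\<^sub>R (transpose Q ** (D ** skew_unit i j ** D) ** Q)"
        by (simp add: scalar_matrix_assoc [symmetric] matrix_scalar_ac)
      moreover have "transpose Q ** (Q ** F i j ** transpose Q) ** Q = F i j"
        by (metis Q_orthogonal(2) matrix_mul_assoc matrix_mul_lid matrix_mul_rid)
      ultimately show ?thesis
        by (simp add: L_def A_def matrix_transpose_mul D matrix_mul_assoc)
    qed
    moreover have "F i i = L (skew_unit i i)" for i
      by (simp add: F_def skew_unit_def linear_0[OF lin] linear_0[OF linL])
    ultimately have "a (skew_unit i j) = L (skew_unit i j)" for i j
      by (cases "i = j") (simp_all add: F_def)
    then have "a x = L x"
      by (simp only: linear_skew_expand[OF lin x] linear_skew_expand[OF linL x])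
    then show ?thesis by (simp add: L_def)
  qed
  ultimately show ?thesis by blast
qed

end

section \<open>The Pfaffian of skew matrices of size 8\<close>

lemma exhaust_8: "(k::8) = 1 \<or> k = 2 \<or> k = 3 \<or> k = 4 \<or> k = 5 \<or> k = 6 \<or> k = 7 \<or> k = 8"
proof (induct k)
  case (of_int z)
  then have "z = 0 \<or> z = 1 \<or> z = 2 \<or> z = 3 \<or> z = 4 \<or> z = 5 \<or> z = 6 \<or> z = 7" by fastforce
  then show ?case by auto
qed

lemma UNIV_8: "(UNIV :: 8 set) = {1, 2, 3, 4, 5, 6, 7, 8}"
  using exhaust_8 by auto

lemma forall_8: "(\<forall>k::8. P k) \<longleftrightarrow> P 1 \<and> P 2 \<and> P 3 \<and> P 4 \<and> P 5 \<and> P 6 \<and> P 7 \<and> P 8"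
  by (metis exhaust_8)

lemma sum_8: "(\<Sum>k\<in>(UNIV :: 8 set). f k) = f 1 + f 2 + f 3 + f 4 + f 5 + f 6 + f 7 + f 8"
  for f :: "8 \<Rightarrow> 'a::comm_monoid_add"
  unfolding UNIV_8 by (simp add: add.assoc)

lemma prod_8: "(\<Prod>k\<in>(UNIV :: 8 set). f k) = f 1 * f 2 * f 3 * f 4 * f 5 * f 6 * f 7 * f 8"
  for f :: "8 \<Rightarrow> 'a::comm_monoid_mult"
  unfolding UNIV_8 by (simp add: mult.assoc)

lemma skewI:
  assumes "\<And>i j. x$j$i = - x$i$j"
  shows "skew x"
  unfolding skew_def vec_eq_iff transpose_def vec_lambda_beta vector_uminus_component
  using assms by blast

lemma skew_diag: "skew x \<Longrightarrow> x$i$i = (0::'a::{ring_1_no_zero_divisors,ring_char_0})"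
  using skew_nth[of x i i] by (simp add: eq_neg_iff_add_eq_0 flip: mult_2)

lemma skew_lower:
  fixes x :: "complex^8^8"
  assumes "skew x"
  shows "x$1$1 = 0" "x$2$2 = 0" "x$3$3 = 0" "x$4$4 = 0" "x$5$5 = 0" "x$6$6 = 0" "x$7$7 = 0" "x$8$8 = 0"
    "x$2$1 = - x$1$2" "x$3$1 = - x$1$3" "x$4$1 = - x$1$4" "x$5$1 = - x$1$5" "x$6$1 = - x$1$6"
    "x$7$1 = - x$1$7" "x$8$1 = - x$1$8" "x$3$2 = - x$2$3" "x$4$2 = - x$2$4" "x$5$2 = - x$2$5"
    "x$6$2 = - x$2$6" "x$7$2 = - x$2$7" "x$8$2 = - x$2$8" "x$4$3 = - x$3$4" "x$5$3 = - x$3$5"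
    "x$6$3 = - x$3$6" "x$7$3 = - x$3$7" "x$8$3 = - x$3$8" "x$5$4 = - x$4$5" "x$6$4 = - x$4$6"
    "x$7$4 = - x$4$7" "x$8$4 = - x$4$8" "x$6$5 = - x$5$6" "x$7$5 = - x$5$7" "x$8$5 = - x$5$8"
    "x$7$6 = - x$6$7" "x$8$6 = - x$6$8" "x$8$7 = - x$7$8"
  by (rule skew_diag[OF assms] skew_nth[OF assms])+

definition pf4 :: "'a::comm_ring_1^8^8 \<Rightarrow> 8 \<Rightarrow> 8 \<Rightarrow> 8 \<Rightarrow> 8 \<Rightarrow> 'a" where
  "pf4 x i j k l = x$i$j * x$k$l - x$i$k * x$j$l + x$i$l * x$j$k"

definition pf6 :: "'a::comm_ring_1^8^8 \<Rightarrow> 8 \<Rightarrow> 8 \<Rightarrow> 8 \<Rightarrow> 8 \<Rightarrow> 8 \<Rightarrow> 8 \<Rightarrow> 'a" where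
  "pf6 x i j k l m n = x$i$j * pf4 x k l m n - x$i$k * pf4 x j l m n + x$i$l * pf4 x j k m n
    - x$i$m * pf4 x j k l n + x$i$n * pf4 x j k l m"

definition pf8 :: "'a::comm_ring_1^8^8 \<Rightarrow> 8 \<Rightarrow> 8 \<Rightarrow> 8 \<Rightarrow> 8 \<Rightarrow> 8 \<Rightarrow> 8 \<Rightarrow> 8 \<Rightarrow> 8 \<Rightarrow> 'a" where
  "pf8 x a b c d e f g h = x$a$b * pf6 x c d e f g h - x$a$c * pf6 x b d e f g h + x$a$d * pf6 x b c
      e f g h
     - x$a$e * pf6 x b c d f g h + x$a$f * pf6 x b c d e g h
     - x$a$g * pf6 x b c d e f h + x$a$h * pf6 x b c d e f g"

definition pf :: "'a::comm_ring_1^8^8 \<Rightarrow> 'a" where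
  "pf x = pf8 x 1 2 3 4 5 6 7 8"

lemma pf6_swap:
  assumes "skew (x :: 'a::comm_ring_1^8^8)"
  shows "pf6 x b a c d e f = - pf6 x a b c d e f"
    "pf6 x a c b d e f = - pf6 x a b c d e f"
    "pf6 x a b d c e f = - pf6 x a b c d e f"
    "pf6 x a b c e d f = - pf6 x a b c d e f"
    "pf6 x a b c d f e = - pf6 x a b c d e f"
  unfolding pf6_def pf4_def
  by (simp_all add: skew_nth[OF assms, of a b] skew_nth[OF assms, of b c] skew_nth[OF assms, of c d]
      skew_nth[OF assms, of d e] skew_nth[OF assms, of e f] algebra_simps)

lemma pf8_swap:
  assumes "skew (x :: 'a::comm_ring_1^8^8)"
  shows "pf8 x b a c d e f g h = - pf8 x a b c d e f g h"
    "pf8 x a c b d e f g h = - pf8 x a b c d e f g h"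
    "pf8 x a b d c e f g h = - pf8 x a b c d e f g h"
    "pf8 x a b c e d f g h = - pf8 x a b c d e f g h"
    "pf8 x a b c d f e g h = - pf8 x a b c d e f g h"
    "pf8 x a b c d e g f h = - pf8 x a b c d e f g h"
    "pf8 x a b c d e f h g = - pf8 x a b c d e f g h"
proof -
  show "pf8 x b a c d e f g h = - pf8 x a b c d e f g h"
    by (simp add: pf8_def pf6_def skew_nth[OF assms, of a b] algebra_simps)
  show "pf8 x a c b d e f g h = - pf8 x a b c d e f g h"
    by (simp add: pf8_def pf6_swap(1)[OF assms, of b c e f g h]
      pf6_swap(1)[OF assms, of b c d f g h]
      pf6_swap(1)[OF assms, of b c d e g h]
      pf6_swap(1)[OF assms, of b c d e f h]
      pf6_swap(1)[OF assms, of b c d e f g] algebra_simps)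
  show "pf8 x a b d c e f g h = - pf8 x a b c d e f g h"
    by (simp add: pf8_def pf6_swap(1)[OF assms, of c d e f g h]
      pf6_swap(2)[OF assms, of b c d f g h]
      pf6_swap(2)[OF assms, of b c d e g h]
      pf6_swap(2)[OF assms, of b c d e f h]
      pf6_swap(2)[OF assms, of b c d e f g] algebra_simps)
  show "pf8 x a b c e d f g h = - pf8 x a b c d e f g h"
    by (simp add: pf8_def pf6_swap(2)[OF assms, of c d e f g h]
      pf6_swap(2)[OF assms, of b d e f g h]
      pf6_swap(3)[OF assms, of b c d e g h]
      pf6_swap(3)[OF assms, of b c d e f h]
      pf6_swap(3)[OF assms, of b c d e f g] algebra_simps)
  show "pf8 x a b c d f e g h = - pf8 x a b c d e f g h"
    by (simp add: pf8_def pf6_swap(3)[OF assms, of c d e f g h]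
      pf6_swap(3)[OF assms, of b d e f g h]
      pf6_swap(3)[OF assms, of b c e f g h]
      pf6_swap(4)[OF assms, of b c d e f h]
      pf6_swap(4)[OF assms, of b c d e f g] algebra_simps)
  show "pf8 x a b c d e g f h = - pf8 x a b c d e f g h"
    by (simp add: pf8_def pf6_swap(4)[OF assms, of c d e f g h]
      pf6_swap(4)[OF assms, of b d e f g h]
      pf6_swap(4)[OF assms, of b c e f g h]
      pf6_swap(4)[OF assms, of b c d f g h]
      pf6_swap(5)[OF assms, of b c d e f g] algebra_simps)
  show "pf8 x a b c d e f h g = - pf8 x a b c d e f g h"
    by (simp add: pf8_def pf6_swap(5)[OF assms, of c d e f g h]
      pf6_swap(5)[OF assms, of b d e f g h]
      pf6_swap(5)[OF assms, of b c e f g h]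
      pf6_swap(5)[OF assms, of b c d f g h]
      pf6_swap(5)[OF assms, of b c d e g h] algebra_simps)
qed

definition relabel :: "('n \<Rightarrow> 'n) \<Rightarrow> 'a^'n::finite^'n \<Rightarrow> 'a^'n^'n" where
  "relabel \<sigma> x = (\<chi> i j. x $ \<sigma> i $ \<sigma> j)"

definition alternating_at :: "8 \<Rightarrow> 8 \<Rightarrow> bool" where
  "alternating_at m n \<longleftrightarrow>
    (\<forall>x::complex^8^8. skew x \<longrightarrow> pf (relabel (Transposition.transpose m n) x) = - pf x)"

lemma skew_relabel: "skew x \<Longrightarrow> skew (relabel \<sigma> x)"
  unfolding relabel_def by (rule skewI) (simp, rule skew_nth)

lemma pf_swap_adjacent:
  "alternating_at 1 2"
  "alternating_at 2 3"
  "alternating_at 3 4"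
  "alternating_at 4 5"
  "alternating_at 5 6"
  "alternating_at 6 7"
  "alternating_at 7 8"
proof -
  have *: "pf (relabel \<sigma> x) = pf8 x (\<sigma> 1) (\<sigma> 2) (\<sigma> 3) (\<sigma> 4) (\<sigma> 5) (\<sigma> 6) (\<sigma> 7) (\<sigma> 8)"
    for \<sigma> and x :: "complex^8^8"
    by (simp add: pf_def pf8_def pf6_def pf4_def relabel_def)
  show "alternating_at 1 2"
    unfolding alternating_at_def * by (simp add: Transposition.transpose_def pf_def) (metis pf8_swap(1))
  show "alternating_at 2 3"
    unfolding alternating_at_def * by (simp add: Transposition.transpose_def pf_def) (metis pf8_swap(2))
  show "alternating_at 3 4"
    unfolding alternating_at_def * by (simp add: Transposition.transpose_def pf_def) (metis pf8_swap(3))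
  show "alternating_at 4 5"
    unfolding alternating_at_def * by (simp add: Transposition.transpose_def pf_def) (metis pf8_swap(4))
  show "alternating_at 5 6"
    unfolding alternating_at_def * by (simp add: Transposition.transpose_def pf_def) (metis pf8_swap(5))
  show "alternating_at 6 7"
    unfolding alternating_at_def * by (simp add: Transposition.transpose_def pf_def) (metis pf8_swap(6))
  show "alternating_at 7 8"
    unfolding alternating_at_def * by (simp add: Transposition.transpose_def pf_def) (metis pf8_swap(7))
qed

lemma alternating_at_trans:
  assumes "alternating_at l m" "alternating_at m n" "l \<noteq> m" "m \<noteq> n" "l \<noteq> n"
  shows "alternating_at l n"
  unfolding alternating_at_def
proof (intro allI impI)
  fix x :: "complex^8^8" assume x: "skew x"
  let ?s = "Transposition.transpose"
  have "?s l n = ?s l m \<circ> ?s m n \<circ> ?s l m"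
    using assms(3-5) by (auto simp: fun_eq_iff Transposition.transpose_def)
  then have "relabel (?s l n) x = relabel (?s l m) (relabel (?s m n) (relabel (?s l m) x))"
    by (simp add: relabel_def)
  then show "pf (relabel (?s l n) x) = - pf x"
    using assms(1,2) x by (simp add: alternating_at_def skew_relabel)
qed

lemma alternating_at_sym: "alternating_at m n \<Longrightarrow> alternating_at n m"
  by (simp add: alternating_at_def transpose_commute)

lemma pf_relabel_transpose:
  assumes "skew (x::complex^8^8)" "m \<noteq> n"
  shows "pf (relabel (Transposition.transpose m n) x) = - pf x"
proof -
  have 2: "alternating_at 1 2" by (rule pf_swap_adjacent)
  have 3: "alternating_at 1 3" by (rule alternating_at_trans[OF 2 pf_swap_adjacent(2)]) simp_all
  have 4: "alternating_at 1 4" by (rule alternating_at_trans[OF 3 pf_swap_adjacent(3)]) simp_all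
  have 5: "alternating_at 1 5" by (rule alternating_at_trans[OF 4 pf_swap_adjacent(4)]) simp_all
  have 6: "alternating_at 1 6" by (rule alternating_at_trans[OF 5 pf_swap_adjacent(5)]) simp_all
  have 7: "alternating_at 1 7" by (rule alternating_at_trans[OF 6 pf_swap_adjacent(6)]) simp_all
  have 8: "alternating_at 1 8" by (rule alternating_at_trans[OF 7 pf_swap_adjacent(7)]) simp_all
  have "alternating_at 1 k" if "k \<noteq> 1" for k
    using exhaust_8[of k] that 2 3 4 5 6 7 8 by blast
  then have "alternating_at m n"
    using alternating_at_trans[of m 1 n] alternating_at_sym assms(2) by (cases "m = 1"; cases "n =
        1") auto
  then show ?thesis using assms(1) by (simp add: alternating_at_def)
qed

definition add_row_col :: "8 \<Rightarrow> 8 \<Rightarrow> 'a::comm_ring_1^8^8 \<Rightarrow> 'a^8^8" where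
  "add_row_col m n x = (\<chi> i j. x$i$j + (if i = m then x$n$j else 0) + (if j = m then x$i$n else 0))"

lemma skew_add_row_col:
  assumes "skew x"
  shows "skew (add_row_col m n x)"
proof (rule skewI)
  fix i j
  show "add_row_col m n x $ j $ i = - add_row_col m n x $ i $ j"
    using skew_nth[OF assms, of i j] skew_nth[OF assms, of i n] skew_nth[OF assms, of n j]
    by (simp add: add_row_col_def)
qed

lemma pf_add_row_col_1_2: "skew (x::complex^8^8) \<Longrightarrow> pf (add_row_col 1 2 x) = pf x"
proof -
  assume x: "skew x"
  let ?y = "add_row_col 1 2 x"
  have 6: "pf6 ?y i j k l m n = pf6 x i j k l m n" if "1 \<notin> {i, j, k, l, m, n}" for i j k l m n
    using that by (simp add: pf6_def pf4_def add_row_col_def)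
  have 1: "?y$1$k = x$1$k + x$2$k" if "k \<noteq> 1" for k
    using that by (simp add: add_row_col_def)
  have "pf8 x 2 2 3 4 5 6 7 8 = 0"
    using pf8_swap(1)[OF x, of 2 2 3 4 5 6 7 8] by simp
  moreover have "pf ?y = pf x + pf8 x 2 2 3 4 5 6 7 8"
    unfolding pf_def pf8_def by (simp add: 6 1 ring_distribs)
  ultimately show ?thesis by simp
qed

lemma pf_add_row_col:
  assumes x: "skew (x::complex^8^8)" and mn: "m \<noteq> n"
  shows "pf (add_row_col m n x) = pf x"
proof -
  let ?s = "Transposition.transpose"
  define k where "k = ?s 1 m n"
  have k: "k \<noteq> 1" using mn by (auto simp: k_def Transposition.transpose_def split: if_splits)
  have *: "pf (add_row_col (\<sigma> m) (\<sigma> n) x) = pf x"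
    if "\<sigma> = ?s p q" "p \<noteq> q" "\<And>x::complex^8^8. skew x \<Longrightarrow> pf (add_row_col m n x) = pf x" "skew x" for \<sigma>
        p q m n and x :: "complex^8^8"
  proof -
    have ss: "\<sigma> (\<sigma> i) = i" for i using that(1) by simp
    have e: "\<sigma> i = \<sigma> j \<longleftrightarrow> i = j" for i j by (metis ss)
    have "relabel \<sigma> (add_row_col (\<sigma> m) (\<sigma> n) x) = add_row_col m n (relabel \<sigma> x)"
      by (simp add: relabel_def add_row_col_def vec_eq_iff e)
    moreover have "skew (add_row_col (\<sigma> m) (\<sigma> n) x)"
      by (rule skew_add_row_col[OF that(4)])
    ultimately have "- pf (add_row_col (\<sigma> m) (\<sigma> n) x) = - pf x"
      using pf_relabel_transpose[of "add_row_col (\<sigma> m) (\<sigma> n) x" p q] pf_relabel_transpose[of x p q]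
        that(1,2,4) that(3)[OF skew_relabel[OF that(4), of \<sigma>]] by simp
    then show ?thesis by simp
  qed
  have 1: "pf (add_row_col 1 k x) = pf x" if "skew x" for x :: "complex^8^8"
  proof (cases "k = 2")
    case False
    then show ?thesis using *[of "?s 2 k" 2 k 1 2 x] k that pf_add_row_col_1_2
      by (simp add: Transposition.transpose_def)
  qed (simp add: pf_add_row_col_1_2 that)
  show ?thesis
  proof (cases "m = 1")
    case True
    then show ?thesis using 1[OF x] by (simp add: k_def)
  next
    case False
    then show ?thesis using *[of "?s 1 m" 1 m 1 k x] 1 x by (simp add: k_def)
  qed
qed

abbreviation cmat :: "real^8^8 \<Rightarrow> complex^8^8" where
  "cmat \<equiv> map_matrix complex_of_real"

definition congruence :: "'a::comm_ring_1^'n^'n \<Rightarrow> 'a^'n^'n \<Rightarrow> 'a^'n^'n" where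
  "congruence A x = A ** x ** transpose A"

lemma congruence_nth:
  "congruence A x $ i $ j = (\<Sum>k\<in>UNIV. \<Sum>l\<in>UNIV. A$i$k * x$k$l * A$j$l)"
  unfolding congruence_def
  by (simp add: matrix_matrix_mult_def transpose_def sum_distrib_right)
     (rule sum.swap)

lemma congruence_mult: "congruence (A ** B) x = congruence A (congruence B x)"
  by (simp add: congruence_def matrix_transpose_mul matrix_mul_assoc)

lemma skew_congruence: "skew x \<Longrightarrow> skew (congruence A x)"
  by (simp add: skew_def congruence_def matrix_transpose_mul mat_simps)

lemma cmat_mult: "cmat (A ** B) = cmat A ** cmat B"
  by (simp add: vec_eq_iff matrix_matrix_mult_def)

lemma cmat_transpose: "cmat (transpose A) = transpose (cmat A)"
  by (simp add: vec_eq_iff transpose_def)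

lemma pf_zero_row:
  assumes y: "skew (y::complex^8^8)" and 0: "\<And>k. y$i$k = 0"
  shows "pf y = 0"
proof -
  have *: "pf z = 0" if "\<And>k. z$1$k = 0" for z :: "complex^8^8"
    by (simp add: pf_def pf8_def that)
  show ?thesis
  proof (cases "i = 1")
    case False
    have "pf (relabel (Transposition.transpose 1 i) y) = 0"
      by (rule *) (simp add: relabel_def 0)
    then show ?thesis using pf_relabel_transpose[OF y, of 1 i] False by simp
  qed (use * 0 in blast)
qed

lemma pf_scale_rows:
  "pf (\<chi> i j. a i * a j * x$i$j) = (\<Prod>i\<in>UNIV. a i) * pf (x::complex^8^8)"
proof -
  let ?y = "(\<chi> i j. a i * a j * x$i$j) :: complex^8^8"
  have 4: "pf4 ?y i j k l = a i * a j * a k * a l * pf4 x i j k l" for i j k l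
    by (simp add: pf4_def algebra_simps)
  have 6: "pf6 ?y i j k l m n = a i * a j * a k * a l * a m * a n * pf6 x i j k l m n" for i j k l m n
    unfolding pf6_def 4 by (simp add: algebra_simps)
  have "pf8 ?y i j k l m n p q = a i * a j * a k * a l * a m * a n * a p * a q * pf8 x i j k l m n p q"
    for i j k l m n p q
    unfolding pf8_def 6 by (simp add: algebra_simps)
  then show ?thesis by (simp add: pf_def prod_8)
qed

lemma pf_congruence:
  assumes "skew (x::complex^8^8)"
  shows "pf (congruence (cmat A) x) = complex_of_real (det A) * pf x"
proof -
  have "\<forall>x. skew x \<longrightarrow> pf (congruence (cmat A) x) = complex_of_real (det A) * pf x" (is "?P A")
  proof (induction A rule: induct_matrix_elementary_alt)
    case (1 A B)
    then show ?case by (simp add: cmat_mult congruence_mult skew_congruence det_mul)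
  next
    case (2 A i)
    then have "A$i$k = 0" for k by (simp add: row_def vec_eq_iff)
    then have "congruence (cmat A) x $ i $ k = 0" for x k by (simp add: congruence_nth)
    moreover have "det A = 0" using 2 by (rule det_zero_row(1))
    ultimately show ?case using pf_zero_row skew_congruence by (metis mult_zero_left of_real_0)
  next
    case (3 A)
    have "congruence (cmat A) x = (\<chi> i j. of_real (A$i$i) * of_real (A$j$j) * x$i$j)" for x
    proof -
      have "(cmat A ** M)$i$j = of_real (A$i$i) * M$i$j" for M :: "complex^8^8" and i j
      proof -
        have "(\<Sum>k\<in>UNIV. of_real (A$i$k) * M$k$j) = (\<Sum>k\<in>UNIV. if k = i then of_real (A$i$i) * M$i$j
            else 0)"
          using 3[of i] by (intro sum.cong) auto
        then show ?thesis by (simp add: matrix_matrix_mult_def)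
      qed
      moreover have "(M ** transpose (cmat A))$i$j = of_real (A$j$j) * M$i$j" for M :: "complex^8^8"
          and i j
      proof -
        have "(\<Sum>k\<in>UNIV. M$i$k * of_real (A$j$k)) = (\<Sum>k\<in>UNIV. if k = j then of_real (A$j$j) * M$i$j
            else 0)"
          using 3[of j] by (intro sum.cong) auto
        then show ?thesis by (simp add: matrix_matrix_mult_def transpose_def)
      qed
      ultimately show ?thesis by (simp add: congruence_def vec_eq_iff)
    qed
    then show ?case using det_diagonal[of A] 3 by (simp add: pf_scale_rows)
  next
    case (4 m n)
    let ?s = "Transposition.transpose m n" and ?A = "(\<chi> i j. mat 1 $ i $ Transposition.transpose m n
        j) :: real^8^8"
    have "cmat ?A $ i $ k = (if k = ?s i then 1 else 0)" for i k
      by (auto simp: mat_def)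
    then have "congruence (cmat ?A) x = relabel ?s x" for x
      by (simp only: vec_eq_iff congruence_nth relabel_def vec_lambda_beta)
         (simp add: if_distrib[of "\<lambda>x. x * _"] if_distrib[of "\<lambda>x. _ * x"] cong: if_cong)
    moreover have "det ?A = - 1"
      using det_permute_columns[of ?s "mat 1"] 4 by (simp add: permutes_swap_id sign_swap_id)
    ultimately show ?case using 4 by (simp add: pf_relabel_transpose)
  next
    case (5 m n)
    let ?A = "(\<chi> i j. of_bool (i = m \<and> j = n \<or> i = j)) :: real^8^8"
    have A: "cmat ?A $ i $ k = (if k = i then 1 else 0) + (if i = m then (if k = n then 1 else 0)
        else 0)" for i k
      using 5 by auto
    have "congruence (cmat ?A) x = add_row_col m n x" if "skew x" for x
      unfolding vec_eq_iff congruence_nth A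
      using skew_diag[OF that, of n]
      by (simp add: add_row_col_def ring_distribs sum.distrib if_distrib[of "\<lambda>x. x * _"]
          if_distrib[of "\<lambda>x. _ * x"] cong: if_cong)
    moreover have "det ?A = 1"
    proof -
      have "?A = (\<chi> k. if k = m then row m (mat 1) + 1 *s row n (mat 1) else row k (mat 1))"
        using 5 by (auto simp: vec_eq_iff row_def mat_def)
      then show ?thesis
        using det_row_operation[OF 5, where c = 1 and A = "mat 1 :: real^8^8"] by (simp only: det_I)
    qed
    ultimately show ?case using 5 by (simp add: pf_add_row_col)
  qed
  then show ?thesis using assms by blast
qed

definition dpf4 :: "'a::comm_ring_1^8^8 \<Rightarrow> 'a^8^8 \<Rightarrow> 8 \<Rightarrow> 8 \<Rightarrow> 8 \<Rightarrow> 8 \<Rightarrow> 'a" where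
  "dpf4 x y i j k l = x$i$j * y$k$l + y$i$j * x$k$l - (x$i$k * y$j$l + y$i$k * x$j$l)
    + (x$i$l * y$j$k + y$i$l * x$j$k)"

definition dpf6 :: "'a::comm_ring_1^8^8 \<Rightarrow> 'a^8^8 \<Rightarrow> 8 \<Rightarrow> 8 \<Rightarrow> 8 \<Rightarrow> 8 \<Rightarrow> 8 \<Rightarrow> 8 \<Rightarrow> 'a" where
  "dpf6 x y i j k l m n = (x$i$j * dpf4 x y k l m n + y$i$j * pf4 x k l m n)
    - (x$i$k * dpf4 x y j l m n + y$i$k * pf4 x j l m n)
    + (x$i$l * dpf4 x y j k m n + y$i$l * pf4 x j k m n)
    - (x$i$m * dpf4 x y j k l n + y$i$m * pf4 x j k l n)
    + (x$i$n * dpf4 x y j k l m + y$i$n * pf4 x j k l m)"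

definition dpf :: "'a::comm_ring_1^8^8 \<Rightarrow> 'a^8^8 \<Rightarrow> 'a" where
  "dpf x y = (x$1$2 * dpf6 x y 3 4 5 6 7 8 + y$1$2 * pf6 x 3 4 5 6 7 8)
    - (x$1$3 * dpf6 x y 2 4 5 6 7 8 + y$1$3 * pf6 x 2 4 5 6 7 8)
    + (x$1$4 * dpf6 x y 2 3 5 6 7 8 + y$1$4 * pf6 x 2 3 5 6 7 8)
    - (x$1$5 * dpf6 x y 2 3 4 6 7 8 + y$1$5 * pf6 x 2 3 4 6 7 8)
    + (x$1$6 * dpf6 x y 2 3 4 5 7 8 + y$1$6 * pf6 x 2 3 4 5 7 8)
    - (x$1$7 * dpf6 x y 2 3 4 5 6 8 + y$1$7 * pf6 x 2 3 4 5 6 8)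
    + (x$1$8 * dpf6 x y 2 3 4 5 6 7 + y$1$8 * pf6 x 2 3 4 5 6 7)"

definition shift :: "'a::comm_ring_1 \<Rightarrow> 'a^'n^'n \<Rightarrow> 'a^'n^'n \<Rightarrow> 'a^'n^'n" where
  "shift t x y = (\<chi> i j. x$i$j + t * y$i$j)"

lemma skew_shift:
  assumes "skew x" "skew y"
  shows "skew (shift t x y)"
proof (rule skewI)
  fix i j
  show "shift t x y $ j $ i = - shift t x y $ i $ j"
    using skew_nth[OF assms(1), of i j] skew_nth[OF assms(2), of i j] by (simp add: shift_def)
qed

lemma pf_add_expand:
  fixes x y :: "complex^8^8"
  shows "\<exists>c2 c3 c4. \<forall>t. pf (shift t x y) = pf x + t * dpf x y + t^2 * c2 + t^3 * c3 + t^4 * c4"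
proof -
  have 4: "pf4 (shift t x y) i j k l = pf4 x i j k l + t * dpf4 x y i j k l + t^2 * pf4 y i j k l"
    for t i j k l
    by (simp add: shift_def pf4_def dpf4_def power2_eq_square algebra_simps)
  have s: "dpf4 y x = dpf4 x y" by (simp add: fun_eq_iff dpf4_def algebra_simps)
  have 6: "pf6 (shift t x y) i j k l m n = pf6 x i j k l m n + t * dpf6 x y i j k l m n
      + t^2 * dpf6 y x i j k l m n + t^3 * pf6 y i j k l m n" for t i j k l m n
    unfolding pf6_def dpf6_def 4 s
    by (simp add: shift_def power2_eq_square power3_eq_cube ring_distribs)
  define b where "b x y = (x$1$2 * dpf6 y x 3 4 5 6 7 8 + y$1$2 * dpf6 x y 3 4 5 6 7 8)
    - (x$1$3 * dpf6 y x 2 4 5 6 7 8 + y$1$3 * dpf6 x y 2 4 5 6 7 8)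
    + (x$1$4 * dpf6 y x 2 3 5 6 7 8 + y$1$4 * dpf6 x y 2 3 5 6 7 8)
    - (x$1$5 * dpf6 y x 2 3 4 6 7 8 + y$1$5 * dpf6 x y 2 3 4 6 7 8)
    + (x$1$6 * dpf6 y x 2 3 4 5 7 8 + y$1$6 * dpf6 x y 2 3 4 5 7 8)
    - (x$1$7 * dpf6 y x 2 3 4 5 6 8 + y$1$7 * dpf6 x y 2 3 4 5 6 8)
    + (x$1$8 * dpf6 y x 2 3 4 5 6 7 + y$1$8 * dpf6 x y 2 3 4 5 6 7)" for x y :: "complex^8^8"
  have "pf (shift t x y) = pf x + t * dpf x y + t^2 * b x y + t^3 * dpf y x + t^4 * pf y" for t
    unfolding pf_def pf8_def dpf_def b_def 6
    by (simp add: shift_def power2_eq_square power3_eq_cube power4_eq_xxxx ring_distribs)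
  then show ?thesis by blast
qed

lemma dpf_congruence:
  assumes "skew (x::complex^8^8)" "skew y"
  shows "dpf (congruence (cmat A) x) (congruence (cmat A) y) = complex_of_real (det A) * dpf x y"
proof -
  let ?C = "congruence (cmat A)"
  obtain c2 c3 c4 where c: "\<And>t. pf (shift t x y) = pf x + t * dpf x y + t^2 * c2 + t^3 * c3 + t^4 * c4"
    using pf_add_expand[of x y] by blast
  obtain d2 d3 d4 where d: "\<And>t. pf (shift t (?C x) (?C y)) =
      pf (?C x) + t * dpf (?C x) (?C y) + t^2 * d2 + t^3 * d3 + t^4 * d4"
    using pf_add_expand[of "?C x" "?C y"] by blast
  have "shift t (?C x) (?C y) = ?C (shift t x y)" for t
    by (simp add: shift_def vec_eq_iff congruence_nth sum.distrib sum_distrib_left ring_distribs mult_ac)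
  moreover have "skew (shift t x y)" for t
    by (rule skew_shift[OF assms])
  ultimately have e: "pf (shift t (?C x) (?C y)) = complex_of_real (det A) * pf (shift t x y)" for t
    by (simp add: pf_congruence)
  have *: "a = D * b"
    if "p + a + q2 + q3 + q4 = D * (r + b + s2 + s3 + s4)" "p - a + q2 - q3 + q4 = D * (r - b + s2 -
        s3 + s4)"
      "p + 2 * a + 4 * q2 + 8 * q3 + 16 * q4 = D * (r + 2 * b + 4 * s2 + 8 * s3 + 16 * s4)"
      "p - 2 * a + 4 * q2 - 8 * q3 + 16 * q4 = D * (r - 2 * b + 4 * s2 - 8 * s3 + 16 * s4)"
    for a b p q2 q3 q4 r s2 s3 s4 D :: complex
    using that by algebra
  show ?thesis
    using *[OF e[of 1, unfolded c d, simplified] e[of "-1", unfolded c d, simplified]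
        e[of 2, unfolded c d, simplified] e[of "-2", unfolded c d, simplified]] by simp
qed

lemma dpf_add: "dpf x (y + z) = dpf x y + dpf x z"
proof -
  have 4: "dpf4 x (y + z) i j k l = dpf4 x y i j k l + dpf4 x z i j k l" for i j k l
    by (simp add: dpf4_def algebra_simps)
  have 6: "dpf6 x (y + z) i j k l m n = dpf6 x y i j k l m n + dpf6 x z i j k l m n" for i j k l m n
    unfolding dpf6_def 4 by (simp add: ring_distribs)
  show ?thesis unfolding dpf_def 6 by (simp add: ring_distribs)
qed

lemma dpf_smult: "dpf x (\<chi> i j. c * y$i$j) = c * dpf x y"
proof -
  let ?y = "\<chi> i j. c * y$i$j"
  have 4: "dpf4 x ?y i j k l = c * dpf4 x y i j k l" for i j k l
    by (simp add: dpf4_def algebra_simps)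
  have 6: "dpf6 x ?y i j k l m n = c * dpf6 x y i j k l m n" for i j k l m n
    unfolding dpf6_def 4 by (simp add: algebra_simps)
  show ?thesis unfolding dpf_def 6 by (simp add: algebra_simps)
qed

lemma dpf_sum: "dpf x (sum y S) = (\<Sum>k\<in>S. dpf x (y k))"
proof (induction S rule: infinite_finite_induct)
  case empty
  show ?case using dpf_smult[of x 0 "mat 1"] by (simp add: zero_vec_def)
next
  case (infinite S)
  then show ?case using dpf_smult[of x 0 "mat 1"] by (simp add: zero_vec_def)
qed (simp_all add: dpf_add)

text \<open>The gradient of the Pfaffian: \<open>dpf x y\<close> is the derivative of \<open>pf\<close> at \<open>x\<close> in direction \<open>y\<close>.\<close>

definition pfadj :: "'a::comm_ring_1^8^8 \<Rightarrow> 'a^8^8" where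
  "pfadj x = (\<chi> i j. dpf x (skew_unit i j))"

lemma skew_pfadj: "skew (pfadj (x :: 'a::comm_ring_1^8^8))"
proof (rule skewI)
  fix i j
  have "dpf x (\<chi> k l. - 1 * skew_unit i j $ k $ l) = - dpf x (skew_unit i j)"
    unfolding dpf_smult by simp
  moreover have "(\<chi> k l. - 1 * skew_unit i j $ k $ l) = (skew_unit j i :: 'a^8^8)"
    by (simp add: vec_eq_iff skew_unit_def)
  ultimately show "pfadj x $ j $ i = - pfadj x $ i $ j" by (simp add: pfadj_def)
qed

lemma matrix_unit_sum:
  "(\<Sum>k\<in>UNIV. \<Sum>l\<in>UNIV. u k * matrix_unit i j $ k $ l * v l) = u i * (v j :: 'a::comm_ring_1)"
proof -
  have "u k * matrix_unit i j $ k $ l * v l = (if l = j then (if k = i then u i * v j else 0) else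
      0)" for k l
    by (simp add: matrix_unit_def)
  then show ?thesis by simp
qed

lemma pfadj_congruence:
  assumes x: "skew (x::complex^8^8)" and A: "orthogonal_matrix A"
  shows "pfadj (congruence (cmat A) x) = (\<chi> i j. complex_of_real (det A) * congruence (cmat A)
      (pfadj x) $ i $ j)"
proof -
  let ?B = "cmat A"
  have AA: "A ** transpose A = mat 1" using A by (simp add: orthogonal_matrix_def)
  have BB: "?B ** transpose ?B = mat 1"
    using arg_cong[OF AA, of cmat] by (simp add: cmat_mult cmat_transpose) (simp add: vec_eq_iff mat_def)
  have "dpf (congruence ?B x) (skew_unit i j) = of_real (det A) * congruence ?B (pfadj x) $ i $ j" for i j
  proof -
    define h where "h = congruence (transpose ?B) (skew_unit i j)"
    have h: "h = (\<Sum>k\<in>UNIV. \<Sum>l\<in>UNIV. \<chi> m n. ?B$i$k * ?B$j$l * skew_unit k l $ m $ n)"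
    proof -
      have "h$m$n = ?B$i$m * ?B$j$n - ?B$j$m * ?B$i$n" for m n
        unfolding h_def congruence_nth skew_unit_def
        by (simp add: transpose_def ring_distribs sum_subtractf matrix_unit_sum)
      moreover have "(\<Sum>k\<in>UNIV. \<Sum>l\<in>UNIV. ?B$i$k * ?B$j$l * skew_unit k l $ m $ n)
        = ?B$i$m * ?B$j$n - ?B$j$m * ?B$i$n" for m n
      proof -
        have "(\<Sum>k\<in>UNIV. \<Sum>l\<in>UNIV. ?B$i$k * ?B$j$l * skew_unit k l $ m $ n)
          = (\<Sum>k\<in>UNIV. \<Sum>l\<in>UNIV. ?B$i$k * ?B$j$l * matrix_unit k l $ m $ n)
            - (\<Sum>l\<in>UNIV. \<Sum>k\<in>UNIV. ?B$i$k * ?B$j$l * matrix_unit l k $ m $ n)"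
          by (subst (3) sum.swap) (simp add: skew_unit_def ring_distribs sum_subtractf)
        then show ?thesis by (simp only: sum_matrix_unit_nth) (simp add: mult.commute)
      qed
      ultimately show ?thesis by (simp add: vec_eq_iff)
    qed
    have "skew h" unfolding h_def by (rule skew_congruence[OF skew_skew_unit])
    moreover have "congruence ?B h = skew_unit i j"
      using BB by (simp add: h_def congruence_mult[symmetric] ) (simp add: congruence_def)
    ultimately have "dpf (congruence ?B x) (skew_unit i j) = of_real (det A) * dpf x h"
      using dpf_congruence[OF x, of h A] by simp
    also have "dpf x h = (\<Sum>k\<in>UNIV. \<Sum>l\<in>UNIV. ?B$i$k * ?B$j$l * dpf x (skew_unit k l))"
      unfolding h by (simp only: dpf_sum dpf_smult)
    also have "\<dots> = congruence ?B (pfadj x) $ i $ j"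
      by (simp add: congruence_nth pfadj_def mult_ac)
    finally show ?thesis .
  qed
  then show ?thesis by (simp add: pfadj_def vec_eq_iff)
qed

section \<open>Coordinates for the exceptional Jordan algebra\<close>

fun cinner :: "'a::comm_ring_1 cayley \<Rightarrow> 'a cayley \<Rightarrow> 'a" where
  "cinner ((a0, a1, a2, a3), (b0, b1, b2, b3)) ((c0, c1, c2, c3), (d0, d1, d2, d3)) =
    a0 * c0 + a1 * c1 + a2 * c2 + a3 * c3 + b0 * d0 + b1 * d1 + b2 * d2 + b3 * d3"

definition cscalar :: "'a::comm_ring_1 \<Rightarrow> 'a cayley" where
  "cscalar t = ((t, 0, 0, 0), 0)"

lemma cconj_cscalar: "cconj (cscalar t) = cscalar t"
  by (simp add: cscalar_def)

lemma cconj_cconj: "cconj (cconj x) = x"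
  by (cases x) (simp add: qconj_qconj)

lemma vector_3_3:
  "vector [a, b, c] $ (1::3) = a" "vector [a, b, c] $ (2::3) = b" "vector [a, b, c] $ (3::3) = c"
  by (simp_all add: vector_def)

lift_definition herm_mk :: "complex \<Rightarrow> complex \<Rightarrow> complex \<Rightarrow> complex cayley \<Rightarrow> complex cayley \<Rightarrow>
    complex cayley \<Rightarrow> jordanC" is
  "\<lambda>a b c x y z. vector [vector [cscalar a, z, cconj y], vector [cconj z, cscalar b, x],
    vector [y, cconj x, cscalar c]]"
  by (simp add: mem_jordan_complexification forall_3 vector_3_3 cconj_cscalar cconj_cconj)

lemma cayley_exhaust:
  obtains a0 a1 a2 a3 b0 b1 b2 b3 where "x = ((a0, a1, a2, a3), (b0, b1, b2, b3))"
  by (metis prod.collapse)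

lemma cconj_fixed: "cconj x = x \<Longrightarrow> x = cscalar (creal x)" for x :: "complex cayley"
  by (cases x rule: cayley_exhaust) (simp add: cscalar_def zero_prod_def)

lemma herm_mk_cases:
  obtains a b c x y z where "X = herm_mk a b c x y z"
proof -
  have "\<exists>a b c x y z. X = herm_mk a b c x y z"
  proof (transfer)
    fix X assume "X \<in> jordan_complexification"
    then have X: "cconj (X $ j $ i) = X $ i $ j" for i j
      by (simp add: mem_jordan_complexification)
    have "X = vector [vector [cscalar (creal (X$1$1)), X$1$2, cconj (X$3$1)],
        vector [cconj (X$1$2), cscalar (creal (X$2$2)), X$2$3],
        vector [X$3$1, cconj (X$2$3), cscalar (creal (X$3$3))]]"
      using cconj_fixed[OF X, of 1] cconj_fixed[OF X, of 2] cconj_fixed[OF X, of 3]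
      by (simp add: vec_eq_iff forall_3 vector_3_3 X)
    then show "\<exists>a b c x y z. X = vector [vector [cscalar a, z, cconj y],
        vector [cconj z, cscalar b, x], vector [y, cconj x, cscalar c]]" by blast
  qed
  then show thesis using that by blast
qed

lemma cscalar_inject: "cscalar a = cscalar b \<longleftrightarrow> a = b"
  by (simp add: cscalar_def)

lemma herm_mk_inject:
  "herm_mk a b c x y z = herm_mk a' b' c' x' y' z' \<longleftrightarrow> a = a' \<and> b = b' \<and> c = c' \<and> x = x' \<and> y = y' \<and> z = z'"
  by transfer (auto simp: vec_eq_iff forall_3 vector_3_3 cscalar_inject)

lemma cscalar_ops:
  "cscalar a + cscalar b = cscalar (a + b)" "- cscalar a = cscalar (- a)"
  "cscalar a - cscalar b = cscalar (a - b)" "(0::'a::comm_ring_1 cayley) = cscalar 0"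
  by (simp_all add: cscalar_def zero_prod_def)

lemma herm_mk_add: "herm_mk a b c x y z + herm_mk a' b' c' x' y' z' =
    herm_mk (a + a') (b + b') (c + c') (x + x') (y + y') (z + z')"
  by transfer (simp add: vec_eq_iff forall_3 vector_3_3 cscalar_ops cconj_add)

lemma herm_mk_diff: "herm_mk a b c x y z - herm_mk a' b' c' x' y' z' =
    herm_mk (a - a') (b - b') (c - c') (x - x') (y - y') (z - z')"
  by transfer (simp add: vec_eq_iff forall_3 vector_3_3 cscalar_ops cconj_diff)

lemma herm_mk_uminus: "- herm_mk a b c x y z = herm_mk (- a) (- b) (- c) (- x) (- y) (- z)"
  by transfer (simp add: vec_eq_iff forall_3 vector_3_3 cscalar_ops cconj_minus)

lemma herm_mk_zero: "(0::jordanC) = herm_mk 0 0 0 0 0 0"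
  by transfer (simp add: vec_eq_iff forall_3 vector_3_3 cconj_0 cscalar_def zero_prod_def)

lemma cayley_map_cscalar: "f 0 = 0 \<Longrightarrow> cayley_map f (cscalar a) = cscalar (f a)"
  by (simp add: cscalar_def zero_prod_def)

lemma jscale_herm_mk: "jscale t (herm_mk a b c x y z) = herm_mk (t * a) (t * b) (t * c)
    (cayley_map ((*) t) x) (cayley_map ((*) t) y) (cayley_map ((*) t) z)"
  by transfer (simp add: vec_eq_iff forall_3 vector_3_3 cayley_map_cscalar cconj_cayley_map)

lemma jtau_herm_mk: "jtau (herm_mk a b c x y z) = herm_mk (cnj a) (cnj b) (cnj c)
    (cayley_map cnj x) (cayley_map cnj y) (cayley_map cnj z)"
  by transfer (simp add: vec_eq_iff forall_3 vector_3_3 cayley_map_cscalar cconj_cayley_map)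

lemma cgamma_cconj: "cgamma (cconj x) = cconj (cgamma x)"
  by (cases x) simp

lemma cgammaC_cconj: "cgammaC (cconj x) = cconj (cgammaC x)"
  by (cases x) auto

lemma jgamma_herm_mk: "jgamma (herm_mk a b c x y z) = herm_mk a b c (cgamma x) (cgamma y) (cgamma z)"
  by transfer (simp add: vec_eq_iff forall_3 vector_3_3 cgamma_cconj, simp add: cscalar_def)

lemma jgammaC_herm_mk: "jgammaC (herm_mk a b c x y z) = herm_mk a b c (cgammaC x) (cgammaC y) (cgammaC z)"
  by transfer (simp add: vec_eq_iff forall_3 vector_3_3 cgammaC_cconj,
      simp add: cscalar_def zero_prod_def)

lemma jtr_herm_mk: "jtr (herm_mk a b c x y z) = a + b + c"
  by transfer (simp add: sum_3 vector_3_3 cscalar_def)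

lemma jE_herm_mk: "jE = herm_mk 1 1 1 0 0 0"
  by transfer (auto simp: vec_eq_iff forall_3 vector_3_3 cscalar_def cone_def zero_prod_def)

lemma jcirc_herm_mk: "jcirc (herm_mk a b c x y z) (herm_mk a' b' c' x' y' z') =
    herm_mk (a * a' + cinner y y' + cinner z z') (b * b' + cinner x x' + cinner z z')
      (c * c' + cinner x x' + cinner y y')
      (cayley_map ((*) (1/2)) (cayley_map ((*) (b + c)) x' + cayley_map ((*) (b' + c')) x
        + cconj (cmult y z') + cconj (cmult y' z)))
      (cayley_map ((*) (1/2)) (cayley_map ((*) (a + c)) y' + cayley_map ((*) (a' + c')) y
        + cconj (cmult z x') + cconj (cmult z' x)))
      (cayley_map ((*) (1/2)) (cayley_map ((*) (a + b)) z' + cayley_map ((*) (a' + b')) z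
        + cconj (cmult x y') + cconj (cmult x' y)))"
  apply transfer
  subgoal for a b c x y z a' b' c' x' y' z'
    apply (cases x rule: cayley_exhaust; cases y rule: cayley_exhaust; cases z rule: cayley_exhaust;
      cases x' rule: cayley_exhaust; cases y' rule: cayley_exhaust; cases z' rule: cayley_exhaust)
    apply (simp add: vec_eq_iff forall_3 vector_3_3 cmat_mult_def sum_3 cscalar_def zero_prod_def)
    apply (simp add: field_simps)
    done
  done

lemma jform_herm_mk: "jform (herm_mk a b c x y z) (herm_mk a' b' c' x' y' z') =
    a * a' + b * b' + c * c' + 2 * (cinner x x' + cinner y y' + cinner z z')"
  by (simp add: jform_def jcirc_herm_mk jtr_herm_mk)

lemma jcross_herm_mk: "jcross (herm_mk a b c x y z) (herm_mk a' b' c' x' y' z') =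
    herm_mk ((b * c' + c * b') / 2 - cinner x x') ((a * c' + c * a') / 2 - cinner y y')
      ((a * b' + b * a') / 2 - cinner z z')
      (cayley_map ((*) (1/2)) (cconj (cmult y z') + cconj (cmult y' z)
        - cayley_map ((*) a) x' - cayley_map ((*) a') x))
      (cayley_map ((*) (1/2)) (cconj (cmult z x') + cconj (cmult z' x)
        - cayley_map ((*) b) y' - cayley_map ((*) b') y))
      (cayley_map ((*) (1/2)) (cconj (cmult x y') + cconj (cmult x' y)
        - cayley_map ((*) c) z' - cayley_map ((*) c') z))"
    apply (cases x rule: cayley_exhaust; cases y rule: cayley_exhaust; cases z rule: cayley_exhaust;
      cases x' rule: cayley_exhaust; cases y' rule: cayley_exhaust; cases z' rule: cayley_exhaust)
   apply (simp only: jcross_def jform_herm_mk jcirc_herm_mk jtr_herm_mk jE_herm_mk jscale_herm_mk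
       herm_mk_add herm_mk_diff herm_mk_inject)
  apply (simp add: zero_prod_def)
  apply (simp add: field_simps)
  done

text \<open>
  Null coordinates \<open>p\<^sub>k = a\<^sub>k + \<i> b\<^sub>k\<close>, \<open>q\<^sub>k = a\<^sub>k - \<i> b\<^sub>k\<close> of the element with quaternion
  components \<open>a\<close> and \<open>b\<close>: the norm becomes \<open>\<Sum> p\<^sub>k q\<^sub>k\<close> and \<open>\<gamma>\<close> exchanges \<open>p\<close> and \<open>q\<close>.
\<close>

fun null_cayley :: "complex quat \<Rightarrow> complex quat \<Rightarrow> complex cayley" where
  "null_cayley (p0, p1, p2, p3) (q0, q1, q2, q3) =
    (((p0 + q0) / 2, (p1 + q1) / 2, (p2 + q2) / 2, (p3 + q3) / 2),
     ((q0 - p0) * \<i> / 2, (q1 - p1) * \<i> / 2, (q2 - p2) * \<i> / 2, (q3 - p3) * \<i> / 2))"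

lemma null_cayley_cases:
  obtains p0 p1 p2 p3 q0 q1 q2 q3 where "x = null_cayley (p0, p1, p2, p3) (q0, q1, q2, q3)"
proof (cases x rule: cayley_exhaust)
  case (1 a0 a1 a2 a3 b0 b1 b2 b3)
  have "\<i> * (b * \<i>) = - b" for b by (simp add: algebra_simps)
  then have "x = null_cayley (a0 + \<i> * b0, a1 + \<i> * b1, a2 + \<i> * b2, a3 + \<i> * b3)
      (a0 - \<i> * b0, a1 - \<i> * b1, a2 - \<i> * b2, a3 - \<i> * b3)"
    by (simp add: 1)
  then show thesis by (rule that)
qed

lemma null_cayley_inject: "null_cayley (p0, p1, p2, p3) (q0, q1, q2, q3) = null_cayley (r0, r1, r2,
    r3) (s0, s1, s2, s3) \<longleftrightarrow>
    p0 = r0 \<and> p1 = r1 \<and> p2 = r2 \<and> p3 = r3 \<and> q0 = s0 \<and> q1 = s1 \<and> q2 = s2 \<and> q3 = s3"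
proof -
  have *: "p + q = r + s \<and> q - p = s - r \<longleftrightarrow> p = r \<and> q = s" for p q r s :: complex
  proof -
    have 1: "p = ((p + q) - (q - p)) / 2" and 2: "q = ((p + q) + (q - p)) / 2" for p q :: complex
      by (simp_all add: field_simps)
    have "p = r \<and> q = s" if that: "p + q = r + s" "q - p = s - r"
    proof
      show "p = r" using 1[of p q] 1[of r s, symmetric] by (simp only: that)
      show "q = s" using 2[of q p] 2[of s r, symmetric] by (simp only: that)
    qed
    then show ?thesis by blast
  qed
  show ?thesis (is "?l \<longleftrightarrow> ?r")
  proof
    assume ?l
    then have "p0 + q0 = r0 + s0 \<and> q0 - p0 = s0 - r0" "p1 + q1 = r1 + s1 \<and> q1 - p1 = s1 - r1"
      "p2 + q2 = r2 + s2 \<and> q2 - p2 = s2 - r2" "p3 + q3 = r3 + s3 \<and> q3 - p3 = s3 - r3"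
      by (simp_all only: null_cayley.simps prod.inject divide_cancel_right mult_cancel_right)
        (simp_all only: complex_i_not_zero zero_neq_numeral [symmetric] simp_thms)
    then show ?r unfolding * by blast
  qed simp
qed

lemma null_cayley_add: "null_cayley (p0, p1, p2, p3) (q0, q1, q2, q3) + null_cayley (r0, r1, r2, r3)
    (s0, s1, s2, s3) =
    null_cayley (p0 + r0, p1 + r1, p2 + r2, p3 + r3) (q0 + s0, q1 + s1, q2 + s2, q3 + s3)"
  and null_cayley_diff: "null_cayley (p0, p1, p2, p3) (q0, q1, q2, q3) - null_cayley (r0, r1, r2,
      r3) (s0, s1, s2, s3) =
    null_cayley (p0 - r0, p1 - r1, p2 - r2, p3 - r3) (q0 - s0, q1 - s1, q2 - s2, q3 - s3)"
  and null_cayley_uminus: "- null_cayley (p0, p1, p2, p3) (q0, q1, q2, q3) = null_cayley (- p0, -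
      p1, - p2, - p3) (- q0, - q1, - q2, - q3)"
  and null_cayley_scale: "cayley_map ((*) t) (null_cayley (p0, p1, p2, p3) (q0, q1, q2, q3)) =
    null_cayley (t * p0, t * p1, t * p2, t * p3) (t * q0, t * q1, t * q2, t * q3)"
  by (simp_all add: field_simps)

lemma null_cayley_cnj: "cayley_map cnj (null_cayley (p0, p1, p2, p3) (q0, q1, q2, q3)) =
    null_cayley (cnj q0, cnj q1, cnj q2, cnj q3) (cnj p0, cnj p1, cnj p2, cnj p3)"
  by (simp add: algebra_simps)

lemma null_cayley_cgamma: "cgamma (null_cayley (p0, p1, p2, p3) (q0, q1, q2, q3)) = null_cayley (q0,
    q1, q2, q3) (p0, p1, p2, p3)"
  by (simp add: field_simps)

lemma null_cayley_cgammaC: "cgammaC (null_cayley (p0, p1, p2, p3) (q0, q1, q2, q3)) =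
    null_cayley (p0, - p1, p2, - p3) (q0, - q1, q2, - q3)"
  by (simp add: field_simps)

lemma cinner_null_cayley: "cinner (null_cayley (p0, p1, p2, p3) (q0, q1, q2, q3)) (null_cayley (r0,
    r1, r2, r3) (s0, s1, s2, s3)) =
    (p0 * s0 + q0 * r0 + p1 * s1 + q1 * r1 + p2 * s2 + q2 * r2 + p3 * s3 + q3 * r3) / 2"
  by (simp add: field_simps)

lemma null_cayley_cconj_cmult:
  "cconj (cmult (null_cayley (p0, p1, p2, p3) (q0, q1, q2, q3)) (null_cayley (r0, r1, r2, r3) (s0,
      s1, s2, s3))) =
    null_cayley (q0 * s0 - p1 * s1 - p2 * s2 - p3 * s3,
         - p1 * r0 - q0 * r1 - q2 * s3 + q3 * s2,
         - p2 * r0 - q0 * r2 + q1 * s3 - q3 * s1,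
         - p3 * r0 - q0 * r3 - q1 * s2 + q2 * s1)
        (p0 * r0 - q1 * r1 - q2 * r2 - q3 * r3,
         - p0 * s1 - p2 * r3 + p3 * r2 - q1 * s0,
         - p0 * s2 + p1 * r3 - p3 * r1 - q2 * s0,
         - p0 * s3 - p1 * r2 + p2 * r1 - q3 * s0)"
  by (simp, simp add: field_simps)

lemmas null_cayley_simps = null_cayley_add null_cayley_diff null_cayley_uminus null_cayley_scale
    cinner_null_cayley null_cayley_cconj_cmult

lemma vector_8_nth:
  "vector [a, b, c, d, e, f, g, h] $ (1::8) = a"
  "vector [a, b, c, d, e, f, g, h] $ (2::8) = b"
  "vector [a, b, c, d, e, f, g, h] $ (3::8) = c"
  "vector [a, b, c, d, e, f, g, h] $ (4::8) = d"
  "vector [a, b, c, d, e, f, g, h] $ (5::8) = e"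
  "vector [a, b, c, d, e, f, g, h] $ (6::8) = f"
  "vector [a, b, c, d, e, f, g, h] $ (7::8) = g"
  "vector [a, b, c, d, e, f, g, h] $ (8::8) = h"
  by (simp_all add: vector_def)

definition skew_mk :: "complex \<Rightarrow> complex \<Rightarrow> complex \<Rightarrow> complex \<Rightarrow> complex \<Rightarrow> complex \<Rightarrow> complex \<Rightarrow> complex
    \<Rightarrow> complex \<Rightarrow> complex \<Rightarrow> complex \<Rightarrow> complex \<Rightarrow> complex \<Rightarrow> complex \<Rightarrow> complex \<Rightarrow> complex \<Rightarrow> complex \<Rightarrow>
    complex \<Rightarrow> complex \<Rightarrow> complex \<Rightarrow> complex \<Rightarrow> complex \<Rightarrow> complex \<Rightarrow> complex \<Rightarrow> complex \<Rightarrow> complex \<Rightarrow>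
    complex \<Rightarrow> complex \<Rightarrow> complex^8^8" where
  "skew_mk a12 a13 a14 a15 a16 a17 a18 a23 a24 a25 a26 a27 a28 a34 a35 a36 a37 a38 a45 a46 a47 a48
      a56 a57 a58 a67 a68 a78 = vector [
    vector [0, a12, a13, a14, a15, a16, a17, a18],
    vector [- a12, 0, a23, a24, a25, a26, a27, a28],
    vector [- a13, - a23, 0, a34, a35, a36, a37, a38],
    vector [- a14, - a24, - a34, 0, a45, a46, a47, a48],
    vector [- a15, - a25, - a35, - a45, 0, a56, a57, a58],
    vector [- a16, - a26, - a36, - a46, - a56, 0, a67, a68],
    vector [- a17, - a27, - a37, - a47, - a57, - a67, 0, a78],
    vector [- a18, - a28, - a38, - a48, - a58, - a68, - a78, 0]]"

lemma skew_mk_nth: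
  fixes a12 a13 a14 a15 a16 a17 a18 a23 a24 a25 a26 a27 a28 a34 a35 a36 a37 a38 a45 a46 a47 a48 a56
      a57 a58 a67 a68 a78 :: complex
  defines "m \<equiv> skew_mk a12 a13 a14 a15 a16 a17 a18 a23 a24 a25 a26 a27 a28 a34 a35 a36 a37 a38 a45
      a46 a47 a48 a56 a57 a58 a67 a68 a78"
  shows "m $ 1 $ 1 = 0" "m $ 1 $ 2 = a12" "m $ 1 $ 3 = a13" "m $ 1 $ 4 = a14" "m $ 1 $ 5 = a15" "m $
      1 $ 6 = a16" "m $ 1 $ 7 = a17" "m $ 1 $ 8 = a18"
    "m $ 2 $ 1 = - a12" "m $ 2 $ 2 = 0" "m $ 2 $ 3 = a23" "m $ 2 $ 4 = a24" "m $ 2 $ 5 = a25" "m $ 2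
        $ 6 = a26" "m $ 2 $ 7 = a27" "m $ 2 $ 8 = a28"
    "m $ 3 $ 1 = - a13" "m $ 3 $ 2 = - a23" "m $ 3 $ 3 = 0" "m $ 3 $ 4 = a34" "m $ 3 $ 5 = a35" "m $
        3 $ 6 = a36" "m $ 3 $ 7 = a37" "m $ 3 $ 8 = a38"
    "m $ 4 $ 1 = - a14" "m $ 4 $ 2 = - a24" "m $ 4 $ 3 = - a34" "m $ 4 $ 4 = 0" "m $ 4 $ 5 = a45" "m
        $ 4 $ 6 = a46" "m $ 4 $ 7 = a47" "m $ 4 $ 8 = a48"
    "m $ 5 $ 1 = - a15" "m $ 5 $ 2 = - a25" "m $ 5 $ 3 = - a35" "m $ 5 $ 4 = - a45" "m $ 5 $ 5 = 0"
        "m $ 5 $ 6 = a56" "m $ 5 $ 7 = a57" "m $ 5 $ 8 = a58"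
    "m $ 6 $ 1 = - a16" "m $ 6 $ 2 = - a26" "m $ 6 $ 3 = - a36" "m $ 6 $ 4 = - a46" "m $ 6 $ 5 = -
        a56" "m $ 6 $ 6 = 0" "m $ 6 $ 7 = a67" "m $ 6 $ 8 = a68"
    "m $ 7 $ 1 = - a17" "m $ 7 $ 2 = - a27" "m $ 7 $ 3 = - a37" "m $ 7 $ 4 = - a47" "m $ 7 $ 5 = -
        a57" "m $ 7 $ 6 = - a67" "m $ 7 $ 7 = 0" "m $ 7 $ 8 = a78"
    "m $ 8 $ 1 = - a18" "m $ 8 $ 2 = - a28" "m $ 8 $ 3 = - a38" "m $ 8 $ 4 = - a48" "m $ 8 $ 5 = -
        a58" "m $ 8 $ 6 = - a68" "m $ 8 $ 7 = - a78" "m $ 8 $ 8 = 0"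
  unfolding m_def skew_mk_def by (simp_all only: vector_8_nth)

lemma skew_skew_mk: "skew (skew_mk a12 a13 a14 a15 a16 a17 a18 a23 a24 a25 a26 a27 a28 a34 a35 a36
    a37 a38 a45 a46 a47 a48 a56 a57 a58 a67 a68 a78)"
  unfolding skew_def vec_eq_iff forall_8 by (simp add: transpose_def skew_mk_nth)

lemma skew_eq_skew_mk:
  assumes "skew (x :: complex^8^8)"
  shows "x = skew_mk (x$1$2) (x$1$3) (x$1$4) (x$1$5) (x$1$6) (x$1$7) (x$1$8) (x$2$3) (x$2$4) (x$2$5)
      (x$2$6) (x$2$7) (x$2$8) (x$3$4) (x$3$5) (x$3$6) (x$3$7) (x$3$8) (x$4$5) (x$4$6) (x$4$7)
      (x$4$8) (x$5$6) (x$5$7) (x$5$8) (x$6$7) (x$6$8) (x$7$8)"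
  unfolding vec_eq_iff forall_8 by (simp add: skew_mk_nth skew_lower[OF assms])

text \<open>
  The elements \<open>skew_freud x 0\<close> form the \<open>\<i>\<close>-eigenspace of \<open>\<iota>\<gamma>\<^sub>C\<close>, and \<open>skew_freud 0 y\<close> is the image of
  \<open>skew_freud y 0\<close> under \<open>\<lambda>\<gamma>\<close>. The positions and signs of the entries are those for which the quartic
  invariant of \<open>E\<^sub>7\<close> restricts to a multiple of the Pfaffian.
\<close>

definition skew_freud :: "complex^8^8 \<Rightarrow> complex^8^8 \<Rightarrow> freudC" where
  "skew_freud x y =
    (herm_mk (y$1$2) (y$3$4) (y$5$6)
      (null_cayley (- y$4$5, x$1$7, y$3$5, x$1$8) (y$3$6, - x$2$8, y$4$6, x$2$7))
      (null_cayley (y$1$6, x$3$7, - y$1$5, x$3$8) (- y$2$5, - x$4$8, - y$2$6, x$4$7))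
      (null_cayley (- y$2$3, x$5$7, y$1$3, x$5$8) (y$1$4, - x$6$8, y$2$4, x$6$7)),
     herm_mk (x$1$2) (x$3$4) (x$5$6)
      (null_cayley (x$3$6, y$2$8, x$4$6, - y$2$7) (- x$4$5, - y$1$7, x$3$5, - y$1$8))
      (null_cayley (- x$2$5, y$4$8, - x$2$6, - y$4$7) (x$1$6, - y$3$7, - x$1$5, - y$3$8))
      (null_cayley (x$1$4, y$6$8, x$2$4, - y$6$7) (- x$2$3, - y$5$7, x$1$3, - y$5$8)),
     y$7$8, x$7$8)"

section \<open>The Freudenthal cubic in terms of skew matrices\<close>

lemma skew_unit_skew_mk:
  "skew_unit 1 2 = skew_mk 1 0 0 0 0 0 0 0 0 0 0 0 0 0 0 0 0 0 0 0 0 0 0 0 0 0 0 0"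
  "skew_unit 1 3 = skew_mk 0 1 0 0 0 0 0 0 0 0 0 0 0 0 0 0 0 0 0 0 0 0 0 0 0 0 0 0"
  "skew_unit 1 4 = skew_mk 0 0 1 0 0 0 0 0 0 0 0 0 0 0 0 0 0 0 0 0 0 0 0 0 0 0 0 0"
  "skew_unit 1 5 = skew_mk 0 0 0 1 0 0 0 0 0 0 0 0 0 0 0 0 0 0 0 0 0 0 0 0 0 0 0 0"
  "skew_unit 1 6 = skew_mk 0 0 0 0 1 0 0 0 0 0 0 0 0 0 0 0 0 0 0 0 0 0 0 0 0 0 0 0"
  "skew_unit 1 7 = skew_mk 0 0 0 0 0 1 0 0 0 0 0 0 0 0 0 0 0 0 0 0 0 0 0 0 0 0 0 0"
  "skew_unit 1 8 = skew_mk 0 0 0 0 0 0 1 0 0 0 0 0 0 0 0 0 0 0 0 0 0 0 0 0 0 0 0 0"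
  "skew_unit 2 3 = skew_mk 0 0 0 0 0 0 0 1 0 0 0 0 0 0 0 0 0 0 0 0 0 0 0 0 0 0 0 0"
  "skew_unit 2 4 = skew_mk 0 0 0 0 0 0 0 0 1 0 0 0 0 0 0 0 0 0 0 0 0 0 0 0 0 0 0 0"
  "skew_unit 2 5 = skew_mk 0 0 0 0 0 0 0 0 0 1 0 0 0 0 0 0 0 0 0 0 0 0 0 0 0 0 0 0"
  "skew_unit 2 6 = skew_mk 0 0 0 0 0 0 0 0 0 0 1 0 0 0 0 0 0 0 0 0 0 0 0 0 0 0 0 0"
  "skew_unit 2 7 = skew_mk 0 0 0 0 0 0 0 0 0 0 0 1 0 0 0 0 0 0 0 0 0 0 0 0 0 0 0 0"
  "skew_unit 2 8 = skew_mk 0 0 0 0 0 0 0 0 0 0 0 0 1 0 0 0 0 0 0 0 0 0 0 0 0 0 0 0"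
  "skew_unit 3 4 = skew_mk 0 0 0 0 0 0 0 0 0 0 0 0 0 1 0 0 0 0 0 0 0 0 0 0 0 0 0 0"
  "skew_unit 3 5 = skew_mk 0 0 0 0 0 0 0 0 0 0 0 0 0 0 1 0 0 0 0 0 0 0 0 0 0 0 0 0"
  "skew_unit 3 6 = skew_mk 0 0 0 0 0 0 0 0 0 0 0 0 0 0 0 1 0 0 0 0 0 0 0 0 0 0 0 0"
  "skew_unit 3 7 = skew_mk 0 0 0 0 0 0 0 0 0 0 0 0 0 0 0 0 1 0 0 0 0 0 0 0 0 0 0 0"
  "skew_unit 3 8 = skew_mk 0 0 0 0 0 0 0 0 0 0 0 0 0 0 0 0 0 1 0 0 0 0 0 0 0 0 0 0"
  "skew_unit 4 5 = skew_mk 0 0 0 0 0 0 0 0 0 0 0 0 0 0 0 0 0 0 1 0 0 0 0 0 0 0 0 0"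
  "skew_unit 4 6 = skew_mk 0 0 0 0 0 0 0 0 0 0 0 0 0 0 0 0 0 0 0 1 0 0 0 0 0 0 0 0"
  "skew_unit 4 7 = skew_mk 0 0 0 0 0 0 0 0 0 0 0 0 0 0 0 0 0 0 0 0 1 0 0 0 0 0 0 0"
  "skew_unit 4 8 = skew_mk 0 0 0 0 0 0 0 0 0 0 0 0 0 0 0 0 0 0 0 0 0 1 0 0 0 0 0 0"
  "skew_unit 5 6 = skew_mk 0 0 0 0 0 0 0 0 0 0 0 0 0 0 0 0 0 0 0 0 0 0 1 0 0 0 0 0"
  "skew_unit 5 7 = skew_mk 0 0 0 0 0 0 0 0 0 0 0 0 0 0 0 0 0 0 0 0 0 0 0 1 0 0 0 0"
  "skew_unit 5 8 = skew_mk 0 0 0 0 0 0 0 0 0 0 0 0 0 0 0 0 0 0 0 0 0 0 0 0 1 0 0 0"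
  "skew_unit 6 7 = skew_mk 0 0 0 0 0 0 0 0 0 0 0 0 0 0 0 0 0 0 0 0 0 0 0 0 0 1 0 0"
  "skew_unit 6 8 = skew_mk 0 0 0 0 0 0 0 0 0 0 0 0 0 0 0 0 0 0 0 0 0 0 0 0 0 0 1 0"
  "skew_unit 7 8 = skew_mk 0 0 0 0 0 0 0 0 0 0 0 0 0 0 0 0 0 0 0 0 0 0 0 0 0 0 0 1"
  unfolding vec_eq_iff forall_8 skew_mk_nth by (simp_all add: skew_unit_def matrix_unit_def)

lemma pfadj_nth:
  fixes x :: "complex^8^8"
  shows "pfadj x $ 1 $ 2 = pf6 x 3 4 5 6 7 8"
    "pfadj x $ 1 $ 3 = - pf6 x 2 4 5 6 7 8"
    "pfadj x $ 1 $ 4 = pf6 x 2 3 5 6 7 8"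
    "pfadj x $ 1 $ 5 = - pf6 x 2 3 4 6 7 8"
    "pfadj x $ 1 $ 6 = pf6 x 2 3 4 5 7 8"
    "pfadj x $ 1 $ 7 = - pf6 x 2 3 4 5 6 8"
    "pfadj x $ 1 $ 8 = pf6 x 2 3 4 5 6 7"
    "pfadj x $ 2 $ 3 = pf6 x 1 4 5 6 7 8"
    "pfadj x $ 2 $ 4 = - pf6 x 1 3 5 6 7 8"
    "pfadj x $ 2 $ 5 = pf6 x 1 3 4 6 7 8"
    "pfadj x $ 2 $ 6 = - pf6 x 1 3 4 5 7 8"
    "pfadj x $ 2 $ 7 = pf6 x 1 3 4 5 6 8"
    "pfadj x $ 2 $ 8 = - pf6 x 1 3 4 5 6 7"
    "pfadj x $ 3 $ 4 = pf6 x 1 2 5 6 7 8"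
    "pfadj x $ 3 $ 5 = - pf6 x 1 2 4 6 7 8"
    "pfadj x $ 3 $ 6 = pf6 x 1 2 4 5 7 8"
    "pfadj x $ 3 $ 7 = - pf6 x 1 2 4 5 6 8"
    "pfadj x $ 3 $ 8 = pf6 x 1 2 4 5 6 7"
    "pfadj x $ 4 $ 5 = pf6 x 1 2 3 6 7 8"
    "pfadj x $ 4 $ 6 = - pf6 x 1 2 3 5 7 8"
    "pfadj x $ 4 $ 7 = pf6 x 1 2 3 5 6 8"
    "pfadj x $ 4 $ 8 = - pf6 x 1 2 3 5 6 7"
    "pfadj x $ 5 $ 6 = pf6 x 1 2 3 4 7 8"
    "pfadj x $ 5 $ 7 = - pf6 x 1 2 3 4 6 8"
    "pfadj x $ 5 $ 8 = pf6 x 1 2 3 4 6 7"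
    "pfadj x $ 6 $ 7 = pf6 x 1 2 3 4 5 8"
    "pfadj x $ 6 $ 8 = - pf6 x 1 2 3 4 5 7"
    "pfadj x $ 7 $ 8 = pf6 x 1 2 3 4 5 6"
  unfolding pfadj_def vec_lambda_beta skew_unit_skew_mk dpf_def dpf6_def dpf4_def pf6_def pf4_def
      skew_mk_nth
  by (simp_all only: mult_zero_left mult_zero_right add_0_left add_0_right diff_0 diff_0_right
      minus_zero mult_1_left)
    (simp_all add: algebra_simps)?

definition cubic :: "freudC \<Rightarrow> freudC" where
  "cubic P = (case P of (X, Y, \<xi>, \<eta>) \<Rightarrow>
    (jcross Y (jcross X X) - jscale (1/4 * (jform X Y - \<xi> * \<eta>)) X - jscale (\<eta> / 2) (jcross Y Y),
     jscale (1/4 * (jform X Y - \<xi> * \<eta>)) Y + jscale (\<xi> / 2) (jcross X X) - jcross X (jcross Y Y),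
     1/4 * \<xi> * (jform X Y - \<xi> * \<eta>) - 1/6 * jform (jcross Y Y) Y,
     1/6 * jform (jcross X X) X - 1/4 * \<eta> * (jform X Y - \<xi> * \<eta>)))"

definition cubicM :: "complex^8^8 \<Rightarrow> complex^8^8 \<Rightarrow> complex^8^8" where
  "cubicM x y = (\<chi> i j. (pfadj y $ i $ j - (x ** y ** x) $ i $ j) / 2 + trace (x ** y) * x$i$j / 8)"

lemma trace_skew_mk: "trace (skew_mk a12 a13 a14 a15 a16 a17 a18 a23 a24 a25 a26 a27 a28 a34 a35 a36
    a37 a38 a45 a46 a47 a48 a56 a57 a58 a67 a68 a78 ** skew_mk b12 b13 b14 b15 b16 b17 b18 b23 b24
    b25 b26 b27 b28 b34 b35 b36 b37 b38 b45 b46 b47 b48 b56 b57 b58 b67 b68 b78) = - 2 * (a12 * b12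
    + a13 * b13 + a14 * b14 + a15 * b15 + a16 * b16 + a17 * b17 + a18 * b18 + a23 * b23 + a24 * b24
    + a25 * b25 + a26 * b26 + a27 * b27 + a28 * b28 + a34 * b34 + a35 * b35 + a36 * b36 + a37 * b37
    + a38 * b38 + a45 * b45 + a46 * b46 + a47 * b47 + a48 * b48 + a56 * b56 + a57 * b57 + a58 * b58
    + a67 * b67 + a68 * b68 + a78 * b78)"
  unfolding trace_def matrix_matrix_mult_def vec_lambda_beta sum_8 skew_mk_nth
  by (simp add: algebra_simps)

lemma cubicM_nth: "cubicM x y $ i $ j = (pfadj y $ i $ j - (\<Sum>k\<in>UNIV. (\<Sum>l\<in>UNIV. x$i$l * y$l$k) *
    x$k$j)) / 2
    + trace (x ** y) * x$i$j / 8"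
  by (simp add: cubicM_def matrix_matrix_mult_def)

lemma cubic_skew_freud_skew_mk: "cubic (skew_freud (skew_mk a12 a13 a14 a15 a16 a17 a18 a23 a24 a25
    a26 a27 a28 a34 a35 a36 a37 a38 a45 a46 a47 a48 a56 a57 a58 a67 a68 a78) (skew_mk b12 b13 b14
    b15 b16 b17 b18 b23 b24 b25 b26 b27 b28 b34 b35 b36 b37 b38 b45 b46 b47 b48 b56 b57 b58 b67 b68
    b78)) =
    skew_freud (cubicM (skew_mk a12 a13 a14 a15 a16 a17 a18 a23 a24 a25 a26 a27 a28 a34 a35 a36 a37
        a38 a45 a46 a47 a48 a56 a57 a58 a67 a68 a78) (skew_mk b12 b13 b14 b15 b16 b17 b18 b23 b24
        b25 b26 b27 b28 b34 b35 b36 b37 b38 b45 b46 b47 b48 b56 b57 b58 b67 b68 b78)) (- cubicM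
        (skew_mk b12 b13 b14 b15 b16 b17 b18 b23 b24 b25 b26 b27 b28 b34 b35 b36 b37 b38 b45 b46 b47
        b48 b56 b57 b58 b67 b68 b78) (skew_mk a12 a13 a14 a15 a16 a17 a18 a23 a24 a25 a26 a27 a28
        a34 a35 a36 a37 a38 a45 a46 a47 a48 a56 a57 a58 a67 a68 a78))"
  apply (simp only: skew_freud_def cubic_def prod.case skew_mk_nth)
  apply (simp only: jcross_herm_mk jform_herm_mk jscale_herm_mk herm_mk_add herm_mk_diff)
  apply (simp only: null_cayley_simps)
  apply (simp only: herm_mk_inject null_cayley_inject prod.inject vector_uminus_component cubicM_nth
      sum_8 skew_mk_nth trace_skew_mk pfadj_nth pf6_def pf4_def)
  apply (intro conjI)
  apply (simp_all add: algebra_simps add_divide_distrib diff_divide_distrib)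
  done

lemma cubic_skew_freud:
  assumes "skew x" "skew y"
  shows "cubic (skew_freud x y) = skew_freud (cubicM x y) (- cubicM y x)"
  by (subst (1 2 3) skew_eq_skew_mk[OF assms(1)], subst (1 2 3) skew_eq_skew_mk[OF assms(2)]) (rule
      cubic_skew_freud_skew_mk)

lemma jscale_jscale: "jscale c (jscale d X) = jscale (c * d) X"
proof -
  interpret vector_space pscale by (rule vector_space_pscale)
  show ?thesis using scale_scale[of c d "(X, 0, 0, 0)"] by simp
qed

lemma cinner_add: "cinner (x + x') y = cinner x y + cinner x' y" "cinner x (y + y') = cinner x y +
    cinner x y'"
  and cinner_scale: "cinner (cayley_map ((*) c) x) y = c * cinner x y" "cinner x (cayley_map ((*) c)
      y) = c * cinner x y"
  and cinner_uminus: "cinner (- x) y = - cinner x y" "cinner x (- y) = - cinner x y"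
  and cinner_diff: "cinner (x - x') y = cinner x y - cinner x' y" "cinner x (y - y') = cinner x y -
      cinner x y'"
  by (cases x rule: cayley_exhaust; cases x' rule: cayley_exhaust; cases y rule: cayley_exhaust;
      cases y' rule: cayley_exhaust; simp add: algebra_simps)+

lemma cinner_commute: "cinner x y = cinner y x"
  by (cases x rule: cayley_exhaust; cases y rule: cayley_exhaust; simp add: algebra_simps)

lemma cinner_cconj_cmult: "cinner (cconj (cmult x y)) z = cinner (cconj (cmult y z)) x"
  by (cases x rule: cayley_exhaust; cases y rule: cayley_exhaust; cases z rule: cayley_exhaust)
    (simp, simp add: algebra_simps)

lemma jform_commute: "jform X Y = jform Y X"
  by (cases X rule: herm_mk_cases; cases Y rule: herm_mk_cases) (simp add: jform_herm_mk cinner_commute)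

lemma jform_add_left: "jform (X + X') Y = jform X Y + jform X' Y"
  by (cases X rule: herm_mk_cases; cases X' rule: herm_mk_cases; cases Y rule: herm_mk_cases)
    (simp add: jform_herm_mk herm_mk_add cinner_add algebra_simps)

lemma jform_scale_left: "jform (jscale c X) Y = c * jform X Y"
  by (cases X rule: herm_mk_cases; cases Y rule: herm_mk_cases)
    (simp add: jform_herm_mk jscale_herm_mk cinner_scale algebra_simps)

lemma jform_uminus_left: "jform (- X) Y = - jform X Y"
  by (cases X rule: herm_mk_cases; cases Y rule: herm_mk_cases)
    (simp add: jform_herm_mk herm_mk_uminus cinner_uminus algebra_simps)

lemma jform_diff_left: "jform (X - X') Y = jform X Y - jform X' Y"
  using jform_add_left[of "X - X'" X' Y] by simp

lemma jform_right: "jform X (Y + Y') = jform X Y + jform X Y'" "jform X (jscale c Y) = c * jform X Y"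
  "jform X (- Y) = - jform X Y" "jform X (Y - Y') = jform X Y - jform X Y'"
  by (simp_all add: jform_commute[of X] jform_add_left jform_scale_left jform_uminus_left jform_diff_left)

lemma jform_zero: "jform 0 X = 0" "jform X 0 = 0"
  using jform_diff_left[of X X X] jform_right(4)[of X X X] by simp_all

lemmas jform_simps = jform_zero jform_add_left jform_scale_left jform_uminus_left jform_diff_left
    jform_right

lemma jform_nondegenerate:
  assumes "\<And>Z. jform X Z = jform Y Z"
  shows "X = Y"
proof -
  have c: "x = 0" if "\<And>z. cinner x z = 0" for x :: "complex cayley"
    using that[of "((1,0,0,0),0)"] that[of "((0,1,0,0),0)"] that[of "((0,0,1,0),0)"] that[of
        "((0,0,0,1),0)"]
      that[of "(0,(1,0,0,0))"] that[of "(0,(0,1,0,0))"] that[of "(0,(0,0,1,0))"] that[of "(0,(0,0,0,1))"]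
    by (cases x rule: cayley_exhaust) (simp add: zero_prod_def)
  have c0: "cinner x 0 = 0" for x :: "complex cayley"
    by (cases x rule: cayley_exhaust) (simp add: zero_prod_def)
  obtain a b d x y z where XY: "X - Y = herm_mk a b d x y z" by (rule herm_mk_cases)
  have 0: "jform (herm_mk a b d x y z) Z = 0" for Z
    using assms[of Z] by (simp add: XY[symmetric] jform_simps)
  have "a = 0" "b = 0" "d = 0" "cinner x t = 0" "cinner y t = 0" "cinner z t = 0" for t
    using 0[of "herm_mk 1 0 0 0 0 0"] 0[of "herm_mk 0 1 0 0 0 0"] 0[of "herm_mk 0 0 1 0 0 0"]
      0[of "herm_mk 0 0 0 t 0 0"] 0[of "herm_mk 0 0 0 0 t 0"] 0[of "herm_mk 0 0 0 0 0 t"]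
    by (simp_all add: jform_herm_mk c0)
  moreover from this(4-6) have "x = 0" "y = 0" "z = 0" by (blast intro: c)+
  ultimately have "X - Y = 0" unfolding XY herm_mk_zero by simp
  then show ?thesis by simp
qed

lemma jform_jcross: "jform (jcross X Y) Z = jform X (jcross Y Z)"
proof -
  obtain a b c x y z where X: "X = herm_mk a b c x y z" by (rule herm_mk_cases)
  obtain a' b' c' x' y' z' where Y: "Y = herm_mk a' b' c' x' y' z'" by (rule herm_mk_cases)
  obtain a'' b'' c'' x'' y'' z'' where Z: "Z = herm_mk a'' b'' c'' x'' y'' z''" by (rule herm_mk_cases)
  have 1: "cinner x (cconj (cmult y' z'')) = cinner (cconj (cmult z'' x)) y'"
    "cinner x (cconj (cmult y'' z')) = cinner (cconj (cmult x y'')) z'"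
    "cinner y (cconj (cmult z' x'')) = cinner (cconj (cmult x'' y)) z'"
    "cinner y (cconj (cmult z'' x')) = cinner (cconj (cmult y z'')) x'"
    "cinner z (cconj (cmult x' y'')) = cinner (cconj (cmult y'' z)) x'"
    "cinner z (cconj (cmult x'' y')) = cinner (cconj (cmult z x'')) y'"
    by (metis cinner_commute cinner_cconj_cmult)+
  have 2: "cinner (cconj (cmult y z')) x'' = cinner (cconj (cmult x'' y)) z'"
    "cinner (cconj (cmult y' z)) x'' = cinner (cconj (cmult z x'')) y'"
    "cinner (cconj (cmult z x')) y'' = cinner (cconj (cmult y'' z)) x'"
    "cinner (cconj (cmult z' x)) y'' = cinner (cconj (cmult x y'')) z'"
    "cinner (cconj (cmult x y')) z'' = cinner (cconj (cmult z'' x)) y'"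
    "cinner (cconj (cmult x' y)) z'' = cinner (cconj (cmult y z'')) x'"
    by (metis cinner_cconj_cmult)+
  show ?thesis
    unfolding X Y Z jcross_herm_mk jform_herm_mk cinner_scale cinner_add cinner_diff 1 2
    using cinner_commute[of x x'] by (simp add: field_simps)
qed

lemma jcross_commute: "jcross X Y = jcross Y X"
  by (cases X rule: herm_mk_cases; cases Y rule: herm_mk_cases)
    (simp add: jcross_herm_mk cinner_commute mult.commute add.commute diff_diff_eq)

lemma jcross_left: "jcross (X + X') Y = jcross X Y + jcross X' Y" "jcross (jscale c X) Y = jscale c
    (jcross X Y)"
  "jcross (- X) Y = - jcross X Y" "jcross (X - X') Y = jcross X Y - jcross X' Y"
  by (rule jform_nondegenerate; simp add: jform_jcross jform_simps)+

lemma jcross_right: "jcross Y (X + X') = jcross Y X + jcross Y X'" "jcross Y (jscale c X) = jscale c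
    (jcross Y X)"
  "jcross Y (- X) = - jcross Y X" "jcross Y (X - X') = jcross Y X - jcross Y X'"
  by (simp_all add: jcross_commute[of Y] jcross_left)

lemma jtranspose_eqI:
  assumes "\<And>X Y. jform (\<phi> X) Y = jform X (\<psi> Y)"
  shows "jtranspose \<phi> = \<psi>"
  unfolding jtranspose_def
proof (rule the_equality)
  fix \<psi>' assume *: "\<forall>X Y. jform (\<phi> X) Y = jform X (\<psi>' Y)"
  show "\<psi>' = \<psi>"
  proof
    fix Y show "\<psi>' Y = \<psi> Y"
      by (rule jform_nondegenerate) (metis * assms jform_commute)
  qed
qed (use assms in blast)

lemma jform_jvee: "jform (jvee X W U) V = jform U (jvee W X V)"
proof -
  have "jform (jcross W (jcross X U)) V = jform U (jcross X (jcross W V))"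
    by (metis jform_jcross jform_commute jcross_commute)
  then show ?thesis
    by (simp add: jvee_def jform_simps jform_commute[of X W] jform_commute[of U W])
qed

definition psymp :: "freudC \<Rightarrow> freudC \<Rightarrow> complex" where
  "psymp P Q = (case P of (X, Y, \<xi>, \<eta>) \<Rightarrow> case Q of (Z, W, \<zeta>, \<omega>) \<Rightarrow>
    jform X W - jform Y Z + \<xi> * \<omega> - \<eta> * \<zeta>)"

lemma pcross_apply:
  "pcross (X, Y, \<xi>, \<eta>) (Z, W, \<zeta>, \<omega>) (U, V, \<mu>, \<kappa>) =
    (jscale (- 1 / 2) (jvee X W U + jvee Z Y U)
       - jscale (1 / 24 * (jform X W + jform Z Y - 3 * (\<xi> * \<omega> + \<zeta> * \<eta>))) U
       + jscale (1 / 2) (jcross (jscale 2 (jcross X Z) - jscale \<eta> W - jscale \<omega> Y) V)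
       - jscale (\<kappa> / 4) (jscale 2 (jcross Y W) - jscale \<xi> Z - jscale \<zeta> X),
     jscale (- 1 / 2) (jcross (jscale 2 (jcross Y W) - jscale \<xi> Z - jscale \<zeta> X) U)
       + jscale (1 / 2) (jvee W X V + jvee Y Z V)
       + jscale (1 / 24 * (jform X W + jform Z Y - 3 * (\<xi> * \<omega> + \<zeta> * \<eta>))) V
       + jscale (\<mu> / 4) (jscale 2 (jcross X Z) - jscale \<eta> W - jscale \<omega> Y),
     - 1 / 4 * jform (jscale 2 (jcross Y W) - jscale \<xi> Z - jscale \<zeta> X) V
       + 1 / 8 * (jform X W + jform Z Y - 3 * (\<xi> * \<omega> + \<zeta> * \<eta>)) * \<mu>,
     1 / 4 * jform (jscale 2 (jcross X Z) - jscale \<eta> W - jscale \<omega> Y) U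
       - 1 / 8 * (jform X W + jform Z Y - 3 * (\<xi> * \<omega> + \<zeta> * \<eta>)) * \<kappa>)"
proof -
  have "jtranspose (\<lambda>U. jscale (- 1 / 2) (jvee X W U + jvee Z Y U))
      = (\<lambda>U. jscale (- 1 / 2) (jvee W X U + jvee Y Z U))"
    by (rule jtranspose_eqI) (simp add: jform_simps jform_jvee)
  then show ?thesis
    by (auto intro!: jform_nondegenerate simp: jcross_left jform_simps jscale_jscale field_simps)
qed

lemmas jordanC_simps = jvee_def jform_simps jcross_left jcross_right

lemma jform_jcross_rotate: "jform (jcross X Y) Z = jform (jcross Z Y) X"
  by (metis jform_jcross jform_commute jcross_commute)

lemma pcross_commute: "pcross P Q = pcross Q P"
proof
  fix R :: freudC
  obtain X Y \<xi> \<eta> where P: "P = (X, Y, \<xi>, \<eta>)" by (cases P)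
  obtain Z W \<zeta> \<omega> where Q: "Q = (Z, W, \<zeta>, \<omega>)" by (cases Q)
  obtain U V \<mu> \<kappa> where R: "R = (U, V, \<mu>, \<kappa>)" by (cases R)
  show "pcross P Q R = pcross Q P R"
    unfolding P Q R pcross_apply prod.inject
    by (intro conjI jform_nondegenerate) (simp_all add: jordanC_simps jcross_commute[of X Z]
        jcross_commute[of Y W] algebra_simps add_divide_distrib diff_divide_distrib)
qed

lemma pcross_add:
  "pcross P Q (R + S) = pcross P Q R + pcross P Q S"
  "pcross (P + S) Q R = pcross P Q R + pcross S Q R"
proof -
  obtain X Y \<xi> \<eta> where P: "P = (X, Y, \<xi>, \<eta>)" by (cases P)
  obtain Z W \<zeta> \<omega> where Q: "Q = (Z, W, \<zeta>, \<omega>)" by (cases Q)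
  obtain U V \<mu> \<kappa> where R: "R = (U, V, \<mu>, \<kappa>)" by (cases R)
  obtain U' V' \<mu>' \<kappa>' where S: "S = (U', V', \<mu>', \<kappa>')" by (cases S)
  show "pcross P Q (R + S) = pcross P Q R + pcross P Q S"
    unfolding P Q R S pcross_apply prod.inject add_Pair
    by (intro conjI jform_nondegenerate) (simp_all add: jordanC_simps algebra_simps
        add_divide_distrib diff_divide_distrib)
  show "pcross (P + S) Q R = pcross P Q R + pcross S Q R"
    unfolding P Q R S pcross_apply prod.inject add_Pair
    by (intro conjI jform_nondegenerate) (simp_all add: jordanC_simps algebra_simps
        add_divide_distrib diff_divide_distrib)
qed

lemma pcross_swap:
  "pcross P Q R - pcross R Q P =
    pscale (psymp Q R / 8) P + pscale (psymp P Q / 8) R + pscale (psymp P R / 4) Q"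
proof -
  obtain X Y \<xi> \<eta> where P: "P = (X, Y, \<xi>, \<eta>)" by (cases P)
  obtain Z W \<zeta> \<omega> where Q: "Q = (Z, W, \<zeta>, \<omega>)" by (cases Q)
  obtain U V \<mu> \<kappa> where R: "R = (U, V, \<mu>, \<kappa>)" by (cases R)
  have 1: "jcross U X = jcross X U" "jcross V Y = jcross Y V" "jcross Z U = jcross U Z" "jcross W V
      = jcross V W"
      "jcross Z X = jcross X Z" "jcross W Y = jcross Y W" "jcross V (jcross X Z) = jcross (jcross X Z) V"
      "jcross Y (jcross U Z) = jcross (jcross U Z) Y" "jcross (jcross V W) X = jcross X (jcross V W)"
      "jcross U (jcross Y W) = jcross (jcross Y W) U"
    by (simp_all only: jcross_commute)
  have 2: "jform (jcross V W) Y = jform (jcross Y W) V" "jform (jcross U Z) X = jform (jcross X Z) U"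
    by (rule jform_jcross_rotate)+
  have 3: "jform U Y = jform Y U" "jform V X = jform X V" "jform W U = jform U W" "jform W X = jform X W"
    "jform Z V = jform V Z" "jform Z Y = jform Y Z"
    by (simp_all only: jform_commute)
  show ?thesis
    unfolding P Q R pcross_apply prod.inject add_Pair diff_Pair psymp_def prod.case pscale.simps
    by (intro conjI jform_nondegenerate)
      (simp_all add: jordanC_simps 1 2 3 algebra_simps add_divide_distrib diff_divide_distrib)
qed

lemma pcross_cubic: "pcross P P P = pscale 3 (cubic P)"
proof -
  obtain X Y \<xi> \<eta> where P: "P = (X, Y, \<xi>, \<eta>)" by (cases P)
  show ?thesis
    unfolding P pcross_apply cubic_def prod.case pscale.simps prod.inject
    by (intro conjI jform_nondegenerate)
      (simp_all add: jordanC_simps jform_commute[of Y X] jcross_commute[of "jcross X X" Y]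
        jcross_commute[of "jcross Y Y" X] algebra_simps add_divide_distrib diff_divide_distrib)
qed

declare null_cayley.simps [simp del]

definition mscale :: "'a::comm_ring_1 \<Rightarrow> 'a^'n^'n \<Rightarrow> 'a^'n^'n" where
  "mscale c x = (\<chi> i j. c * x$i$j)"

abbreviation cnjm :: "complex^8^8 \<Rightarrow> complex^8^8" where
  "cnjm \<equiv> map_matrix cnj"

lemma mscale_nth: "mscale c x $ i $ j = c * x$i$j"
  by (simp add: mscale_def)

lemma skew_ops:
  assumes "skew x"
  shows "skew (mscale c x)" "skew (- x)" "skew (map_matrix cnj x)"
proof (rule_tac [!] skewI)
  fix i j
  note * = skew_nth[OF assms, of i j]
  show "mscale c x $ j $ i = - mscale c x $ i $ j" by (simp add: mscale_nth *)
  show "(- x) $ j $ i = - (- x) $ i $ j" by (simp add: *)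
  show "map_matrix cnj x $ j $ i = - map_matrix cnj x $ i $ j" by (simp add: *)
qed

lemma skew_plus: "skew x \<Longrightarrow> skew y \<Longrightarrow> skew (x + y)"
  by (simp add: skew_def transpose_add)

lemma skew_zero: "skew 0"
  by (simp add: skew_def transpose_def vec_eq_iff)

lemma skew_freud_add: "skew_freud (x + x') (y + y') = skew_freud x y + skew_freud x' y'"
  by (simp add: skew_freud_def herm_mk_add null_cayley_add)

lemma skew_freud_mscale: "skew_freud (mscale c x) (mscale c y) = pscale c (skew_freud x y)"
  by (simp add: skew_freud_def jscale_herm_mk null_cayley_scale mscale_nth)

lemma skew_freud_uminus: "skew_freud (- x) (- y) = - skew_freud x y"
  by (simp add: skew_freud_def herm_mk_uminus null_cayley_uminus)

lemma skew_freud_inject: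
  assumes "skew x" "skew y" "skew x'" "skew y'" "skew_freud x y = skew_freud x' y'"
  shows "x = x' \<and> y = y'"
proof -
  note eqs = assms(5)[unfolded skew_freud_def prod.inject herm_mk_inject null_cayley_inject
      neg_equal_iff_equal]
  have "skew_mk (x$1$2) (x$1$3) (x$1$4) (x$1$5) (x$1$6) (x$1$7) (x$1$8) (x$2$3) (x$2$4) (x$2$5)
      (x$2$6) (x$2$7) (x$2$8) (x$3$4) (x$3$5) (x$3$6) (x$3$7) (x$3$8) (x$4$5) (x$4$6) (x$4$7)
      (x$4$8) (x$5$6) (x$5$7) (x$5$8) (x$6$7) (x$6$8) (x$7$8) = skew_mk (x'$1$2) (x'$1$3) (x'$1$4)
      (x'$1$5) (x'$1$6) (x'$1$7) (x'$1$8) (x'$2$3) (x'$2$4) (x'$2$5) (x'$2$6) (x'$2$7) (x'$2$8)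
      (x'$3$4) (x'$3$5) (x'$3$6) (x'$3$7) (x'$3$8) (x'$4$5) (x'$4$6) (x'$4$7) (x'$4$8) (x'$5$6)
      (x'$5$7) (x'$5$8) (x'$6$7) (x'$6$8) (x'$7$8)" by (simp only: eqs)
  moreover have "skew_mk (y$1$2) (y$1$3) (y$1$4) (y$1$5) (y$1$6) (y$1$7) (y$1$8) (y$2$3) (y$2$4)
      (y$2$5) (y$2$6) (y$2$7) (y$2$8) (y$3$4) (y$3$5) (y$3$6) (y$3$7) (y$3$8) (y$4$5) (y$4$6)
      (y$4$7) (y$4$8) (y$5$6) (y$5$7) (y$5$8) (y$6$7) (y$6$8) (y$7$8) = skew_mk (y'$1$2) (y'$1$3)
      (y'$1$4) (y'$1$5) (y'$1$6) (y'$1$7) (y'$1$8) (y'$2$3) (y'$2$4) (y'$2$5) (y'$2$6) (y'$2$7)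
      (y'$2$8) (y'$3$4) (y'$3$5) (y'$3$6) (y'$3$7) (y'$3$8) (y'$4$5) (y'$4$6) (y'$4$7) (y'$4$8)
      (y'$5$6) (y'$5$7) (y'$5$8) (y'$6$7) (y'$6$8) (y'$7$8)" by (simp only: eqs)
  ultimately show ?thesis
    using assms(1-4) skew_eq_skew_mk by metis
qed

lemma skew_freud_surj: obtains x y where "skew x" "skew y" "P = skew_freud x y"
proof -
  obtain X Y xi eta where P: "P = (X, Y, xi, eta)" by (cases P)
  obtain d0 d1 d2 u0 u1 u2 where X0: "X = herm_mk d0 d1 d2 u0 u1 u2" by (rule herm_mk_cases)
  obtain p00 p01 p02 p03 q00 q01 q02 q03 where X1: "u0 = null_cayley (p00, p01, p02, p03) (q00, q01,
      q02, q03)" by (rule null_cayley_cases)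
  obtain p10 p11 p12 p13 q10 q11 q12 q13 where X2: "u1 = null_cayley (p10, p11, p12, p13) (q10, q11,
      q12, q13)" by (rule null_cayley_cases)
  obtain p20 p21 p22 p23 q20 q21 q22 q23 where X3: "u2 = null_cayley (p20, p21, p22, p23) (q20, q21,
      q22, q23)" by (rule null_cayley_cases)
  obtain e0 e1 e2 v0 v1 v2 where Y0: "Y = herm_mk e0 e1 e2 v0 v1 v2" by (rule herm_mk_cases)
  obtain r00 r01 r02 r03 s00 s01 s02 s03 where Y1: "v0 = null_cayley (r00, r01, r02, r03) (s00, s01,
      s02, s03)" by (rule null_cayley_cases)
  obtain r10 r11 r12 r13 s10 s11 s12 s13 where Y2: "v1 = null_cayley (r10, r11, r12, r13) (s10, s11,
      s12, s13)" by (rule null_cayley_cases)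
  obtain r20 r21 r22 r23 s20 s21 s22 s23 where Y3: "v2 = null_cayley (r20, r21, r22, r23) (s20, s21,
      s22, s23)" by (rule null_cayley_cases)
  have "P = skew_freud (skew_mk (e0) (s22) (r20) (- s12) (s10) (p01) (p03) (- s20) (r22) (- r10) (-
      r12) (q03) (- q01) (e1) (s02) (r00) (p11) (p13) (- s00) (r02) (q13) (- q11) (e2) (p21) (p23)
      (q23) (- q21) (eta))
      (skew_mk (d0) (p22) (q20) (- p12) (p10) (- s01) (- s03) (- p20) (q22) (- q10) (- q12) (- r03)
          (r01) (d1) (p02) (q00) (- s11) (- s13) (- p00) (q02) (- r13) (r11) (d2) (- s21) (- s23) (-
          r23) (r21) (xi))"
    unfolding P X0 X1 X2 X3 Y0 Y1 Y2 Y3 skew_freud_def skew_mk_nth minus_minus ..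
  then show thesis by (rule that[OF skew_skew_mk skew_skew_mk])
qed

lemma lambda_gamma_skew_freud: "(lambda7 \<circ> gamma7) (skew_freud x y) = skew_freud (- y) x"
  by (simp add: skew_freud_def jgamma_herm_mk null_cayley_cgamma herm_mk_uminus null_cayley_uminus)

lemma iota_gammaC_skew_freud: "(iota7 \<circ> gammaC7) (skew_freud x y) = skew_freud (mscale \<i> x) (mscale
    (- \<i>) y)"
  by (simp add: skew_freud_def jgammaC_herm_mk null_cayley_cgammaC jscale_herm_mk null_cayley_scale
      mscale_nth)

definition pstar :: "freudC \<Rightarrow> freudC" where
  "pstar P = (case P of (X, Y, \<xi>, \<eta>) \<Rightarrow> (- jtau Y, jtau X, - cnj \<eta>, cnj \<xi>))"

lemma pstar_skew_freud: "pstar (skew_freud x y) = skew_freud (cnjm y) (- cnjm x)"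
  by (simp add: pstar_def skew_freud_def jtau_herm_mk null_cayley_cnj herm_mk_uminus null_cayley_uminus)

lemma jtau_jtau: "jtau (jtau X) = X"
proof -
  have "cayley_map cnj (cayley_map cnj x) = x" for x
    by (cases x rule: cayley_exhaust) simp
  then show ?thesis by (cases X rule: herm_mk_cases) (simp add: jtau_herm_mk)
qed

lemma jtau_uminus: "jtau (- X) = - jtau X"
proof -
  have "cayley_map cnj (- x) = - cayley_map cnj x" for x
    by (cases x rule: cayley_exhaust) simp
  then show ?thesis by (cases X rule: herm_mk_cases) (simp add: jtau_herm_mk herm_mk_uminus)
qed

lemma psymp_pherm: "psymp P Q = pherm (pstar P) Q"
  by (cases P; cases Q) (simp add: psymp_def pstar_def jherm_def jtau_jtau jtau_uminus jform_simps)

lemma pherm_skew_freud_skew_mk: "pherm (skew_freud (skew_mk a12 a13 a14 a15 a16 a17 a18 a23 a24 a25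
    a26 a27 a28 a34 a35 a36 a37 a38 a45 a46 a47 a48 a56 a57 a58 a67 a68 a78) (skew_mk b12 b13 b14
    b15 b16 b17 b18 b23 b24 b25 b26 b27 b28 b34 b35 b36 b37 b38 b45 b46 b47 b48 b56 b57 b58 b67 b68
    b78)) (skew_freud (skew_mk c12 c13 c14 c15 c16 c17 c18 c23 c24 c25 c26 c27 c28 c34 c35 c36 c37
    c38 c45 c46 c47 c48 c56 c57 c58 c67 c68 c78) (skew_mk d12 d13 d14 d15 d16 d17 d18 d23 d24 d25
    d26 d27 d28 d34 d35 d36 d37 d38 d45 d46 d47 d48 d56 d57 d58 d67 d68 d78)) = (cnj a12 * c12 + cnj
    a13 * c13 + cnj a14 * c14 + cnj a15 * c15 + cnj a16 * c16 + cnj a17 * c17 + cnj a18 * c18 + cnj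
    a23 * c23 + cnj a24 * c24 + cnj a25 * c25 + cnj a26 * c26 + cnj a27 * c27 + cnj a28 * c28 + cnj
    a34 * c34 + cnj a35 * c35 + cnj a36 * c36 + cnj a37 * c37 + cnj a38 * c38 + cnj a45 * c45 + cnj
    a46 * c46 + cnj a47 * c47 + cnj a48 * c48 + cnj a56 * c56 + cnj a57 * c57 + cnj a58 * c58 + cnj
    a67 * c67 + cnj a68 * c68 + cnj a78 * c78)
    + (cnj b12 * d12 + cnj b13 * d13 + cnj b14 * d14 + cnj b15 * d15 + cnj b16 * d16 + cnj b17 * d17
        + cnj b18 * d18 + cnj b23 * d23 + cnj b24 * d24 + cnj b25 * d25 + cnj b26 * d26 + cnj b27 *
        d27 + cnj b28 * d28 + cnj b34 * d34 + cnj b35 * d35 + cnj b36 * d36 + cnj b37 * d37 + cnj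
        b38 * d38 + cnj b45 * d45 + cnj b46 * d46 + cnj b47 * d47 + cnj b48 * d48 + cnj b56 * d56 +
        cnj b57 * d57 + cnj b58 * d58 + cnj b67 * d67 + cnj b68 * d68 + cnj b78 * d78)"
  unfolding skew_freud_def skew_mk_nth pherm.simps jherm_def jtau_herm_mk null_cayley_cnj
      jform_herm_mk cinner_null_cayley
  by (simp add: field_simps)

lemma pherm_skew_freud:
  assumes "skew x" "skew y" "skew x'" "skew y'"
  shows "pherm (skew_freud x y) (skew_freud x' y') = - (trace (cnjm x ** x') + trace (cnjm y ** y')) / 2"
proof -
  have *: "trace (cnjm x ** x') = - 2 * (cnj (x$1$2) * x'$1$2 + cnj (x$1$3) * x'$1$3 + cnj (x$1$4) *
      x'$1$4 + cnj (x$1$5) * x'$1$5 + cnj (x$1$6) * x'$1$6 + cnj (x$1$7) * x'$1$7 + cnj (x$1$8) *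
      x'$1$8 + cnj (x$2$3) * x'$2$3 + cnj (x$2$4) * x'$2$4 + cnj (x$2$5) * x'$2$5 + cnj (x$2$6) *
      x'$2$6 + cnj (x$2$7) * x'$2$7 + cnj (x$2$8) * x'$2$8 + cnj (x$3$4) * x'$3$4 + cnj (x$3$5) *
      x'$3$5 + cnj (x$3$6) * x'$3$6 + cnj (x$3$7) * x'$3$7 + cnj (x$3$8) * x'$3$8 + cnj (x$4$5) *
      x'$4$5 + cnj (x$4$6) * x'$4$6 + cnj (x$4$7) * x'$4$7 + cnj (x$4$8) * x'$4$8 + cnj (x$5$6) *
      x'$5$6 + cnj (x$5$7) * x'$5$7 + cnj (x$5$8) * x'$5$8 + cnj (x$6$7) * x'$6$7 + cnj (x$6$8) *
      x'$6$8 + cnj (x$7$8) * x'$7$8)" if "skew x" "skew x'" for x x'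
    unfolding trace_def matrix_matrix_mult_def vec_lambda_beta sum_8
    by (simp add: skew_lower[OF that(1)] skew_lower[OF that(2)] algebra_simps)
  show ?thesis
    unfolding *[OF assms(1,3)] *[OF assms(2,4)]
    by (subst skew_eq_skew_mk[OF assms(1)], subst skew_eq_skew_mk[OF assms(2)], subst
        skew_eq_skew_mk[OF assms(3)],
      subst skew_eq_skew_mk[OF assms(4)], subst pherm_skew_freud_skew_mk) (simp add: algebra_simps)
qed

section \<open>The fixed group\<close>

definition coords :: "freudC \<Rightarrow> (complex^8^8) \<times> (complex^8^8)" where
  "coords P = (SOME p. skew (fst p) \<and> skew (snd p) \<and> skew_freud (fst p) (snd p) = P)"

lemma coords: "skew (fst (coords P))" "skew (snd (coords P))" "skew_freud (fst (coords P)) (snd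
    (coords P)) = P"
proof -
  obtain x y where "skew x" "skew y" "P = skew_freud x y" by (rule skew_freud_surj)
  then have "\<exists>p. skew (fst p) \<and> skew (snd p) \<and> skew_freud (fst p) (snd p) = P" by auto
  from someI_ex[OF this] show "skew (fst (coords P))" "skew (snd (coords P))"
    "skew_freud (fst (coords P)) (snd (coords P)) = P"
    by (simp_all add: coords_def)
qed

lemma coords_skew_freud: "skew x \<Longrightarrow> skew y \<Longrightarrow> coords (skew_freud x y) = (x, y)"
  using skew_freud_inject[OF coords(1)[of "skew_freud x y"] coords(2)[of "skew_freud x y"]]
      coords(3)[of "skew_freud x y"]
  by (metis prod.collapse)

lemma linear_pscale_iff: "Vector_Spaces.linear pscale pscale \<alpha> \<longleftrightarrow>
    (\<forall>P Q. \<alpha> (P + Q) = \<alpha> P + \<alpha> Q) \<and> (\<forall>c P. \<alpha> (pscale c P) = pscale c (\<alpha> P))"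
  using vector_space_pscale by (simp add: Vector_Spaces.linear_iff)

lemma pscale_6: "P + P + P + P + P + P = pscale 6 P"
proof -
  interpret vector_space pscale by (rule vector_space_pscale)
  have "pscale (1 + 1 + 1 + 1 + 1 + 1) P = P + P + P + P + P + P"
    by (simp only: scale_left_distrib scale_one)
  then show ?thesis by simp
qed

lemma pscale_inverse: "c \<noteq> 0 \<Longrightarrow> pscale c P = pscale c Q \<longleftrightarrow> P = Q"
proof -
  interpret vector_space pscale by (rule vector_space_pscale)
  show "c \<noteq> 0 \<Longrightarrow> ?thesis" by simp
qed

lemma pscale_minus_1: "pscale (- 1) P = - P"
proof -
  interpret vector_space pscale by (rule vector_space_pscale)
  show ?thesis using scale_minus_left[of 1 P] by simp
qed

lemma pherm_nondegenerate:
  assumes "\<And>Q. pherm P Q = pherm P' Q"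
  shows "P = P'"
proof -
  obtain X Y \<xi> \<eta> where P: "P = (X, Y, \<xi>, \<eta>)" by (cases P)
  obtain X' Y' \<xi>' \<eta>' where P': "P' = (X', Y', \<xi>', \<eta>')" by (cases P')
  have "jform (jtau X) Z = jform (jtau X') Z" "jform (jtau Y) Z = jform (jtau Y') Z" for Z
    using assms[of "(Z, 0, 0, 0)"] assms[of "(0, Z, 0, 0)"]
    by (simp_all add: P P' jherm_def jform_simps)
  then have "jtau X = jtau X'" "jtau Y = jtau Y'"
    by (auto intro: jform_nondegenerate)
  then have "X = X'" "Y = Y'" by (metis jtau_jtau)+
  moreover have "\<xi> = \<xi>'" "\<eta> = \<eta>'"
    using assms[of "(0, 0, 1, 0)"] assms[of "(0, 0, 0, 1)"]
    by (simp_all add: P P' jherm_def jform_simps)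
  ultimately show ?thesis by (simp add: P P')
qed

lemma psymp_self: "psymp P P = 0" and psymp_flip: "psymp Q P = - psymp P Q"
  by (cases P; cases Q; simp add: psymp_def jform_commute algebra_simps)+

locale E7_element =
  fixes \<alpha> :: "freudC \<Rightarrow> freudC"
  assumes E7: "\<alpha> \<in> E7"
begin

lemma bij: "bij \<alpha>" and add: "\<alpha> (P + Q) = \<alpha> P + \<alpha> Q" and scale: "\<alpha> (pscale c P) = pscale c (\<alpha> P)"
  and herm: "pherm (\<alpha> P) (\<alpha> Q) = pherm P Q"
  using E7 unfolding E7_def IsoC_def linear_pscale_iff by blast+

lemma uminus: "\<alpha> (- P) = - \<alpha> P"
  using scale[of "- 1" P] by (simp add: pscale_minus_1)

lemma zero: "\<alpha> 0 = 0"
  using add[of 0 0] by simp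

lemma diff: "\<alpha> (P - Q) = \<alpha> P - \<alpha> Q"
  using add[of "P - Q" Q] by simp

lemma cross: "\<alpha> (pcross P Q R) = pcross (\<alpha> P) (\<alpha> Q) (\<alpha> R)"
proof -
  have "\<alpha> \<circ> pcross P Q \<circ> inv_into UNIV \<alpha> = pcross (\<alpha> P) (\<alpha> Q)"
    using E7 unfolding E7_def by blast
  then have "(\<alpha> \<circ> pcross P Q \<circ> inv_into UNIV \<alpha>) (\<alpha> R) = pcross (\<alpha> P) (\<alpha> Q) (\<alpha> R)" by simp
  then show ?thesis using bij by (simp add: bij_is_inj)
qed

lemma cubic: "\<alpha> (cubic P) = cubic (\<alpha> P)"
proof -
  have "pscale 3 (\<alpha> (cubic P)) = pscale 3 (cubic (\<alpha> P))"
    using cross[of P P P] by (simp add: pcross_cubic scale)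
  then show ?thesis by (simp add: pscale_inverse)
qed

text \<open>The symplectic form is recovered from the failure of \<open>(P \<times> Q) R\<close> to be symmetric.\<close>

lemma symp: "psymp (\<alpha> P) (\<alpha> Q) = psymp P Q"
proof -
  interpret vector_space pscale by (rule vector_space_pscale)
  have "\<alpha> (pcross P P Q - pcross Q P P) = pcross (\<alpha> P) (\<alpha> P) (\<alpha> Q) - pcross (\<alpha> Q) (\<alpha> P) (\<alpha> P)"
    by (simp add: diff cross)
  then have "pscale (psymp P Q / 8) (\<alpha> P) + pscale (psymp P Q / 4) (\<alpha> P)
      = pscale (psymp (\<alpha> P) (\<alpha> Q) / 8) (\<alpha> P) + pscale (psymp (\<alpha> P) (\<alpha> Q) / 4) (\<alpha> P)"
    unfolding pcross_swap by (simp add: psymp_self add scale zero)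
  then have "pscale (psymp P Q / 8 + psymp P Q / 4 - (psymp (\<alpha> P) (\<alpha> Q) / 8 + psymp (\<alpha> P) (\<alpha> Q) /
      4)) (\<alpha> P) = 0"
    by (simp only: scale_left_distrib scale_left_diff_distrib) simp
  then have "psymp P Q / 8 + psymp P Q / 4 - (psymp (\<alpha> P) (\<alpha> Q) / 8 + psymp (\<alpha> P) (\<alpha> Q) / 4) = 0 \<or> \<alpha>
      P = 0"
    by (simp only: scale_eq_0_iff)
  then have "psymp P Q = psymp (\<alpha> P) (\<alpha> Q) \<or> \<alpha> P = 0"
    by (simp add: field_simps)
  moreover have "psymp P Q = 0" if "\<alpha> P = 0"
  proof -
    have "P = 0" using that zero bij by (metis bij_is_inj injD)
    then show ?thesis by (cases Q) (simp add: psymp_def jform_simps zero_prod_def)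
  qed
  moreover have "psymp 0 (\<alpha> Q) = 0" by (cases "\<alpha> Q") (simp add: psymp_def jform_simps zero_prod_def)
  ultimately show ?thesis by metis
qed

lemma star: "\<alpha> (pstar P) = pstar (\<alpha> P)"
proof (rule pherm_nondegenerate)
  fix R
  obtain Q where R: "R = \<alpha> Q" using bij by (metis bij_pointE)
  have "pherm (\<alpha> (pstar P)) R = psymp P Q" by (simp add: R herm psymp_pherm)
  also have "\<dots> = pherm (pstar (\<alpha> P)) R" by (simp add: R symp flip: psymp_pherm)
  finally show "pherm (\<alpha> (pstar P)) R = pherm (pstar (\<alpha> P)) R" .
qed

end

lemma E7I:
  assumes bij: "bij \<alpha>" and add: "\<And>P Q. \<alpha> (P + Q) = \<alpha> P + \<alpha> Q"
    and scale: "\<And>c P. \<alpha> (pscale c P) = pscale c (\<alpha> P)"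
    and cubic: "\<And>P. \<alpha> (cubic P) = cubic (\<alpha> P)"
    and herm: "\<And>P Q. pherm (\<alpha> P) (\<alpha> Q) = pherm P Q"
    and star: "\<And>P. \<alpha> (pstar P) = pstar (\<alpha> P)"
  shows "\<alpha> \<in> E7"
proof -
  have symp: "psymp (\<alpha> P) (\<alpha> Q) = psymp P Q" for P Q
    by (simp add: psymp_pherm herm flip: star)
  have minus: "\<alpha> (- P) = - \<alpha> P" for P using scale[of "- 1" P] by (simp add: pscale_minus_1)
  have diff: "\<alpha> (P - Q) = \<alpha> P - \<alpha> Q" for P Q using add[of P "- Q"] minus[of Q] by simp
  have c3: "\<alpha> (pcross P P P) = pcross (\<alpha> P) (\<alpha> P) (\<alpha> P)" for P
    by (simp add: pcross_cubic scale cubic)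
  define D where "D P = pcross P P P" for P
  have D: "\<alpha> (D P) = D (\<alpha> P)" for P by (simp add: D_def c3)
  have pol: "(pcross P Q R + pcross R Q P + pcross P R Q) + (pcross P Q R + pcross R Q P + pcross P R Q)
      = D (P + Q + R) - D (P + Q) - D (P + R) - D (Q + R) + D P + D Q + D R" for P Q R
  proof -
    have r: "pcross P (Q + S) R = pcross P Q R + pcross P S R" for P Q R S
      using pcross_add(2)[of Q S P R] by (simp add: pcross_commute)
    show ?thesis
      unfolding D_def pcross_add r
      by (simp add: pcross_commute[of Q P] pcross_commute[of R P] pcross_commute[of R Q] algebra_simps)
  qed
  have cross: "\<alpha> (pcross P Q R) = pcross (\<alpha> P) (\<alpha> Q) (\<alpha> R)" for P Q R
  proof -
    define a b c where "a = pcross P Q R" and "b = pcross R Q P" and "c = pcross P R Q"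
    define a' b' c' where "a' = pcross (\<alpha> P) (\<alpha> Q) (\<alpha> R)" and "b' = pcross (\<alpha> R) (\<alpha> Q) (\<alpha> P)"
      and "c' = pcross (\<alpha> P) (\<alpha> R) (\<alpha> Q)"
    have 1: "\<alpha> ((a + b + c) + (a + b + c)) = (a' + b' + c') + (a' + b' + c')"
      unfolding a_def b_def c_def a'_def b'_def c'_def pol by (simp only: add diff D)
    have 2: "\<alpha> (a - b) = a' - b'"
      unfolding a_def b_def a'_def b'_def pcross_swap by (simp only: add scale symp)
    have "\<alpha> (pcross Q P R - pcross R P Q) = pcross (\<alpha> Q) (\<alpha> P) (\<alpha> R) - pcross (\<alpha> R) (\<alpha> P) (\<alpha> Q)"
      unfolding pcross_swap by (simp only: add scale symp)
    then have 3: "\<alpha> (a - c) = a' - c'"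
      by (simp add: a_def c_def a'_def c'_def pcross_commute)
    have "a + a + a + a + a + a = ((a + b + c) + (a + b + c)) + ((a - b) + (a - b)) + ((a - c) + (a
        - c))" for a b c :: freudC
      by (simp add: algebra_simps)
    then have "\<alpha> (a + a + a + a + a + a) = a' + a' + a' + a' + a' + a'"
      using 1 2 3 by (metis add)
    then have "pscale 6 (\<alpha> a) = pscale 6 a'" by (simp only: pscale_6 scale)
    then show ?thesis by (simp add: pscale_inverse a_def a'_def)
  qed
  have "\<alpha> \<circ> pcross P Q \<circ> inv_into UNIV \<alpha> = pcross (\<alpha> P) (\<alpha> Q)" for P Q
  proof
    fix R
    show "(\<alpha> \<circ> pcross P Q \<circ> inv_into UNIV \<alpha>) R = pcross (\<alpha> P) (\<alpha> Q) R"
      using bij by (simp add: cross bij_is_surj surj_f_inv_f)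
  qed
  then show ?thesis
    using assms unfolding E7_def IsoC_def linear_pscale_iff by blast
qed

lemma jscale_uminus: "jscale c (- X) = - jscale c X" "jscale (- c) X = - jscale c X"
  by (rule jform_nondegenerate; simp add: jform_simps)+

lemma congruence_add: "congruence A (x + y) = congruence A x + congruence A y"
  and congruence_diff: "congruence A (x - y) = congruence A x - congruence A y"
  by (simp_all add: congruence_def mat_simps)

lemma congruence_mscale: "congruence A (mscale c x) = mscale c (congruence A x)"
  by (simp add: vec_eq_iff congruence_nth mscale_nth sum_distrib_left mult_ac)

lemma cnjm_congruence: "cnjm (congruence (cmat A) x) = congruence (cmat A) (cnjm x)"
  by (simp add: vec_eq_iff congruence_nth)

lemma congruence_one: "congruence (mat 1) x = x"
  by (simp add: congruence_def transpose_mat)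

lemma congruence_uminus_left: "congruence (- A) x = congruence A x"
  by (simp add: congruence_def transpose_uminus mat_simps)

lemma cmat_one: "cmat (mat 1) = mat 1"
  by (simp add: vec_eq_iff mat_def)

lemma cmat_uminus: "cmat (- A) = - cmat A"
  by (simp add: vec_eq_iff)

lemma cmat_orthogonal: "orthogonal_matrix A \<Longrightarrow> transpose (cmat A) ** cmat A = mat 1"
  by (simp add: orthogonal_matrix_def flip: cmat_transpose cmat_mult cmat_one)

lemma congruence_triple:
  assumes "orthogonal_matrix A"
  shows "congruence (cmat A) x ** congruence (cmat A) y = congruence (cmat A) (x ** y)"
  unfolding congruence_def
  by (metis (no_types, lifting) assms cmat_orthogonal matrix_mul_assoc matrix_mul_rid)

lemma trace_congruence:
  assumes "orthogonal_matrix A"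
  shows "trace (congruence (cmat A) x) = trace x"
proof -
  have "trace (congruence (cmat A) x) = trace (transpose (cmat A) ** (cmat A ** x))"
    unfolding congruence_def by (rule trace_mul_sym)
  also have "\<dots> = trace x"
    by (simp add: matrix_mul_assoc cmat_orthogonal[OF assms])
  finally show ?thesis .
qed

lemma cubicM_eq: "cubicM x y = mscale (1/2) (pfadj y - x ** y ** x) + mscale (trace (x ** y) / 8) x"
  by (simp add: vec_eq_iff cubicM_def mscale_nth)

lemma skew_triple: "skew x \<Longrightarrow> skew y \<Longrightarrow> skew (x ** y ** (x :: 'a::comm_ring_1^'n^'n))"
  by (simp add: skew_def matrix_transpose_mul mat_simps)

lemma skew_cubicM:
  assumes "skew x" "skew y"
  shows "skew (cubicM x y)"
proof -
  have "skew (pfadj y + - (x ** y ** x))"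
    by (intro skew_plus skew_pfadj skew_ops skew_triple assms)
  then show ?thesis unfolding cubicM_eq by (auto intro!: skew_plus skew_ops assms)
qed

lemma cubicM_congruence:
  assumes "rotation_matrix A" "skew y"
  shows "cubicM (congruence (cmat A) x) (congruence (cmat A) y) = congruence (cmat A) (cubicM x y)"
proof -
  have A: "orthogonal_matrix A" "det A = 1" using assms(1) by (auto simp: rotation_matrix_def)
  have "pfadj (congruence (cmat A) y) = congruence (cmat A) (pfadj y)"
    using pfadj_congruence[OF assms(2) A(1)] by (simp add: A(2))
  then show ?thesis
    unfolding cubicM_eq
    by (simp add: congruence_triple[OF A(1)] trace_congruence[OF A(1)] congruence_add
        congruence_diff congruence_mscale)
qed

definition rho :: "real^8^8 \<Rightarrow> freudC \<Rightarrow> freudC" where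
  "rho A P = skew_freud (congruence (cmat A) (fst (coords P))) (congruence (cmat A) (snd (coords P)))"

lemma rho_skew_freud: "skew x \<Longrightarrow> skew y \<Longrightarrow> rho A (skew_freud x y) = skew_freud (congruence (cmat A) x)
    (congruence (cmat A) y)"
  by (simp add: rho_def coords_skew_freud)

lemma rho_add: "rho A (P + Q) = rho A P + rho A Q"
proof -
  obtain x y where "skew x" "skew y" "P = skew_freud x y" by (rule skew_freud_surj)
  moreover obtain x' y' where "skew x'" "skew y'" "Q = skew_freud x' y'" by (rule skew_freud_surj)
  ultimately show ?thesis
    by (simp add: rho_skew_freud congruence_add skew_plus flip: skew_freud_add)
qed

lemma rho_pscale: "rho A (pscale c P) = pscale c (rho A P)"
proof -
  obtain x y where "skew x" "skew y" "P = skew_freud x y" by (rule skew_freud_surj)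
  then show ?thesis by (simp add: rho_skew_freud congruence_mscale skew_ops flip: skew_freud_mscale)
qed

lemma rho_mult: "rho (A ** B) = rho A \<circ> rho B"
proof
  fix P
  obtain x y where "skew x" "skew y" "P = skew_freud x y" by (rule skew_freud_surj)
  then show "rho (A ** B) P = (rho A \<circ> rho B) P"
    by (simp add: rho_skew_freud cmat_mult congruence_mult skew_congruence)
qed

lemma rho_one: "rho (mat 1) = id"
proof
  fix P
  obtain x y where "skew x" "skew y" "P = skew_freud x y" by (rule skew_freud_surj)
  then show "rho (mat 1) P = id P" by (simp add: rho_skew_freud cmat_one congruence_one)
qed

lemma rho_uminus: "rho (- A) = rho A"
  by (simp add: fun_eq_iff rho_def cmat_uminus congruence_uminus_left)

lemma bij_rho: "orthogonal_matrix A \<Longrightarrow> bij (rho A)"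
  by (rule o_bij[of "rho (transpose A)"]) (simp_all add: orthogonal_matrix_def rho_one flip: rho_mult)

abbreviation "J1 \<equiv> lambda7 \<circ> gamma7"
abbreviation "J2 \<equiv> iota7 \<circ> gammaC7"

definition Gfix :: "(freudC \<Rightarrow> freudC) set" where
  "Gfix = E7_fixed J1 \<inter> E7_fixed J2"

lemma bij_J1: "bij J1" and bij_J2: "bij J2"
proof -
  have 1: "J1 (J1 P) = - P" and 2: "J2 (J2 P) = - P" for P
  proof -
    obtain x y where P: "P = skew_freud x y" by (rule skew_freud_surj)
    show "J1 (J1 P) = - P" unfolding P lambda_gamma_skew_freud by (simp add: skew_freud_uminus)
    have "mscale \<i> (mscale \<i> x) = - x" "mscale (- \<i>) (mscale (- \<i>) y) = - y" for x y :: "complex^8^8"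
      by (simp_all add: vec_eq_iff mscale_nth)
    then show "J2 (J2 P) = - P" unfolding P iota_gammaC_skew_freud by (simp add: skew_freud_uminus)
  qed
  have 3: "J1 (- P) = - J1 P" "J2 (- P) = - J2 P" for P
    using 1[of "J1 P"] 1[of P] 2[of "J2 P"] 2[of P] by metis+
  show "bij J1" by (rule o_bij[of "\<lambda>P. - J1 P"]; rule ext; use 1 3 in \<open>simp del: comp_apply add:
      comp_apply[of "\<lambda>P. - J1 P"] comp_apply[of J1 "\<lambda>P. - J1 P"]\<close>)
  show "bij J2" by (rule o_bij[of "\<lambda>P. - J2 P"]; rule ext; use 2 3 in \<open>simp del: comp_apply add:
      comp_apply[of "\<lambda>P. - J2 P"] comp_apply[of J2 "\<lambda>P. - J2 P"]\<close>)
qed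

lemma conjugation_eq_iff:
  assumes "bij \<sigma>"
  shows "\<sigma> \<circ> \<alpha> \<circ> inv_into UNIV \<sigma> = \<alpha> \<longleftrightarrow> (\<forall>P. \<alpha> (\<sigma> P) = \<sigma> (\<alpha> P))"
proof
  assume *: "\<sigma> \<circ> \<alpha> \<circ> inv_into UNIV \<sigma> = \<alpha>"
  show "\<forall>P. \<alpha> (\<sigma> P) = \<sigma> (\<alpha> P)"
  proof
    fix P
    have "(\<sigma> \<circ> \<alpha> \<circ> inv_into UNIV \<sigma>) (\<sigma> P) = \<alpha> (\<sigma> P)" by (simp only: *)
    then show "\<alpha> (\<sigma> P) = \<sigma> (\<alpha> P)" using assms by (simp add: bij_is_inj)
  qed
next
  assume *: "\<forall>P. \<alpha> (\<sigma> P) = \<sigma> (\<alpha> P)"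
  show "\<sigma> \<circ> \<alpha> \<circ> inv_into UNIV \<sigma> = \<alpha>"
  proof
    fix P
    show "(\<sigma> \<circ> \<alpha> \<circ> inv_into UNIV \<sigma>) P = \<alpha> P"
      using assms *[rule_format, of "inv_into UNIV \<sigma> P"] by (simp add: bij_is_surj surj_f_inv_f)
  qed
qed

lemma Gfix_iff: "\<alpha> \<in> Gfix \<longleftrightarrow> \<alpha> \<in> E7 \<and> (\<forall>P. \<alpha> (J1 P) = J1 (\<alpha> P)) \<and> (\<forall>P. \<alpha> (J2 P) = J2 (\<alpha> P))"
  unfolding Gfix_def E7_fixed_def
  using conjugation_eq_iff[OF bij_J1, of \<alpha>] conjugation_eq_iff[OF bij_J2, of \<alpha>] by blast

lemma rho_Gfix:
  assumes A: "rotation_matrix A"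
  shows "rho A \<in> Gfix"
proof -
  have A': "orthogonal_matrix A" using A by (simp add: rotation_matrix_def)
  have "rho A (cubic P) = cubic (rho A P)" for P
  proof -
    obtain x y where "skew x" "skew y" "P = skew_freud x y" by (rule skew_freud_surj)
    moreover have "congruence (cmat A) (- z) = - congruence (cmat A) z" for z
      by (simp add: congruence_def mat_simps)
    ultimately show ?thesis
      by (simp add: rho_skew_freud cubic_skew_freud skew_cubicM skew_ops skew_congruence
          cubicM_congruence[OF A])
  qed
  moreover have "pherm (rho A P) (rho A Q) = pherm P Q" for P Q
  proof -
    obtain x y where "skew x" "skew y" "P = skew_freud x y" by (rule skew_freud_surj)
    moreover obtain x' y' where "skew x'" "skew y'" "Q = skew_freud x' y'" by (rule skew_freud_surj)
    ultimately show ?thesis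
      by (simp add: rho_skew_freud pherm_skew_freud skew_congruence cnjm_congruence
          congruence_triple[OF A'] trace_congruence[OF A'])
  qed
  moreover have "rho A (pstar P) = pstar (rho A P)" for P
  proof -
    obtain x y where "skew x" "skew y" "P = skew_freud x y" by (rule skew_freud_surj)
    moreover have "congruence (cmat A) (- z) = - congruence (cmat A) z" for z
      by (simp add: congruence_def mat_simps)
    ultimately show ?thesis
      by (simp add: rho_skew_freud pstar_skew_freud skew_ops cnjm_congruence)
  qed
  ultimately have "rho A \<in> E7"
    by (intro E7I bij_rho[OF A'] rho_add rho_pscale)
  moreover have "rho A (J1 P) = J1 (rho A P)" "rho A (J2 P) = J2 (rho A P)" for P
  proof -
    obtain x y where xy: "skew x" "skew y" "P = skew_freud x y" by (rule skew_freud_surj)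
    have "congruence (cmat A) (- z) = - congruence (cmat A) z" for z
      by (simp add: congruence_def mat_simps)
    then show "rho A (J1 P) = J1 (rho A P)" "rho A (J2 P) = J2 (rho A P)"
      unfolding xy(3) rho_skew_freud[OF xy(1,2)] lambda_gamma_skew_freud iota_gammaC_skew_freud
      by (simp_all add: rho_skew_freud xy skew_ops congruence_mscale)
  qed
  ultimately show ?thesis by (simp add: Gfix_iff del: comp_apply)
qed

lemma uminus_Gfix:
  assumes "\<alpha> \<in> Gfix"
  shows "uminus \<circ> \<alpha> \<in> Gfix"
proof -
  have a: "\<alpha> \<in> E7" and J: "\<alpha> (J1 P) = J1 (\<alpha> P)" "\<alpha> (J2 P) = J2 (\<alpha> P)" for P
    using assms unfolding Gfix_iff by blast+
  interpret E7_element \<alpha> by standard (rule a)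
  interpret vector_space pscale by (rule vector_space_pscale)
  have m: "cubic (- P) = - cubic P" "pstar (- P) = - pstar P" "pherm (- P) (- Q) = pherm P Q"
    "J1 (- P) = - J1 P" "J2 (- P) = - J2 P" for P Q
  proof -
    obtain x y where xy: "skew x" "skew y" "P = skew_freud x y" by (rule skew_freud_surj)
    have "jcross (- X) (- X) = jcross X X" for X by (simp add: jcross_left jcross_right)
    then show "cubic (- P) = - cubic P"
      by (cases P) (simp add: cubic_def jcross_left jcross_right jform_simps jscale_uminus)
    have "cnjm (- z) = - cnjm z" for z by (simp add: vec_eq_iff)
    then show "pstar (- P) = - pstar P"
      by (simp add: xy(3) pstar_skew_freud flip: skew_freud_uminus)
    show "pherm (- P) (- Q) = pherm P Q"
      by (cases P; cases Q) (simp add: jherm_def jtau_uminus jform_simps)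
    have "mscale c (- z) = - mscale c z" for c and z :: "complex^8^8" by (simp add: vec_eq_iff mscale_nth)
    then show "J1 (- P) = - J1 P" "J2 (- P) = - J2 P"
      unfolding xy(3) skew_freud_uminus[symmetric] lambda_gamma_skew_freud iota_gammaC_skew_freud by
          simp_all
  qed
  have "bij (uminus \<circ> \<alpha>)"
    using bij by (intro bij_comp) (auto intro: o_bij[of uminus] simp: fun_eq_iff)
  then have "uminus \<circ> \<alpha> \<in> E7"
    by (rule E7I) (simp_all add: add scale cubic herm star m)
  moreover have "(uminus \<circ> \<alpha>) (J1 P) = J1 ((uminus \<circ> \<alpha>) P)" "(uminus \<circ> \<alpha>) (J2 P) = J2 ((uminus \<circ> \<alpha>)
      P)" for P
    using J[of P] m(4,5)[of "\<alpha> P"] by simp_all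
  ultimately show ?thesis unfolding Gfix_iff by blast
qed

lemma dpf_uminus: "dpf (- x) y = - dpf x y"
proof -
  have 4: "dpf4 (- x) y i j k l = - dpf4 x y i j k l" "pf4 (- x) i j k l = pf4 x i j k l" for i j k l
    by (simp_all add: dpf4_def pf4_def algebra_simps)
  have 6: "dpf6 (- x) y i j k l m n = dpf6 x y i j k l m n" "pf6 (- x) i j k l m n = - pf6 x i j k l
      m n" for i j k l m n
    unfolding dpf6_def pf6_def 4 by (simp_all add: algebra_simps)
  show ?thesis unfolding dpf_def 6 by (simp add: algebra_simps)
qed

lemma pfadj_uminus: "pfadj (- x) = - pfadj x"
  by (simp add: vec_eq_iff pfadj_def dpf_uminus)

lemma skew_map_matrix:
  assumes "\<And>t. f (- t) = - f t" "skew x"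
  shows "skew (map_matrix f x)"
proof (rule skewI)
  fix i j
  show "map_matrix f x $ j $ i = - map_matrix f x $ i $ j"
    using skew_nth[OF assms(2), of i j] assms(1) by simp
qed

lemma skew_cmat: "skew (cmat x) \<longleftrightarrow> skew x"
  by (simp add: skew_def vec_eq_iff transpose_def flip: of_real_minus)

lemma cmat_inject: "cmat x = cmat y \<longleftrightarrow> x = y"
  by (simp add: vec_eq_iff)

lemma trace_skew: "skew x \<Longrightarrow> trace (x ** y) = - (x \<bullet> (y :: real^'n^'n))"
  by (simp add: inner_matrix skew_def mat_simps trace_def sum_negf)

lemma trace_cmat: "trace (cmat x) = of_real (trace x)"
  by (simp add: trace_def)

locale Gfix_element =
  fixes \<alpha> :: "freudC \<Rightarrow> freudC"
  assumes Gfix: "\<alpha> \<in> Gfix"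
begin

sublocale E7_element \<alpha>
  using Gfix by unfold_locales (simp add: Gfix_iff)

lemma J: "\<alpha> (J1 P) = J1 (\<alpha> P)" "\<alpha> (J2 P) = J2 (\<alpha> P)"
  using Gfix unfolding Gfix_iff by blast+

definition a :: "complex^8^8 \<Rightarrow> complex^8^8" where
  "a x = fst (coords (\<alpha> (skew_freud x 0)))"

lemma skew_a: "skew (a x)"
  by (simp add: a_def coords)

lemma a: "\<alpha> (skew_freud x 0) = skew_freud (a x) 0"
proof -
  define y where "y = snd (coords (\<alpha> (skew_freud x 0)))"
  have y: "skew y" by (simp add: y_def coords)
  have e: "\<alpha> (skew_freud x 0) = skew_freud (a x) y" by (simp add: a_def y_def coords)
  have z: "mscale c 0 = (0 :: complex^8^8)" for c by (simp add: vec_eq_iff mscale_nth)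
  have "skew_freud (mscale \<i> (a x)) (mscale (- \<i>) y) = J2 (\<alpha> (skew_freud x 0))" unfolding e
      iota_gammaC_skew_freud ..
  also have "\<dots> = \<alpha> (J2 (skew_freud x 0))" by (rule J(2)[symmetric])
  also have "\<dots> = \<alpha> (pscale \<i> (skew_freud x 0))"
    unfolding iota_gammaC_skew_freud z skew_freud_mscale[symmetric] ..
  also have "\<dots> = skew_freud (mscale \<i> (a x)) (mscale \<i> y)" by (simp add: scale e skew_freud_mscale)
  finally have "mscale (- \<i>) y = mscale \<i> y"
    using skew_freud_inject[OF skew_ops(1)[OF skew_a] skew_ops(1)[OF y] skew_ops(1)[OF skew_a]
        skew_ops(1)[OF y]] by blast
  then have "y = 0" by (simp add: vec_eq_iff mscale_nth)
  then show ?thesis using e by simp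
qed

lemma a_snd: "\<alpha> (skew_freud 0 y) = skew_freud 0 (a y)"
proof -
  have "\<alpha> (skew_freud 0 y) = \<alpha> (J1 (skew_freud y 0))" unfolding lambda_gamma_skew_freud by simp
  also have "\<dots> = J1 (skew_freud (a y) 0)" unfolding J(1) a ..
  also have "\<dots> = skew_freud 0 (a y)" unfolding lambda_gamma_skew_freud by simp
  finally show ?thesis .
qed

lemma a_skew_freud: "\<alpha> (skew_freud x y) = skew_freud (a x) (a y)"
proof -
  have "skew_freud x y = skew_freud x 0 + skew_freud 0 y" for x y by (simp flip: skew_freud_add)
  then show ?thesis by (metis a a_snd add)
qed

lemma a_eqI: "\<alpha> (skew_freud x 0) = skew_freud y 0 \<Longrightarrow> skew y \<Longrightarrow> a x = y"
  unfolding a using skew_freud_inject[OF skew_a skew_zero _ skew_zero] by blast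

lemma a_add: "a (x + y) = a x + a y"
proof (rule a_eqI)
  have "\<alpha> (skew_freud (x + y) 0) = \<alpha> (skew_freud x 0) + \<alpha> (skew_freud y 0)" by (simp flip: add
      skew_freud_add)
  then show "\<alpha> (skew_freud (x + y) 0) = skew_freud (a x + a y) 0" by (simp add: a flip: skew_freud_add)
qed (intro skew_plus skew_a)

lemma mscale_zero: "mscale c 0 = 0"
  by (simp add: vec_eq_iff mscale_nth)

lemma a_mscale: "a (mscale c x) = mscale c (a x)"
proof (rule a_eqI)
  have "\<alpha> (skew_freud (mscale c x) (mscale c 0)) = skew_freud (mscale c (a x)) (mscale c 0)"
    unfolding skew_freud_mscale scale a ..
  then show "\<alpha> (skew_freud (mscale c x) 0) = skew_freud (mscale c (a x)) 0" by (simp add: mscale_zero)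
qed (intro skew_ops skew_a)

lemma a_uminus: "a (- x) = - a x"
proof -
  have "mscale (- 1) x = - x" for x :: "complex^8^8" by (simp add: vec_eq_iff mscale_nth)
  then show ?thesis by (metis a_mscale)
qed

lemma a_diff: "a (x - y) = a x - a y"
  using a_add[of x "- y"] by (simp add: a_uminus)

lemma a_zero: "a 0 = 0"
  using a_add[of 0 0] by simp

lemma a_cnjm: "a (cnjm x) = cnjm (a x)"
proof -
  have z: "cnjm 0 = 0" by (simp add: vec_eq_iff)
  have "skew_freud 0 (- a (cnjm x)) = \<alpha> (pstar (skew_freud x 0))"
    unfolding pstar_skew_freud z a_snd a_uminus ..
  also have "\<dots> = pstar (skew_freud (a x) 0)" unfolding star a ..
  also have "\<dots> = skew_freud 0 (- cnjm (a x))" unfolding pstar_skew_freud z ..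
  finally have "- a (cnjm x) = - cnjm (a x)"
    using skew_freud_inject[OF skew_zero skew_ops(2)[OF skew_a] skew_zero skew_ops(2)[OF
        skew_ops(3)[OF skew_a]]] by blast
  then show ?thesis by simp
qed

lemma a_cubicM:
  assumes "skew x" "skew y"
  shows "a (cubicM x y) = cubicM (a x) (a y)"
proof -
  have "skew_freud (a (cubicM x y)) (a (- cubicM y x)) = \<alpha> (cubic (skew_freud x y))"
    by (simp add: cubic_skew_freud assms a_skew_freud)
  also have "\<dots> = skew_freud (cubicM (a x) (a y)) (- cubicM (a y) (a x))"
    by (simp add: cubic a_skew_freud cubic_skew_freud skew_a)
  finally show ?thesis
    using skew_freud_inject[OF skew_a skew_a skew_cubicM[OF skew_a skew_a] skew_ops(2)[OF
        skew_cubicM[OF skew_a skew_a]]] by blast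
qed

lemma a_pfadj: "skew y \<Longrightarrow> a (pfadj y) = pfadj (a y)"
proof -
  assume y: "skew y"
  have c: "cubicM 0 y = mscale (1/2) (pfadj y)" for y :: "complex^8^8"
    by (simp add: cubicM_eq mat_simps mscale_zero)
  have "mscale (1/2) (a (pfadj y)) = mscale (1/2) (pfadj (a y))"
    using a_cubicM[OF skew_zero y] by (simp add: c a_zero a_mscale)
  then show ?thesis by (simp add: vec_eq_iff mscale_nth)
qed

lemma a_triple:
  assumes "skew x" "skew y" "trace (a x ** a y) = trace (x ** y)"
  shows "a (x ** y ** x) = a x ** a y ** a x"
proof -
  have "a (cubicM x y) = mscale (1/2) (pfadj (a y) - a (x ** y ** x)) + mscale (trace (x ** y) / 8) (a x)"
    by (simp add: cubicM_eq a_add a_diff a_mscale a_pfadj assms)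
  then have "mscale (1/2) (pfadj (a y) - a (x ** y ** x)) = mscale (1/2) (pfadj (a y) - a x ** a y
      ** a x)"
    unfolding a_cubicM[OF assms(1,2)] by (simp add: cubicM_eq assms(3))
  then show ?thesis by (simp add: vec_eq_iff mscale_nth)
qed

definition b :: "real^8^8 \<Rightarrow> real^8^8" where
  "b x = (\<chi> i j. Re (a (cmat x) $ i $ j))"

lemma cmat_b: "cmat (b x) = a (cmat x)"
proof -
  have "cnjm (cmat x) = cmat x" by (simp add: vec_eq_iff)
  then have "cnj (a (cmat x) $ i $ j) = a (cmat x) $ i $ j" for i j
    using arg_cong[OF a_cnjm[of "cmat x"], of "\<lambda>z. z $ i $ j"] by simp
  then have "of_real (Re (a (cmat x) $ i $ j)) = a (cmat x) $ i $ j" for i j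
    by (metis Reals_cnj_iff of_real_Re)
  then show ?thesis by (simp add: vec_eq_iff b_def)
qed

lemma b_isometry: "skew x \<Longrightarrow> skew y \<Longrightarrow> b x \<bullet> b y = x \<bullet> y"
proof -
  assume x: "skew x" and y: "skew y"
  have h: "pherm (skew_freud (cmat x) 0) (skew_freud (cmat y) 0) = of_real (x \<bullet> y) / 2" if "skew x"
      "skew y" for x y
  proof -
    have "cnjm (cmat x) = cmat x" by (simp add: vec_eq_iff)
    then show ?thesis
      using that by (simp add: pherm_skew_freud skew_cmat skew_zero mat_simps trace_skew trace_cmat
          flip: cmat_mult)
        (simp add: trace_def)
  qed
  have s: "skew (b x)" for x using skew_a[of "cmat x"] by (simp add: skew_cmat flip: cmat_b)
  have "of_real (b x \<bullet> b y) / 2 = (of_real (x \<bullet> y) / 2 :: complex)"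
    using herm[of "skew_freud (cmat x) 0" "skew_freud (cmat y) 0"] by (simp only: a h[OF x y] h[OF s
        s] flip: cmat_b)
  then show ?thesis by simp
qed

lemma skew_triple_isometry_b: "skew_triple_isometry b"
proof (rule skew_triple_isometry.intro)
  show "CARD(8) \<ge> 5" by simp
  show "linear b"
  proof (rule linearI)
    have 1: "cmat (x + y) = cmat x + cmat y" "cmat (c *\<^sub>R x) = mscale (of_real c) (cmat x)" for x y c
      by (simp_all add: vec_eq_iff mscale_nth)
    show "b (x + y) = b x + b y" for x y by (simp add: 1 a_add cmat_b flip: cmat_inject)
    show "b (c *\<^sub>R x) = c *\<^sub>R b x" for c x by (simp add: 1 a_mscale cmat_b flip: cmat_inject)
  qed
  have s: "skew (b x)" for x using skew_a[of "cmat x"] by (simp add: skew_cmat flip: cmat_b)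
  then show "skew (b x)" if "skew x" for x .
  show "b x \<bullet> b y = x \<bullet> y" if "skew x" "skew y" for x y using b_isometry that .
  then have "trace (a (cmat x) ** a (cmat y)) = trace (cmat x ** cmat y)" if "skew x" "skew y" for x y
    using that s by (simp add: trace_cmat trace_skew flip: cmat_b cmat_mult)
  then have "a (cmat x ** cmat y ** cmat x) = a (cmat x) ** a (cmat y) ** a (cmat x)" if "skew x"
      "skew y" for x y
    using that by (simp add: a_triple skew_cmat)
  then show "b (x ** y ** x) = b x ** b y ** b x" if "skew x" "skew y" for x y
    using that by (simp add: cmat_b cmat_mult flip: cmat_inject)
qed

theorem Gfix_classify: "\<exists>A s. rotation_matrix A \<and> s \<in> center2 \<and> \<alpha> = s \<circ> rho A"
proof -
  interpret b: skew_triple_isometry b by (rule skew_triple_isometry_b)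
  obtain A e where A: "orthogonal_matrix A" and e: "e = 1 \<or> e = -1"
    and bA: "\<And>x. skew x \<Longrightarrow> b x = e *\<^sub>R (A ** x ** transpose A)"
    using b.conjugation_by_orthogonal by blast
  have a_cmat: "a (cmat x) = mscale (of_real e) (congruence (cmat A) (cmat x))" if "skew x" for x
  proof -
    have "cmat (e *\<^sub>R y) = mscale (of_real e) (cmat y)" for y by (simp add: vec_eq_iff mscale_nth)
    then show ?thesis unfolding cmat_b[symmetric] bA[OF that]
      by (simp add: congruence_def cmat_mult cmat_transpose)
  qed
  have aA: "a x = mscale (of_real e) (congruence (cmat A) x)" if x: "skew x" for x
  proof -
    define u v :: "real^8^8" where "u = map_matrix Re x" and "v = map_matrix Im x"
    have uv: "skew u" "skew v"
      unfolding u_def v_def by (rule skew_map_matrix[OF _ x], simp)+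
    have "x = cmat u + mscale \<i> (cmat v)"
      by (simp add: vec_eq_iff mscale_nth u_def v_def complex_eq)
    moreover have "mscale c (mscale d y) = mscale d (mscale c y)" "mscale c (y + z) = mscale c y +
        mscale c z" for c d and y z :: "complex^8^8"
      by (simp_all add: vec_eq_iff mscale_nth algebra_simps)
    ultimately show ?thesis
      by (simp add: a_add a_mscale a_cmat uv congruence_add congruence_mscale)
  qed
  have e': "mscale (of_real e) y = y \<and> e = 1 \<or> mscale (of_real e) y = - y \<and> e = - 1" for y ::
      "complex^8^8"
    using e by (auto simp: vec_eq_iff mscale_nth)
  have "det A = 1"
  proof -
    define y where "y = skew_mk 0 0 0 0 0 0 0  0 0 0 0 0 0  1 0 0 0 0  0 0 0 0  1 0 0  0 0 1"
    let ?B = "cmat A" and ?y = "pfadj y"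
    have y: "skew y" unfolding y_def by (rule skew_skew_mk)
    have y12: "?y $ 1 $ 2 = 1" unfolding y_def pfadj_nth pf6_def pf4_def skew_mk_nth by simp
    have "mscale (of_real e) (congruence ?B ?y) = mscale (of_real (e * det A)) (congruence ?B ?y)"
    proof -
      have "pfadj (mscale (of_real e) z) = mscale (of_real e) (pfadj z)" for z :: "complex^8^8"
        using e'[of z] e'[of "pfadj z"] by (auto simp: pfadj_uminus)
      then have "mscale (of_real e) (congruence ?B ?y) = mscale (of_real e) (pfadj (congruence ?B y))"
        using a_pfadj[OF y] by (simp add: aA y skew_pfadj)
      then show ?thesis
        by (simp add: pfadj_congruence[OF y A] vec_eq_iff mscale_nth mult.assoc)
    qed
    then have "congruence ?B (mscale (of_real e - of_real (e * det A)) ?y) = 0"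
      by (simp add: congruence_mscale vec_eq_iff mscale_nth left_diff_distrib)
    then have "congruence (transpose ?B) (congruence ?B (mscale (of_real e - of_real (e * det A))
        ?y)) = 0"
      by (simp add: congruence_def mat_simps)
    then have "mscale (of_real e - of_real (e * det A)) ?y = 0"
      by (simp add: cmat_orthogonal[OF A] congruence_one flip: congruence_mult)
    then have "(of_real e - of_real (e * det A)) * ?y $ 1 $ 2 = 0"
      by (metis mscale_nth zero_index)
    then have "of_real (e - e * det A) = (0 :: complex)" using y12 by simp
    then have "e = e * det A" by (simp only: of_real_eq_0_iff right_minus_eq)
    then show ?thesis using e by auto
  qed
  then have R: "rotation_matrix A" using A by (simp add: rotation_matrix_def)
  define s :: "freudC \<Rightarrow> freudC" where "s = (if e = 1 then id else uminus)"
  have "\<alpha> = s \<circ> rho A"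
  proof
    fix P
    obtain x y where xy: "skew x" "skew y" "P = skew_freud x y" by (rule skew_freud_surj)
    show "\<alpha> P = (s \<circ> rho A) P"
      using e'[of "congruence (cmat A) x"] e'[of "congruence (cmat A) y"]
      by (auto simp: xy a_skew_freud aA rho_skew_freud s_def skew_freud_uminus)
  qed
  moreover have "s \<in> center2" by (simp add: s_def center2_def)
  ultimately show ?thesis using R by blast
qed

end

section \<open>The topological isomorphism\<close>

instance jordanC :: t2_space
proof
  fix X Y :: jordanC assume "X \<noteq> Y"
  then have "Rep_jordanC X \<noteq> Rep_jordanC Y" by (simp add: Rep_jordanC_inject)
  then obtain U V where "open U" "open V" "Rep_jordanC X \<in> U" "Rep_jordanC Y \<in> V" "U \<inter> V = {}"
    by (meson hausdorff)
  then show "\<exists>U V. open U \<and> open V \<and> X \<in> U \<and> Y \<in> V \<and> U \<inter> V = {}"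
    by (intro exI[of _ "Rep_jordanC -` U"] exI[of _ "Rep_jordanC -` V"]) (auto simp: open_jordanC_def)
qed

lemma continuous_on_jordanC:
  assumes "continuous_on UNIV (\<lambda>t. Rep_jordanC (f t))"
  shows "continuous_on UNIV f"
  unfolding continuous_on_open_vimage[OF open_UNIV]
proof (intro allI impI)
  fix B :: "jordanC set" assume "open B"
  then obtain V where V: "open V" "B = Rep_jordanC -` V" unfolding open_jordanC_def by blast
  have "open ((\<lambda>t. Rep_jordanC (f t)) -` V \<inter> UNIV)"
    using assms V(1) unfolding continuous_on_open_vimage[OF open_UNIV] by blast
  then show "open (f -` B \<inter> UNIV)" by (simp add: V(2) vimage_def)
qed

lemma continuous_on_cconj:
  assumes "continuous_on UNIV (x :: 't::topological_space \<Rightarrow> complex cayley)"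
  shows "continuous_on UNIV (\<lambda>t. cconj (x t))"
proof -
  have "cconj y = ((fst (fst y), - fst (snd (fst y)), - fst (snd (snd (fst y))), - snd (snd (snd
      (fst y)))), - snd y)"
    for y :: "complex cayley"
    by (cases y rule: cayley_exhaust) simp
  then show ?thesis using assms by (simp add: continuous_intros)
qed

lemma continuous_on_herm_mk:
  fixes a b c :: "'t::topological_space \<Rightarrow> complex" and x y z :: "'t \<Rightarrow> complex cayley"
  assumes "continuous_on UNIV a" "continuous_on UNIV b" "continuous_on UNIV c"
    "continuous_on UNIV x" "continuous_on UNIV y" "continuous_on UNIV z"
  shows "continuous_on UNIV (\<lambda>t. herm_mk (a t) (b t) (c t) (x t) (y t) (z t))"
proof (rule continuous_on_jordanC)
  let ?M = "\<lambda>t. Rep_jordanC (herm_mk (a t) (b t) (c t) (x t) (y t) (z t))"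
  have s: "continuous_on UNIV (\<lambda>t. cscalar (d t))" if "continuous_on UNIV d" for d :: "'t \<Rightarrow> complex"
    unfolding cscalar_def using that by (intro continuous_intros)
  have "\<forall>i j. continuous_on UNIV (\<lambda>t. ?M t $ i $ j)"
    unfolding forall_3 herm_mk.rep_eq vector_3_3 using assms by (simp add: s continuous_on_cconj)
  then have "continuous_on UNIV (\<lambda>t. \<chi> i j. ?M t $ i $ j)"
    by (intro continuous_on_vec_lambda) blast
  then show "continuous_on UNIV ?M" by simp
qed

lemma continuous_on_null_cayley:
  fixes p0 p1 p2 p3 q0 q1 q2 q3 :: "'t::topological_space \<Rightarrow> complex"
  assumes "continuous_on UNIV p0" "continuous_on UNIV p1" "continuous_on UNIV p2" "continuous_on UNIV p3"
    "continuous_on UNIV q0" "continuous_on UNIV q1" "continuous_on UNIV q2" "continuous_on UNIV q3"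
  shows "continuous_on UNIV (\<lambda>t. null_cayley (p0 t, p1 t, p2 t, p3 t) (q0 t, q1 t, q2 t, q3 t))"
  unfolding null_cayley.simps using assms by (intro continuous_intros) auto

lemma continuous_on_skew_freud:
  fixes x y :: "'t::topological_space \<Rightarrow> complex^8^8"
  assumes "continuous_on UNIV x" "continuous_on UNIV y"
  shows "continuous_on UNIV (\<lambda>t. skew_freud (x t) (y t))"
  unfolding skew_freud_def
  by (intro continuous_on_Pair continuous_on_herm_mk continuous_on_null_cayley continuous_on_minus
      continuous_on_component assms)

lemma continuous_on_center_rho:
  assumes "s \<in> center2"
  shows "continuous_on UNIV (\<lambda>A. s \<circ> rho A)"
proof (rule continuous_on_coordinatewise_then_product)
  fix P
  have c: "continuous_on UNIV (\<lambda>A. congruence (cmat A) x)" for x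
  proof -
    have "(\<lambda>A. congruence (cmat A) x) = (\<lambda>A. \<chi> i j. \<Sum>k\<in>UNIV. \<Sum>l\<in>UNIV. of_real (A$i$k) * x$k$l *
        of_real (A$j$l))"
      by (simp add: fun_eq_iff vec_eq_iff congruence_nth)
    then show ?thesis by (simp only:) (intro continuous_intros)
  qed
  have m: "continuous_on UNIV (\<lambda>A. - congruence (cmat A) x)" for x
  proof -
    have "(\<lambda>A. - congruence (cmat A) x) = (\<lambda>A. \<chi> i j. - (congruence (cmat A) x $ i $ j))"
      by (simp add: fun_eq_iff vec_eq_iff)
    then show ?thesis using c by (simp only:) (intro continuous_intros)
  qed
  show "continuous_on UNIV (\<lambda>A. (s \<circ> rho A) P)"
    using assms unfolding center2_def rho_def
    by (auto simp: skew_freud_uminus[symmetric] intro!: continuous_on_skew_freud c m)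
qed

lemma carrier_SO8: "carrier SO8 = {A. rotation_matrix A}"
  by (simp add: SO8_def)

lemma compact_SO8: "compact (carrier SO8)"
proof -
  have "closed {A :: real^8^8. transpose A ** A = mat 1 \<and> det A = 1}"
  proof (intro closed_Collect_conj closed_Collect_eq)
    show "continuous_on UNIV (\<lambda>A :: real^8^8. transpose A ** A)"
      unfolding matrix_matrix_mult_def transpose_def by (simp, intro continuous_intros)
    show "continuous_on UNIV (\<lambda>A :: real^8^8. det A)"
      unfolding det_def by (intro continuous_intros)
  qed (rule continuous_on_const)+
  moreover have "bounded {A :: real^8^8. transpose A ** A = mat 1 \<and> det A = 1}"
  proof (rule boundedI)
    fix A :: "real^8^8" assume "A \<in> {A. transpose A ** A = mat 1 \<and> det A = 1}"
    then have "(norm A)\<^sup>2 = 8" by (simp add: power2_norm_eq_inner inner_matrix trace_I)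
    then show "norm A \<le> sqrt 8" by (simp add: real_le_rsqrt)
  qed
  ultimately show ?thesis
    by (simp add: carrier_SO8 rotation_matrix_def orthogonal_matrix compact_eq_bounded_closed)
qed

lemma commuting_skew_unit:
  fixes M :: "real^'n::finite^'n"
  assumes n: "CARD('n) \<ge> 3" and e: "e = 1 \<or> e = - 1" and M: "M \<noteq> 0"
    and c: "\<And>i j. M ** skew_unit i j = e *\<^sub>R (skew_unit i j ** M)"
  shows "e = 1 \<and> (\<exists>c. M = c *\<^sub>R mat 1)"
proof -
  have fresh: "\<exists>j. j \<noteq> i \<and> j \<noteq> k" for i k :: 'n
  proof -
    have "card {i, k} < CARD('n)" using n card_length[of "[i, k]"] by simp
    then have "{i, k} \<noteq> UNIV" by auto
    then show ?thesis by auto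
  qed
  have l: "(M ** skew_unit i j) $ k $ m = M$k$i * (if m = j then 1 else 0) - M$k$j * (if m = i then
      1 else 0)" for i j k m
  proof -
    have "(M ** skew_unit i j) $ k $ m = (\<Sum>p\<in>UNIV. (if p = i then M$k$i * (if m = j then 1 else 0) else 0)
        - (if p = j then M$k$j * (if m = i then 1 else 0) else 0))"
      unfolding matrix_matrix_mult_def vec_lambda_beta by (intro sum.cong) (auto simp: skew_unit_def
          matrix_unit_def)
    then show ?thesis by (simp add: sum_subtractf)
  qed
  have r: "(skew_unit i j ** M) $ k $ m = (if k = i then 1 else 0) * M$j$m - (if k = j then 1 else
      0) * M$i$m" for i j k m
  proof -
    have "(skew_unit i j ** M) $ k $ m = (\<Sum>p\<in>UNIV. (if p = j then (if k = i then 1 else 0) * M$j$m else 0)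
        - (if p = i then (if k = j then 1 else 0) * M$i$m else 0))"
      unfolding matrix_matrix_mult_def vec_lambda_beta by (intro sum.cong) (auto simp: skew_unit_def
          matrix_unit_def)
    then show ?thesis by (simp add: sum_subtractf)
  qed
  have e2: "M$k$i * (if m = j then 1 else 0) - M$k$j * (if m = i then 1 else 0)
      = e * ((if k = i then 1 else 0) * M$j$m - (if k = j then 1 else 0) * M$i$m)" for i j k m
    using arg_cong[OF c[of i j], of "\<lambda>z. z $ k $ m"] by (simp only: l r vector_scaleR_component
        real_scaleR_def)
  have off: "M$k$i = 0" if "k \<noteq> i" for i k
  proof -
    obtain j where "j \<noteq> i" "j \<noteq> k" using fresh by blast
    then show ?thesis using e2[of k i j j] that by simp
  qed
  have d: "M$i$i = e * M$j$j" if "i \<noteq> j" for i j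
    using e2[of i i j j] that by simp
  have d1: "M$i$i = M$j$j" if "i \<noteq> j" for i j
  proof -
    obtain k where k: "k \<noteq> i" "k \<noteq> j" using fresh by blast
    have "M$i$i = e * (e * M$j$j)" using d[of i k] d[of k j] k by simp
    then show ?thesis using e by auto
  qed
  have "e = 1"
  proof (rule ccontr)
    assume "e \<noteq> 1"
    then have "M$i$i = 0" for i
    proof -
      obtain j where "j \<noteq> i" using fresh by blast
      then show ?thesis using d[of i j] d1[of i j] e \<open>e \<noteq> 1\<close> by auto
    qed
    then have "M$i$j = 0" for i j using off by (cases "i = j") auto
    then show False using M by (simp add: vec_eq_iff)
  qed
  moreover obtain i0 :: 'n where True by simp
  have "M$i$i = M$i0$i0" for i using d1[of i i0] by (cases "i = i0") auto
  then have "M = M$i0$i0 *\<^sub>R mat 1"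
    using off by (auto simp: vec_eq_iff mat_def)
  ultimately show ?thesis by blast
qed

lemma rho_eq_iff:
  assumes A: "rotation_matrix A" and B: "rotation_matrix B" and s: "s \<in> center2" "t \<in> center2"
  shows "s \<circ> rho A = t \<circ> rho B \<longleftrightarrow> s = t \<and> (A = B \<or> A = - B)"
proof
  assume eq: "s \<circ> rho A = t \<circ> rho B"
  define e :: real where "e = (if s = t then 1 else - 1)"
  have e: "e = 1 \<or> e = - 1" by (simp add: e_def)
  have AO: "transpose A ** A = mat 1" "A ** transpose A = mat 1" and BO: "transpose B ** B = mat 1"
      "B ** transpose B = mat 1"
    using A B by (simp_all add: rotation_matrix_def orthogonal_matrix_def)
  define M where "M = transpose B ** A"
  have st: "id \<noteq> (uminus :: freudC \<Rightarrow> freudC)"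
  proof
    assume "id = (uminus :: freudC \<Rightarrow> freudC)"
    then have "(0, 0, 1, 0) = (- (0, 0, 1, 0) :: freudC)" by (metis id_apply)
    then show False by simp
  qed
  have c: "congruence A x = e *\<^sub>R congruence B x" if x: "skew x" for x
  proof -
    have sx: "skew (cmat x)" using x by (simp add: skew_cmat)
    have "(s \<circ> rho A) (skew_freud (cmat x) 0) = (t \<circ> rho B) (skew_freud (cmat x) 0)" by (simp only: eq)
    then have "s (skew_freud (congruence (cmat A) (cmat x)) 0) = t (skew_freud (congruence (cmat B)
        (cmat x)) 0)"
      by (simp add: rho_skew_freud sx skew_zero congruence_def mat_simps)
    moreover have m: "skew_freud (- u) 0 = - skew_freud u 0" for u using skew_freud_uminus[of u 0] by simp
    ultimately have "skew_freud (congruence (cmat A) (cmat x)) 0 = skew_freud (if s = t then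
        congruence (cmat B) (cmat x) else - congruence (cmat B) (cmat x)) 0"
      unfolding if_distrib[of "\<lambda>u. skew_freud u 0"] m
      using s st unfolding center2_def by (auto simp: eq_neg_iff_add_eq_0 neg_eq_iff_add_eq_0)
    then have "congruence (cmat A) (cmat x) = (if s = t then congruence (cmat B) (cmat x) else -
        congruence (cmat B) (cmat x))"
      using skew_freud_inject[OF skew_congruence[OF sx] skew_zero _ skew_zero, of "if s = t then
          congruence (cmat B) (cmat x) else - congruence (cmat B) (cmat x)" "cmat A"]
        skew_congruence[OF sx, of "cmat B"] skew_ops(2)[OF skew_congruence[OF sx, of "cmat B"]] by
            (auto split: if_splits)
    moreover have "cmat (congruence C x) = congruence (cmat C) (cmat x)" for C
      by (simp add: congruence_def cmat_mult cmat_transpose)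
    moreover have "cmat (e *\<^sub>R y) = (if s = t then cmat y else - cmat y)" for y
      by (simp add: e_def vec_eq_iff)
    ultimately have "cmat (congruence A x) = cmat (e *\<^sub>R congruence B x)" by simp
    then show ?thesis by (simp only: cmat_inject)
  qed
  have comm: "M ** skew_unit i j = e *\<^sub>R (skew_unit i j ** M)" for i j
  proof -
    have "A ** skew_unit i j ** transpose A = e *\<^sub>R (B ** skew_unit i j ** transpose B)"
      using c[OF skew_skew_unit] by (simp add: congruence_def)
    then have "transpose B ** (A ** skew_unit i j ** transpose A) ** A = transpose B ** (e *\<^sub>R (B **
        skew_unit i j ** transpose B)) ** A"
      by simp
    then have "transpose B ** A ** skew_unit i j ** (transpose A ** A) = e *\<^sub>R ((transpose B ** B)
        ** skew_unit i j ** transpose B ** A)"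
      by (simp only: matrix_mul_assoc scalar_matrix_assoc [symmetric] matrix_scalar_ac)
    then show ?thesis by (simp add: AO BO M_def matrix_mul_assoc)
  qed
  have MM: "transpose M ** M = mat 1"
    by (simp add: M_def matrix_transpose_mul) (metis AO BO matrix_mul_assoc matrix_mul_rid)
  have "M \<noteq> 0"
  proof
    assume "M = 0"
    then have "(mat 1 :: real^8^8) $ 1 $ 1 = 0" using MM by (simp add: mat_simps)
    then show False by (simp add: mat_def)
  qed
  then have 1: "e = 1" and "\<exists>d. M = d *\<^sub>R mat 1"
    using commuting_skew_unit[of e M] e comm by auto
  then obtain d where d: "M = d *\<^sub>R mat 1" by blast
  have "transpose M = M" by (auto simp: d vec_eq_iff transpose_def mat_def)
  then have "transpose M ** M = (d * d) *\<^sub>R mat 1"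
    unfolding d by (simp add: matrix_scalar_ac flip: scalar_matrix_assoc)
  then have "((d * d) *\<^sub>R (mat 1 :: real^8^8)) $ 1 $ 1 = (mat 1 :: real^8^8) $ 1 $ 1"
    using MM by simp
  then have "d * d = 1" by (simp add: mat_def)
  then have "d = 1 \<or> d = - 1" by (simp add: square_eq_1_iff)
  moreover have "A = B ** M" by (simp add: M_def matrix_mul_assoc BO)
  then have "A = d *\<^sub>R B" unfolding d by (simp add: matrix_scalar_ac flip: scalar_matrix_assoc)
  ultimately show "s = t \<and> (A = B \<or> A = - B)" using 1 by (auto simp: e_def split: if_splits)
qed (use rho_uminus in auto)

abbreviation "pm_one \<equiv> {mat 1, - mat 1 :: real^8^8}"

lemma coset_SO8: "pm_one #>\<^bsub>SO8\<^esub> A = {A, - A}"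
  by (auto simp: r_coset_def SO8_def mat_simps)

lemma carrier_quotient: "carrier (SO8 Mod pm_one) = (\<lambda>A. {A, - A}) ` carrier SO8"
  by (auto simp: FactGroup_def RCOSETS_def coset_SO8)

lemma set_mult_cosets: "{A, - A} <#>\<^bsub>SO8\<^esub> {B, - B} = {A ** B, - (A ** B)}"
  by (auto simp: set_mult_def SO8_def mat_simps)

lemma rotation_matrix_mult: "rotation_matrix A \<Longrightarrow> rotation_matrix B \<Longrightarrow> rotation_matrix (A ** (B ::
    real^'n^'n))"
  by (simp add: rotation_matrix_def orthogonal_matrix_mul det_mul)

definition rep_map :: "(real^8^8) set \<times> (freudC \<Rightarrow> freudC) \<Rightarrow> freudC \<Rightarrow> freudC" where
  "rep_map p = snd p \<circ> rho (SOME A. A \<in> fst p)"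

lemma rep_map: "rep_map ({A, - A}, s) = s \<circ> rho A"
proof -
  have "(SOME B. B \<in> {A, - A}) \<in> {A, - A}" by (rule someI[of _ A]) simp
  then show ?thesis using rho_uminus by (auto simp: rep_map_def)
qed

abbreviation "target \<equiv> (SO8 Mod pm_one) \<times>\<times> comp_group center2"

abbreviation "quotient_top \<equiv> coset_topology SO8 (top_of_set (carrier SO8)) pm_one"

lemma carrier_target: "carrier target = (\<lambda>A. {A, - A}) ` carrier SO8 \<times> center2"
  by (simp add: DirProd_def carrier_quotient comp_group_def)

lemma target_cases:
  assumes "p \<in> carrier target"
  obtains A s where "p = ({A, - A}, s)" "rotation_matrix A" "s \<in> center2"
  using assms unfolding carrier_target carrier_SO8 by blast

lemma center2_comp: "s \<in> center2 \<Longrightarrow> t \<in> center2 \<Longrightarrow> s \<circ> t \<in> center2"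
  by (auto simp: center2_def fun_eq_iff)

lemma rep_map_mult:
  assumes "p \<in> carrier target" "q \<in> carrier target"
  shows "p \<otimes>\<^bsub>target\<^esub> q \<in> carrier target" "rep_map (p \<otimes>\<^bsub>target\<^esub> q) = rep_map p \<circ> rep_map q"
proof -
  obtain A s where p: "p = ({A, - A}, s)" "rotation_matrix A" "s \<in> center2"
    by (rule target_cases[OF assms(1)])
  obtain B t where q: "q = ({B, - B}, t)" "rotation_matrix B" "t \<in> center2"
    by (rule target_cases[OF assms(2)])
  have pq: "p \<otimes>\<^bsub>target\<^esub> q = ({A ** B, - (A ** B)}, s \<circ> t)"
    unfolding p q by (simp add: DirProd_def comp_group_def FactGroup_def set_mult_cosets)
  show "p \<otimes>\<^bsub>target\<^esub> q \<in> carrier target"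
    unfolding pq carrier_target carrier_SO8 using p q rotation_matrix_mult center2_comp by blast
  have m: "rho A (- P) = - rho A P" for P
    using rho_pscale[of A "- 1" P] by (simp add: pscale_minus_1)
  consider "t = id" | "t = uminus" using q(3) unfolding center2_def by blast
  then have "rho A \<circ> t = t \<circ> rho A"
    by cases (simp_all add: comp_def m)
  then show "rep_map (p \<otimes>\<^bsub>target\<^esub> q) = rep_map p \<circ> rep_map q"
    unfolding pq unfolding p q rep_map rho_mult by (metis comp_assoc)
qed

lemma rep_map_image: "rep_map ` carrier target = Gfix"
proof
  show "rep_map ` carrier target \<subseteq> Gfix"
  proof
    fix \<alpha> assume "\<alpha> \<in> rep_map ` carrier target"
    then obtain p where p: "p \<in> carrier target" "\<alpha> = rep_map p" by blast
    obtain A s where "p = ({A, - A}, s)" "rotation_matrix A" "s \<in> center2"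
      by (rule target_cases[OF p(1)])
    then show "\<alpha> \<in> Gfix"
      using rho_Gfix[of A] uminus_Gfix[of "rho A"] by (auto simp: p(2) rep_map center2_def)
  qed
  show "Gfix \<subseteq> rep_map ` carrier target"
  proof
    fix \<alpha> assume "\<alpha> \<in> Gfix"
    then interpret Gfix_element \<alpha> by unfold_locales
    obtain A s where "rotation_matrix A" "s \<in> center2" "\<alpha> = s \<circ> rho A"
      using Gfix_classify by blast
    then show "\<alpha> \<in> rep_map ` carrier target"
      unfolding carrier_target carrier_SO8 by (intro image_eqI[of _ _ "({A, - A}, s)"]) (auto simp:
          rep_map)
  qed
qed

lemma inj_on_rep_map: "inj_on rep_map (carrier target)"
proof (rule inj_onI)
  fix p q assume p: "p \<in> carrier target" and q: "q \<in> carrier target" and eq: "rep_map p = rep_map q"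
  obtain A s where A: "p = ({A, - A}, s)" "rotation_matrix A" "s \<in> center2"
    by (rule target_cases[OF p])
  obtain B t where B: "q = ({B, - B}, t)" "rotation_matrix B" "t \<in> center2"
    by (rule target_cases[OF q])
  have "s \<circ> rho A = t \<circ> rho B" using eq unfolding A(1) B(1) rep_map .
  then show "p = q" using rho_eq_iff[OF A(2) B(2) A(3) B(3)] by (auto simp: A(1) B(1))
qed

lemma topspace_quotient_top: "topspace quotient_top = carrier (SO8 Mod pm_one)"
proof
  show "topspace quotient_top \<subseteq> carrier (SO8 Mod pm_one)"
    using openin_topspace[of quotient_top] by (simp only: openin_coset_topology)
  have "{x \<in> carrier SO8. pm_one #>\<^bsub>SO8\<^esub> x \<in> carrier (SO8 Mod pm_one)} = carrier SO8"
    by (auto simp: carrier_quotient coset_SO8)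
  then have "openin quotient_top (carrier (SO8 Mod pm_one))"
    unfolding openin_coset_topology topspace_euclidean_subtopology by simp
  then show "carrier (SO8 Mod pm_one) \<subseteq> topspace quotient_top" by (rule openin_subset)
qed

lemma compact_quotient_top: "compact_space quotient_top"
proof -
  let ?q = "\<lambda>A. pm_one #>\<^bsub>SO8\<^esub> A"
  have "continuous_map (top_of_set (carrier SO8)) quotient_top ?q"
    unfolding continuous_map_def topspace_quotient_top
    by (auto simp: openin_coset_topology carrier_quotient coset_SO8)
  moreover have "compactin (top_of_set (carrier SO8)) (carrier SO8)"
    using compact_SO8 by (simp add: compactin_subtopology)
  ultimately have "compactin quotient_top (?q ` carrier SO8)" by (intro image_compactin)
  then show ?thesis
    by (simp add: compact_space_def topspace_quotient_top carrier_quotient coset_SO8)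
qed

lemma Hausdorff_space_operators: "Hausdorff_space (euclidean :: ('b \<Rightarrow> 'a::t2_space) topology)"
  unfolding Hausdorff_space_def
proof (intro allI impI)
  fix f g :: "'b \<Rightarrow> 'a" assume "f \<in> topspace euclidean \<and> g \<in> topspace euclidean \<and> f \<noteq> g"
  then obtain P where "f P \<noteq> g P" by auto
  then obtain U V where UV: "open U" "open V" "f P \<in> U" "g P \<in> V" "U \<inter> V = {}" by (meson hausdorff)
  have c: "continuous_on UNIV (\<lambda>f :: 'b \<Rightarrow> 'a. f P)" by (rule continuous_on_product_coordinates)
  have "open ((\<lambda>f. f P) -` W)" if "open W" for W :: "'a set"
    using open_vimage[OF that c] .
  then show "\<exists>U V. openin euclidean U \<and> openin euclidean V \<and> f \<in> U \<and> g \<in> V \<and> disjnt U V"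
    using UV by (intro exI[of _ "(\<lambda>f. f P) -` U"] exI[of _ "(\<lambda>f. f P) -` V"]) (auto simp: disjnt_def)
qed

lemma openin_center2: "openin (top_of_set center2) {s}" if "s \<in> center2"
proof -
  have "Hausdorff_space (top_of_set center2)"
    by (rule Hausdorff_space_subtopology[OF Hausdorff_space_operators])
  moreover have "finite center2" by (simp add: center2_def)
  ultimately have "top_of_set center2 = discrete_topology center2"
    using finite_topspace_imp_discrete_topology[of "top_of_set center2"] Hausdorff_imp_t1_space by simp
  then show ?thesis using that by simp
qed

lemma continuous_map_rep_map:
  "continuous_map (prod_topology quotient_top (top_of_set center2)) (top_of_set Gfix) rep_map"
  unfolding continuous_map_in_subtopology continuous_map_def[of _ euclidean]
proof (intro conjI allI impI)
  have t: "topspace (prod_topology quotient_top (top_of_set center2)) = carrier target"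
    unfolding carrier_target by (simp add: topspace_quotient_top carrier_quotient)
  show "rep_map \<in> topspace (prod_topology quotient_top (top_of_set center2)) \<rightarrow> topspace euclidean" by simp
  show "rep_map \<in> topspace (prod_topology quotient_top (top_of_set center2)) \<rightarrow> Gfix"
    unfolding t using rep_map_image by blast
  fix U :: "(freudC \<Rightarrow> freudC) set" assume "openin euclidean U"
  then have U: "open U" by simp
  have "openin quotient_top {C \<in> carrier (SO8 Mod pm_one). rep_map (C, s) \<in> U}" if "s \<in> center2" for s
  proof -
    have "open ((\<lambda>A. s \<circ> rho A) -` U)"
      using open_vimage[OF U continuous_on_center_rho[OF that]] .
    then have "openin (top_of_set (carrier SO8)) (carrier SO8 \<inter> (\<lambda>A. s \<circ> rho A) -` U)" by (rule
        openin_open_Int)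
    moreover have "{x \<in> carrier SO8. pm_one #>\<^bsub>SO8\<^esub> x \<in> {C \<in> carrier (SO8 Mod pm_one). rep_map (C,
        s) \<in> U}}
        = carrier SO8 \<inter> (\<lambda>A. s \<circ> rho A) -` U"
      unfolding coset_SO8 carrier_quotient by (auto simp: rep_map simp del: comp_apply)
    ultimately show ?thesis
      unfolding openin_coset_topology topspace_euclidean_subtopology by auto
  qed
  then have "openin (prod_topology quotient_top (top_of_set center2))
      ({C \<in> carrier (SO8 Mod pm_one). rep_map (C, s) \<in> U} \<times> {s})" if "s \<in> center2" for s
    unfolding openin_prod_Times_iff using that openin_center2 by blast
  then have "openin (prod_topology quotient_top (top_of_set center2))
      (\<Union>s\<in>center2. {C \<in> carrier (SO8 Mod pm_one). rep_map (C, s) \<in> U} \<times> {s})" by blast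
  moreover have "(\<Union>s\<in>center2. {C \<in> carrier (SO8 Mod pm_one). rep_map (C, s) \<in> U} \<times> {s})
      = {p \<in> topspace (prod_topology quotient_top (top_of_set center2)). rep_map p \<in> U}"
    by (auto simp: topspace_quotient_top)
  ultimately show "openin (prod_topology quotient_top (top_of_set center2))
      {p \<in> topspace (prod_topology quotient_top (top_of_set center2)). rep_map p \<in> U}" by simp
qed

lemma homeomorphic_map_rep_map:
  "homeomorphic_map (prod_topology quotient_top (top_of_set center2)) (top_of_set Gfix) rep_map"
proof (rule continuous_imp_homeomorphic_map[OF continuous_map_rep_map])
  have t: "topspace (prod_topology quotient_top (top_of_set center2)) = carrier target"
    unfolding carrier_target by (simp add: topspace_quotient_top carrier_quotient)
  have "compact_space (top_of_set center2)"
    by (rule compact_space_subtopology) (simp add: center2_def finite_imp_compact)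
  then show "compact_space (prod_topology quotient_top (top_of_set center2))"
    using compact_quotient_top by (simp add: compact_space_prod_topology)
  show "Hausdorff_space (top_of_set Gfix)"
    by (rule Hausdorff_space_subtopology[OF Hausdorff_space_operators])
  show "rep_map ` topspace (prod_topology quotient_top (top_of_set center2)) = topspace (top_of_set Gfix)"
    unfolding t by (simp only: rep_map_image topspace_euclidean_subtopology)
  show "inj_on rep_map (topspace (prod_topology quotient_top (top_of_set center2)))"
    unfolding t by (rule inj_on_rep_map)
qed

theorem theorem4p13p7:
  shows "top_group_iso
    (comp_group (E7_fixed (lambda7 \<circ> gamma7) \<inter> E7_fixed (iota7 \<circ> gammaC7)))
    (top_of_set (E7_fixed (lambda7 \<circ> gamma7) \<inter> E7_fixed (iota7 \<circ> gammaC7)))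
    ((SO8 Mod {mat 1, - mat 1}) \<times>\<times> comp_group center2)
    (prod_topology
      (coset_topology SO8 (top_of_set (carrier SO8)) {mat 1, - mat 1})
      (top_of_set center2))"
  unfolding Gfix_def [symmetric] top_group_iso_def
proof -
  obtain h where h: "homeomorphic_maps (prod_topology quotient_top (top_of_set center2)) (top_of_set
      Gfix) rep_map h"
    using homeomorphic_map_rep_map unfolding homeomorphic_map_maps by blast
  have t: "topspace (prod_topology quotient_top (top_of_set center2)) = carrier target"
    unfolding carrier_target by (simp add: topspace_quotient_top carrier_quotient)
  have h1: "h (rep_map p) = p" if "p \<in> carrier target" for p
  proof -
    have "\<forall>x\<in>carrier target. h (rep_map x) = x"
      using h unfolding homeomorphic_maps_map t by (elim conjE)
    then show ?thesis by (rule bspec) (rule that)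
  qed
  have h2: "h \<alpha> \<in> carrier target" "rep_map (h \<alpha>) = \<alpha>" if "\<alpha> \<in> Gfix" for \<alpha>
  proof -
    have "\<alpha> \<in> rep_map ` carrier target" using that by (simp only: rep_map_image)
    then obtain p where "\<alpha> = rep_map p" "p \<in> carrier target" by (rule imageE)
    then show "h \<alpha> \<in> carrier target" "rep_map (h \<alpha>) = \<alpha>" by (simp_all only: h1)
  qed
  have bij: "bij_betw h Gfix (carrier target)"
  proof (rule bij_betw_byWitness[where f' = rep_map])
    show "h ` Gfix \<subseteq> carrier target" by (rule image_subsetI) (rule h2)
    show "\<forall>\<alpha>\<in>Gfix. rep_map (h \<alpha>) = \<alpha>" by (rule ballI) (rule h2)
    show "\<forall>p\<in>carrier target. h (rep_map p) = p" by (rule ballI) (rule h1)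
    show "rep_map ` carrier target \<subseteq> Gfix" by (simp only: rep_map_image subset_refl)
  qed
  have "h (\<alpha> \<circ> \<beta>) = h \<alpha> \<otimes>\<^bsub>target\<^esub> h \<beta>" if "\<alpha> \<in> Gfix" "\<beta> \<in> Gfix" for \<alpha> \<beta>
    using h1[OF rep_map_mult(1)[OF h2(1)[OF that(1)] h2(1)[OF that(2)]]]
    by (simp only: rep_map_mult(2)[OF h2(1)[OF that(1)] h2(1)[OF that(2)]] h2(2)[OF that(1)]
        h2(2)[OF that(2)])
  moreover have "carrier (comp_group Gfix) = Gfix" "\<alpha> \<otimes>\<^bsub>comp_group Gfix\<^esub> \<beta> = \<alpha> \<circ> \<beta>" for \<alpha> \<beta>
    by (simp_all add: comp_group_def)
  ultimately have "h \<in> iso (comp_group Gfix) target"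
    unfolding iso_def hom_def using bij h2(1) by (simp only: mem_Collect_eq Pi_iff) blast
  moreover have "homeomorphic_map (top_of_set Gfix) (prod_topology quotient_top (top_of_set center2)) h"
    using h unfolding homeomorphic_maps_map by blast
  ultimately show "\<exists>f\<in>iso (comp_group Gfix) target.
      homeomorphic_map (top_of_set Gfix) (prod_topology quotient_top (top_of_set center2)) f" by blast
qed

end
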